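(* For every $\mathfrak{m}\in\mathcal{P}_2(2k)$ and every $d>6k^{7/2}$, $$\frac{\#P(\mathfrak{m},|\mathfrak{m}|)}{1-\frac{k-1}{2d^2}}\le(2d)^{|\mathfrak{m}|+k}\,|\mathrm{Wg}^{\mathrm{Sp}}(\mathfrak{m},d)|\le\frac{\#P(\mathfrak{m},|\mathfrak{m}|)}{1-\frac{6k^{7/2}}{d}}.$$
   Context: $\mathcal{P}_2(2k)$ is the set of pair partitions of $\{1,\dots,2k\}$; $\mathcal{P}_2(0)=\{\emptyset\}$; $S_{2k}$ acts on it by applying the permutation to every element of every block. The coset-type of $\mathfrak{m}$ is the partition $\mu$ of $k$ such that the connected components of the graph on $\{1,\dots,2k\}$ whose edges are the blocks of $\mathfrak{e}_k=\{1,2\}\cdots\{2k-1,2k\}$ and of $\mathfrak{m}$ have sizes $2\mu_1,2\mu_2,\dots$; $|\mathfrak{m}|=k-\ell(\mu)$. The orthogonal Weingarten function $\mathrm{Wg}^{\mathrm{O}}(\mathfrak{m},d)=\int_{\mathrm{O}(d)}u_{i_1j_1}\cdots u_{i_{2k}j_{2k}}\,d\mu(U)$ (for integers $d\ge2k$, $\mu$ Haar probability on $\mathrm{O}(d)$, $\mathbf{i}$ with $i_r=i_s\iff\{r,s\}\in\mathfrak{e}_k$, $\mathbf{j}$ with $j_r=j_s\iff\{r,s\}\in\mathfrak{m}$, for $r\neq s$) is a rational function of $d$. The symplectic Weingarten function $\mathrm{Wg}^{\mathrm{Sp}}(\mathfrak{m},d)$ of the compact symplectic group $\mathrm{Sp}(d)=\{g\in\mathrm{U}(2d):gJ=Jg\}$,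 $J=\begin{pmatrix}0&I_d\\-I_d&0\end{pmatrix}$, satisfies $\pm\mathrm{Wg}^{\mathrm{Sp}}(\mathfrak{m},d)=\mathrm{Wg}^{\mathrm{O}}(\mathfrak{m},-2d)$ up to sign (the rational function evaluated at $-2d$). The orthogonal Weingarten graph has vertex set $\bigsqcup_{k\ge0}\mathcal{P}_2(2k)$, a solid arrow $\mathfrak{m}\to(i,2k-1).\mathfrak{m}$ for every $\mathfrak{m}\in\mathcal{P}_2(2k)$ and $1\le i<2k-1$, and a dashed arrow $\mathfrak{m}\dashrightarrow\mathfrak{m}^{\downarrow}$ whenever $\{2k-1,2k\}\in\mathfrak{m}$, with $\mathfrak{m}^{\downarrow}$ being $\mathfrak{m}$ with that block removed. $P(\mathfrak{m},l)$ is the set of paths $(\mathfrak{m}_0=\mathfrak{m},\dots,\mathfrak{m}_{l+k}=\emptyset)$ following arrows at each step, using $l$ solid and $k$ dashed arrows.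
   Formalization: The compact symplectic group is taken as the unitary g with gJ = J·conj(g); the literal matrix condition gJ = Jg would give a copy of U(d)×U(d), where these integrals vanish and the relation to the orthogonal Weingarten function fails. *)

theory Defs
  imports "HOL-Analysis.Analysis" "HOL-Probability.Probability" "HOL-Library.Disjoint_Sets"
    "HOL-Library.Multiset" "HOL-Combinatorics.Transposition"
begin

section \<open>Pair partitions and coset-type\<close>

definition pair_partitions :: "nat \<Rightarrow> nat set set set" where
  "pair_partitions n = {m. partition_on {1..n} m \<and> (\<forall>B\<in>m. card B = 2)}"

definition std_pairing :: "nat \<Rightarrow> nat set set" where
  "std_pairing k = (\<lambda>a. {2 * a - 1, 2 * a}) ` {1..k}"

definition perm_act :: "(nat \<Rightarrow> nat) \<Rightarrow> nat set set \<Rightarrow> nat set set" where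
  "perm_act \<pi> m = (\<lambda>B. \<pi> ` B) ` m"

definition pairing_graph :: "nat \<Rightarrow> nat set set \<Rightarrow> (nat \<times> nat) set" where
  "pairing_graph k m = {(r, s). {r, s} \<in> std_pairing k \<union> m}"

definition pairing_components :: "nat \<Rightarrow> nat set set \<Rightarrow> nat set set" where
  "pairing_components k m = {1..2 * k} // (pairing_graph k m)\<^sup>*"

text \<open>Integer partitions are represented as multisets of their parts, so that the length of a
  partition is the size of the multiset.\<close>

definition coset_type :: "nat \<Rightarrow> nat set set \<Rightarrow> nat multiset" where
  "coset_type k m = image_mset (\<lambda>C. card C div 2) (mset_set (pairing_components k m))"

definition pairing_norm :: "nat \<Rightarrow> nat set set \<Rightarrow> nat" where
  "pairing_norm k m = k - size (coset_type k m)"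


section \<open>The orthogonal Weingarten graph\<close>

text \<open>A vertex is just a pair partition; its level is determined by the partition, because
  distinct levels partition distinct ground sets.\<close>

definition solid_arrow :: "nat set set \<Rightarrow> nat set set \<Rightarrow> bool" where
  "solid_arrow m n \<longleftrightarrow> (\<exists>k i. m \<in> pair_partitions (2 * k) \<and> 1 \<le> i \<and> i < 2 * k - 1 \<and>
     n = perm_act (Transposition.transpose i (2 * k - 1)) m)"

definition dashed_arrow :: "nat set set \<Rightarrow> nat set set \<Rightarrow> bool" where
  "dashed_arrow m n \<longleftrightarrow> (\<exists>k. m \<in> pair_partitions (2 * k) \<and> {2 * k - 1, 2 * k} \<in> m \<and>
     n = m - {{2 * k - 1, 2 * k}})"

text \<open>Paths are recorded by their vertex sequences, as lists of length \<open>l + k + 1\<close>.\<close>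

definition weingarten_paths :: "nat \<Rightarrow> nat set set \<Rightarrow> nat \<Rightarrow> nat set set list set" where
  "weingarten_paths k m l = {xs. length xs = l + k + 1 \<and> xs ! 0 = m \<and> xs ! (l + k) = {} \<and>
     (\<forall>t < l + k. solid_arrow (xs ! t) (xs ! Suc t) \<or> dashed_arrow (xs ! t) (xs ! Suc t)) \<and>
     card {t. t < l + k \<and> solid_arrow (xs ! t) (xs ! Suc t)} = l \<and>
     card {t. t < l + k \<and> dashed_arrow (xs ! t) (xs ! Suc t)} = k}"


section \<open>The compact symplectic group and its Weingarten function\<close>

text \<open>For a finite type \<open>'d\<close> with \<open>d\<close> elements, the \<open>2d\<close> coordinates are indexed by the sum
  type \<open>'d + 'd\<close>: \<open>Inl a\<close> is the coordinate \<open>a\<close> and \<open>Inr a\<close> is the coordinate \<open>d + a\<close>.\<close>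

type_synonym 'd sp_matrix = "complex ^ ('d + 'd) ^ ('d + 'd)"

definition sp_J :: "('d::finite) sp_matrix" where
  "sp_J = (\<chi> p q. case (p, q) of
      (Inl a, Inr b) \<Rightarrow> (if a = b then 1 else 0)
    | (Inr a, Inl b) \<Rightarrow> (if a = b then - 1 else 0)
    | _ \<Rightarrow> 0)"

definition unitary_group :: "(complex ^ 'n ^ 'n) set" where
  "unitary_group = {g. g ** Finite_Cartesian_Product.transpose (map_matrix cnj g) = mat 1 \<and>
                       Finite_Cartesian_Product.transpose (map_matrix cnj g) ** g = mat 1}"

text \<open>\<open>J\<close> has to be read as the antilinear quaternionic structure: \<open>g\<close> commutes with the map that
  sends \<open>v\<close> to \<open>J\<close> times the complex conjugate of \<open>v\<close>. In terms of matrices this says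
  \<open>g J = J (cnj g)\<close>; for unitary \<open>g\<close> this is the same as preservation of the symplectic form of \<open>J\<close>.
  Without the conjugation one would obtain a copy of \<open>U(d) \<times> U(d)\<close>.\<close>

definition Sp_group :: "('d::finite) sp_matrix set" where
  "Sp_group = {g \<in> unitary_group. g ** sp_J = sp_J ** map_matrix cnj g}"

definition haar_probability_Sp :: "('d::finite) sp_matrix measure \<Rightarrow> bool" where
  "haar_probability_Sp M \<longleftrightarrow> prob_space M \<and> sets M = sets (restrict_space borel Sp_group) \<and>
     (\<forall>h \<in> Sp_group. distr M M (\<lambda>g. h ** g) = M)"

text \<open>The symplectic analogue of an index sequence \<open>i\<close> with \<open>i r = i s\<close> iff \<open>{r, s}\<close> is a block:
  the symmetric form given by the identity matrix is replaced by the alternating form given by \<open>J\<close>,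
  and the two ends of a block are ordered increasingly. Since \<open>J\<close> is nondegenerate on each
  block, adapted indices are automatically pairwise distinct.\<close>

definition sp_adapted :: "nat \<Rightarrow> nat set set \<Rightarrow> (nat \<Rightarrow> ('d::finite) + 'd) \<Rightarrow> bool" where
  "sp_adapted k m i \<longleftrightarrow> (\<forall>r \<in> {1..2 * k}. \<forall>s \<in> {1..2 * k}. r < s \<longrightarrow>
     sp_J $ i r $ i s = (if {r, s} \<in> m then 1 else 0))"

text \<open>\<open>M\<close> is the Haar probability measure on the group. Adapted indices exist when \<open>k \<le> d\<close>, and
  then the integral does not depend on which ones are chosen: in the Weingarten formula it is the
  single surviving coefficient, the one for the pair of the standard pairing and \<open>m\<close>. It is the
  entry at this pair of the inverse of the symplectic Gram matrix. Other
  orientations of the blocks change it only by a sign, and up to a sign it is the rational function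
  of the orthogonal Weingarten function of \<open>m\<close> evaluated at \<open>- 2 d\<close>.\<close>

definition Wg_Sp :: "('d::finite) sp_matrix measure \<Rightarrow> nat \<Rightarrow> nat set set \<Rightarrow> complex" where
  "Wg_Sp M k m =
     (let i = (SOME i. sp_adapted k (std_pairing k) i);
          j = (SOME j. sp_adapted k m j)
      in integral\<^sup>L M (\<lambda>g. \<Prod>r = 1..2 * k. g $ i r $ j r))"

end

theory Submission
  imports Defs
begin

text \<open>
  Fix column indices \<open>j\<close> and regard the integral of \<open>\<Prod> g (i r) (j r)\<close> as a tensor in the row
  indices \<open>i\<close>. Left invariance of the Haar measure, applied to signed permutations, phases and one
  rotation, reduces row indices with a repeated coordinate to standard ones, and summing the
  last two row indices against \<open>J\<close> (where \<open>g\<^sup>T J g = J\<close>) gives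
  \<open>2d W(j) + \<Sum>\<^sub>q W(j \<circ> (q, 2k - 1)) = J(j\<^bsub>2k-1\<^esub>, j\<^bsub>2k\<^esub>) W\<^bsub>k-1\<^esub>(j)\<close>.
  After multiplication by the sign of the arrangement \<open>j\<close> all signs become positive, and the system
  has only one solution because \<open>2k - 2 < 2d\<close>; hence \<open>\<bar>Wg\<bar>\<close> is the generating series
  \<open>\<Sum>\<^sub>l #P(m, l) (2d)\<^sup>-\<^sup>(\<^sup>l\<^sup>+\<^sup>k\<^sup>)\<close>.

  The bounds compare \<open>#P(m, l)\<close> with \<open>#P(m, |m|)\<close>. A solid step splits the loop of \<open>2k - 1\<close> in the
  graph of \<open>m\<close>, reverses an arc of it, or joins it to another loop, so \<open>#P(m, |m|)\<close> is a product of Catalan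
  numbers over the loops. A reversal does not change this product and a join increases it at most by
  a factor \<open>8k\<^sup>2\<close>, which bounds the number of paths with a given excess. Going back and forth along a
  solid arrow gives the lower bound.
\<close>

text \<open>Call excess the number of solid steps beyond \<open>pairing_norm\<close>. A split uses
  its step to lower the norm and costs no excess, a reversal costs 1, a join 2, a dashed step 0.
  Geodesic steps reproduce the weight exactly, by the Catalan convolution. A geodesic has at most
  \<open>2 * k\<close> steps, and at each of them there are at most \<open>k\<close> reversals and
  \<open>2 * k\<close> joins to deviate by. A join is affordable because Catalan numbers are 4^n up
  to a polynomial factor. Together this gives a factor \<open>C\<close> per unit of excess as soon
  as \<open>C\<close> is at least 12 k^2. As each step carries the weight 1 / (2d), the ratio of the
  majorizing geometric series is C / (2d), and C = 12 k^(7/2) makes it the ratio in the statement.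
  On the group side the obstacle is that a recursion has to stay within row indices with distinct
  coordinates, while the sum of two rows against J also runs over coordinates that are in use. There
  four rows share a coordinate, and invariance under one rotation moves two of them to a coordinate
  that is still free. The correction terms are column transpositions, that is, solid arrows.\<close>

section \<open>Catalan numbers\<close>

text \<open>The index is shifted: \<open>catalan n\<close> is the Catalan number \<open>C\<^bsub>n - 1\<^esub>\<close>, the coefficient of
  \<open>x\<^sup>n\<close> in \<open>(1 - sqrt (1 - 4x)) / 2\<close> for \<open>n > 0\<close>; the junk value at \<open>0\<close> is \<open>- 1 / 2\<close>.\<close>

definition catalan :: "nat \<Rightarrow> real" where
  "catalan n = - ((1 / 2) gchoose n) * (- 4) ^ n / 2"

lemma catalan_Suc: "catalan (Suc n) = catalan n * (4 * real n - 2) / (real n + 1)"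
proof -
  have "of_nat (Suc n) * ((1 / 2 :: real) gchoose Suc n) = (1 / 2 - of_nat n) * ((1 / 2) gchoose n)"
    using gbinomial_mult_1[of "1 / 2 :: real" n] by (simp add: algebra_simps)
  then have eq: "((1 / 2 :: real) gchoose Suc n) = (1 / 2 - real n) * ((1 / 2) gchoose n) / (real n + 1)"
    by (simp add: field_simps)
  then show ?thesis
    unfolding catalan_def eq by (simp add: divide_simps) (simp add: algebra_simps)
qed

lemma catalan_1 [simp]: "catalan (Suc 0) = 1"
  by (simp add: catalan_def)

lemma catalan_ge_1: "1 \<le> catalan (Suc n)"
proof (induction n)
  case (Suc n)
  have "catalan (Suc (Suc n)) = catalan (Suc n) * ((4 * real n + 2) / (real n + 2))"
    using catalan_Suc[of "Suc n"] by (simp add: field_simps)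
  moreover have "1 \<le> (4 * real n + 2) / (real n + 2)" by (simp add: field_simps)
  ultimately show ?case using Suc mult_mono[OF Suc, of 1 "(4 * real n + 2) / (real n + 2)"] by simp
qed simp

text \<open>This is the coefficient of x^(n+1) in the square of sqrt(1 - 4x), which vanishes beyond
  degree 1; the two end terms of the Vandermonde sum give the left side. The arguments
  \<open>n - t\<close> and \<open>Suc t\<close> are the sizes of the two loops left by a
  split.\<close>

lemma catalan_convolution:
  assumes "0 < n"
  shows "catalan (Suc n) = (\<Sum>t<n. catalan (n - t) * catalan (Suc t))"
proof -
  let ?e = "\<lambda>n. ((1 / 2 :: real) gchoose n)"
  have "(\<Sum>k\<le>Suc n. ?e k * ?e (Suc n - k)) = ((1::real) gchoose Suc n)"
    using gbinomial_Vandermonde[of "1 / 2 :: real" "1 / 2" "Suc n"] by (simp add: atLeast0AtMost)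
  also have "(1::real) gchoose Suc n = 0"
    using assms gbinomial_rec[of "0::real" n] by (simp add: gbinomial_0_left)
  finally have "(\<Sum>k\<le>Suc n. ?e k * ?e (Suc n - k)) = 0" .
  moreover have "(\<Sum>k\<le>Suc n. f k) = f 0 + (\<Sum>k=1..n. f k) + f (Suc n)" for f :: "nat \<Rightarrow> real"
    by (simp add: sum.atLeast1_atMost_eq sum.atMost_shift)
  ultimately have e: "2 * ?e (Suc n) = - (\<Sum>k=1..n. ?e k * ?e (Suc n - k))"
    by simp
  have "catalan (Suc n) = - (2 * ?e (Suc n)) * (- 4) ^ Suc n / 4"
    by (simp add: catalan_def)
  also have "\<dots> = (\<Sum>k=1..n. ?e k * ?e (Suc n - k)) * (- 4) ^ Suc n / 4"
    unfolding e by simp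
  also have "\<dots> = (\<Sum>k=1..n. catalan k * catalan (Suc n - k))"
    unfolding sum_distrib_right sum_divide_distrib
  proof (rule sum.cong)
    fix k assume "k \<in> {1..n}"
    then have "(- 4 :: real) ^ Suc n = (- 4) ^ k * (- 4) ^ (Suc n - k)"
      by (simp flip: power_add)
    then show "?e k * ?e (Suc n - k) * (- 4) ^ Suc n / 4 = catalan k * catalan (Suc n - k)"
      unfolding catalan_def by (simp add: field_simps)
  qed simp
  also have "\<dots> = (\<Sum>t<n. catalan (Suc t) * catalan (n - t))"
    by (simp add: sum.atLeast1_atMost_eq)
  finally show ?thesis by (simp add: mult.commute)
qed

lemma catalan_add_le: "catalan (Suc n + b) \<le> 4 ^ b * catalan (Suc n)"
proof (induction b)
  case (Suc b)
  have "catalan (Suc n + Suc b) = catalan (Suc n + b) * ((4 * real (n + b) + 2) / (real (n + b) + 2))"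
    using catalan_Suc[of "Suc n + b"] by (simp add: field_simps)
  also have "\<dots> \<le> (4 ^ b * catalan (Suc n)) * 4"
    using Suc catalan_ge_1[of "n + b"] catalan_ge_1[of n]
    by (intro mult_mono) (simp_all add: field_simps)
  finally show ?case by (simp add: mult_ac)
qed simp

text \<open>The true factor is of order n^(3/2). The square keeps the induction step polynomial: the
  difference of its two sides is \<open>(b + 2) * 16 * b\<close>.\<close>

lemma four_power_le_catalan: "4 ^ Suc b \<le> 8 * real (Suc b) ^ 2 * catalan (Suc b)"
proof (induction b)
  case (Suc b)
  have r: "catalan (Suc b) = catalan (Suc (Suc b)) * ((real b + 2) / (4 * real b + 2))"
    using catalan_Suc[of "Suc b"] by (simp add: field_simps)
  have "4 ^ Suc (Suc b) \<le> 4 * (8 * real (Suc b) ^ 2 * catalan (Suc b))"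
    using Suc by simp
  also have "\<dots> = (32 * real (Suc b) ^ 2 * (real b + 2) / (4 * real b + 2)) * catalan (Suc (Suc b))"
    by (subst r) simp
  also have "\<dots> \<le> (8 * real (Suc (Suc b)) ^ 2) * catalan (Suc (Suc b))"
  proof (rule mult_right_mono)
    have "32 * (real b + 1) ^ 2 * (real b + 2) \<le> 8 * (real b + 2) ^ 2 * (4 * real b + 2)"
    proof -
      have "8 * (real b + 2) ^ 2 * (4 * real b + 2) - 32 * (real b + 1) ^ 2 * (real b + 2) = (real b + 2) * 16 * real b"
        by (simp add: power2_eq_square algebra_simps)
      then show ?thesis by (smt (verit) mult_nonneg_nonneg of_nat_0_le_iff)
    qed
    then show "32 * real (Suc b) ^ 2 * (real b + 2) / (4 * real b + 2) \<le> 8 * real (Suc (Suc b)) ^ 2"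
      by (simp add: divide_le_eq add.commute)
  qed (use catalan_ge_1[of "Suc b"] in simp)
  finally show ?case .
qed simp

text \<open>The price of joining two loops: the growth \<open>4 ^ b\<close> is absorbed by
  \<open>catalan b\<close> and a polynomial factor.\<close>

lemma catalan_add_le_mult:
  assumes "0 < n" "0 < b" "b \<le> K"
  shows "catalan (n + b) \<le> 8 * (real K)\<^sup>2 * (catalan n * catalan b)"
proof -
  obtain n' b' where [simp]: "n = Suc n'" "b = Suc b'" using assms(1,2) by (metis gr0_implies_Suc)
  have "catalan (n + b) \<le> 4 ^ b * catalan n"
    using catalan_add_le[of n' b] by simp
  also have "\<dots> \<le> (8 * (real b)\<^sup>2 * catalan b) * catalan n"
    using four_power_le_catalan[of b'] catalan_ge_1[of n'] by (intro mult_right_mono) simp_all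
  also have "\<dots> \<le> (8 * (real K)\<^sup>2 * catalan b) * catalan n"
    using catalan_ge_1[of n'] catalan_ge_1[of b'] assms(3)
    by (intro mult_right_mono mult_left_mono power_mono) simp_all
  finally show ?thesis by (simp add: mult_ac)
qed

section \<open>Loops of a pair partition\<close>

text \<open>The partner in the standard pairing; \<open>mate 0 = 0\<close> is a default value
  outside the ground set.\<close>

definition mate :: "nat \<Rightarrow> nat" where
  "mate x = (if odd x then Suc x else x - 1)"

lemma mate_mate [simp]: "0 < x \<Longrightarrow> mate (mate x) = x"
  by (auto simp: mate_def)

lemma mate_neq [simp]: "0 < x \<Longrightarrow> mate x \<noteq> x"
  by (auto simp: mate_def)

lemma mem_std_pairing: "{r, s} \<in> std_pairing k \<longleftrightarrow> r \<in> {1..2 * k} \<and> s = mate r"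
proof
  assume "{r, s} \<in> std_pairing k"
  then obtain a where "a \<in> {1..k}" "{r, s} = {2 * a - 1, 2 * a}"
    by (auto simp: std_pairing_def)
  then show "r \<in> {1..2 * k} \<and> s = mate r"
    by (auto simp: doubleton_eq_iff mate_def)
next
  assume *: "r \<in> {1..2 * k} \<and> s = mate r"
  show "{r, s} \<in> std_pairing k"
  proof (cases "odd r")
    case True
    then obtain b where "r = 2 * b + 1" by (elim oddE)
    with * have "{r, s} = {2 * Suc b - 1, 2 * Suc b}" "Suc b \<in> {1..k}"
      by (auto simp: mate_def)
    then show ?thesis unfolding std_pairing_def by blast
  next
    case False
    then obtain b where "r = 2 * b" by (auto elim: evenE)
    with * have "{r, s} = {2 * b - 1, 2 * b}" "b \<in> {1..k}"
      by (auto simp: mate_def)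
    then show ?thesis unfolding std_pairing_def by blast
  qed
qed

lemma pair_partitions_unique:
  assumes "m \<in> pair_partitions n" "{r, s} \<in> m" "{r, s'} \<in> m"
  shows "s = s'"
proof -
  have "{r, s} = {r, s'}"
    using assms disjointD[of m "{r, s}" "{r, s'}"] unfolding pair_partitions_def partition_on_def by auto
  moreover have "card {r, s} = 2" using assms by (simp add: pair_partitions_def)
  ultimately show ?thesis by (auto simp: doubleton_eq_iff)
qed

lemma pair_partitions_neq:
  assumes "m \<in> pair_partitions n" "{r, s} \<in> m"
  shows "r \<noteq> s"
  using assms by (auto simp: pair_partitions_def)

lemma pair_partitions_mem:
  assumes "m \<in> pair_partitions n" "{r, s} \<in> m"
  shows "r \<in> {1..n}" "s \<in> {1..n}"
  using assms unfolding pair_partitions_def partition_on_def by auto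

lemma pair_partitions_ex:
  assumes "m \<in> pair_partitions n" "r \<in> {1..n}"
  obtains s where "{r, s} \<in> m"
proof -
  have "r \<in> \<Union>m" using assms by (simp add: pair_partitions_def partition_on_def)
  then obtain B where "B \<in> m" "r \<in> B" "card B = 2"
    using assms by (auto simp: pair_partitions_def)
  then show ?thesis using that by (auto simp: card_2_iff insert_commute)
qed

lemma perm_act_mem:
  "{x, y} \<in> perm_act (Transposition.transpose i j) m \<longleftrightarrow>
   {Transposition.transpose i j x, Transposition.transpose i j y} \<in> m"
proof -
  have *: "Transposition.transpose i j ` Transposition.transpose i j ` B = B" for B
    by (simp add: image_image)
  show ?thesis
  proof
    assume "{x, y} \<in> perm_act (Transposition.transpose i j) m"
    then obtain B where "B \<in> m" "{x, y} = Transposition.transpose i j ` B"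
      by (auto simp: perm_act_def)
    then show "{Transposition.transpose i j x, Transposition.transpose i j y} \<in> m"
      using *[of B] by (metis image_empty image_insert)
  next
    assume "{Transposition.transpose i j x, Transposition.transpose i j y} \<in> m"
    then have "Transposition.transpose i j ` {Transposition.transpose i j x, Transposition.transpose i j y} \<in> perm_act (Transposition.transpose i j) m"
      unfolding perm_act_def by blast
    then show "{x, y} \<in> perm_act (Transposition.transpose i j) m" by simp
  qed
qed

lemma perm_act_perm_act:
  "perm_act (Transposition.transpose i j) (perm_act (Transposition.transpose i j) m) = m"
  by (simp add: perm_act_def image_image)

lemma perm_act_pair_partitions:
  assumes "m \<in> pair_partitions n" "i \<in> {1..n}" "j \<in> {1..n}"
  shows "perm_act (Transposition.transpose i j) m \<in> pair_partitions n"
proof -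
  let ?t = "Transposition.transpose i j"
  have "?t ` {1..n} = {1..n}"
    using assms(2,3) by simp
  moreover have "partition_on {1..n} m" using assms by (simp add: pair_partitions_def)
  ultimately have "partition_on {1..n} ((\<lambda>B. ?t ` B) ` m)"
    using partition_on_inj_image[of "{1..n}" m ?t] partition_onD3[of "{1..n}" m] by (simp add: image_iff)
  then show ?thesis using assms
    by (auto simp: pair_partitions_def perm_act_def card_image)
qed

lemma pair_partitions_Suc:
  assumes "m \<in> pair_partitions (2 * Suc k)" "{2 * k + 1, 2 * k + 2} \<in> m"
  shows "m - {{2 * k + 1, 2 * k + 2}} \<in> pair_partitions (2 * k)"
proof -
  have p: "partition_on {1..2 * Suc k} m" and c: "\<forall>B\<in>m. card B = 2"
    using assms by (simp_all add: pair_partitions_def)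
  have "partition_on ({1..2 * Suc k} - \<Union>{{2 * k + 1, 2 * k + 2}}) (m - {{2 * k + 1, 2 * k + 2}})"
    unfolding partition_on_def
  proof (intro conjI)
    have "B \<inter> {2 * k + 1, 2 * k + 2} = {}" if "B \<in> m" "B \<noteq> {2 * k + 1, 2 * k + 2}" for B
      using disjointD[OF partition_onD2[OF p] that(1) assms(2) that(2)] .
    then show "\<Union>(m - {{2 * k + 1, 2 * k + 2}}) = {1..2 * Suc k} - \<Union>{{2 * k + 1, 2 * k + 2}}"
      unfolding partition_onD1[OF p] by blast
    show "disjoint (m - {{2 * k + 1, 2 * k + 2}})"
      using partition_onD2[OF p] by (auto simp: disjoint_def)
  qed (use partition_onD3[OF p] in blast)
  moreover have "{1..2 * Suc k} - \<Union>{{2 * k + 1, 2 * k + 2}} = {1..2 * k}" by auto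
  ultimately show ?thesis using c by (simp add: pair_partitions_def)
qed

lemma pair_partitions_0: "pair_partitions 0 = {{}}"
  by (auto simp: pair_partitions_def partition_on_def)

text \<open>A component of size \<open>2n\<close> is recorded by the list \<open>x\<^sub>1, \<dots>, x\<^sub>n\<close> of every second vertex on the
  alternating cycle: \<open>m\<close> joins \<open>x\<^sub>t\<close> to the mate of \<open>x\<^bsub>t + 1\<^esub>\<close>, cyclically. Reversing the cycle
  replaces the list by the reversed list of mates.\<close>

definition loop :: "nat set set \<Rightarrow> nat list \<Rightarrow> bool" where
  "loop m xs \<longleftrightarrow> xs \<noteq> [] \<and> successively (\<lambda>x y. {x, mate y} \<in> m) (xs @ [hd xs])"

definition with_mates :: "nat list \<Rightarrow> nat list" where
  "with_mates xs = xs @ map mate xs"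

text \<open>Equality with a \<open>mset_set\<close> says at once that the loops are disjoint, free
  of repetitions and exhaustive. It is preserved by any rearrangement, so each surgery on loops only
  has to compare two multisets.\<close>

definition loops :: "nat \<Rightarrow> nat set set \<Rightarrow> nat list list \<Rightarrow> bool" where
  "loops k m X \<longleftrightarrow> (\<forall>xs\<in>set X. loop m xs) \<and> mset (concat (map with_mates X)) = mset_set {1..2 * k}"

lemma mset_eq_mset_set:
  assumes "mset xs = mset_set A" "finite A"
  shows "distinct xs" "set xs = A"
proof -
  show "set xs = A" using assms by (metis finite_set_mset_mset_set set_mset_mset)
  then show "distinct xs" using assms
    by (auto simp: distinct_count_atmost_1)
qed

lemma loops_distinct:
  assumes "loops k m X"
  shows "distinct (concat (map with_mates X))" "set (concat (map with_mates X)) = {1..2 * k}"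
  using mset_eq_mset_set[of "concat (map with_mates X)" "{1..2 * k}"] assms by (simp_all add: loops_def)

lemma loops_loop: "loops k m X \<Longrightarrow> xs \<in> set X \<Longrightarrow> loop m xs"
  by (simp add: loops_def)

lemma loop_succ:
  assumes "loop m xs" "x \<in> set xs"
  shows "\<exists>y\<in>set xs. {x, mate y} \<in> m"
proof -
  from split_list[OF assms(2)] obtain as bs where xs: "xs = as @ x # bs" by blast
  then have "{x, mate (hd (bs @ [hd xs]))} \<in> m"
    using assms(1) by (cases bs) (auto simp: loop_def successively_append_iff successively_Cons)
  moreover have "hd (bs @ [hd xs]) \<in> set xs"
    using xs by (cases bs; cases as) auto
  ultimately show ?thesis by blast
qed

lemma loop_pred:
  assumes "loop m xs" "y \<in> set xs"
  shows "\<exists>x\<in>set xs. {x, mate y} \<in> m"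
proof -
  from split_list[OF assms(2)] obtain as bs where xs: "xs = as @ y # bs" by blast
  show ?thesis
  proof (cases as rule: rev_cases)
    case Nil
    then have "{last xs, mate y} \<in> m"
      using assms(1) xs unfolding loop_def successively_append_iff[of _ xs] by simp
    then show ?thesis using xs by (metis last_in_set assms(1) loop_def)
  next
    case (snoc cs c)
    then show ?thesis
      using assms(1) xs by (auto simp: loop_def successively_append_iff successively_Cons)
  qed
qed

lemma sym_pairing_graph: "sym (pairing_graph k m)"
  by (auto simp: sym_def pairing_graph_def insert_commute)

lemma loop_connected:
  assumes "successively (\<lambda>x y. {x, mate y} \<in> m) xs" "set xs \<subseteq> {1..2 * k}" "x \<in> set xs"
  shows "(hd xs, x) \<in> (pairing_graph k m)\<^sup>*"
  using assms
proof (induction xs rule: induct_list012)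
  case (3 a b xs)
  have "(a, mate b) \<in> pairing_graph k m" using 3 by (simp add: pairing_graph_def)
  moreover have "(mate b, b) \<in> pairing_graph k m"
    using 3 mem_std_pairing[of b "mate b" k] by (simp add: pairing_graph_def insert_commute)
  ultimately have ab: "(a, b) \<in> (pairing_graph k m)\<^sup>*" by (meson r_into_rtrancl rtrancl_trans)
  show ?case
  proof (cases "x = a")
    case False
    then have "(b, x) \<in> (pairing_graph k m)\<^sup>*" using 3 by auto
    with ab show ?thesis by simp
  qed simp
qed simp_all

text \<open>The set is closed under both kinds of edges because a point has only one
  \<open>m\<close>-neighbour, found by \<open>loop_succ\<close> or \<open>loop_pred\<close>;
  consecutive entries are connected through the mate between them.\<close>

lemma loop_component:
  assumes m: "m \<in> pair_partitions (2 * k)" and xs: "loop m xs" "set xs \<subseteq> {1..2 * k}"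
    and r: "r \<in> set (with_mates xs)"
  shows "(pairing_graph k m)\<^sup>* `` {r} = set (with_mates xs)"
proof -
  let ?G = "pairing_graph k m"
  have closed: "s \<in> set (with_mates xs)" if a: "a \<in> set (with_mates xs)" and s: "(a, s) \<in> ?G" for a s
  proof -
    consider "s = mate a" | "{a, s} \<in> m" using s by (auto simp: pairing_graph_def mem_std_pairing)
    then show ?thesis
    proof cases
      case 1
      then show ?thesis using a xs(2) by (force simp: with_mates_def)
    next
      case 2
      show ?thesis
      proof (cases "a \<in> set xs")
        case True
        then show ?thesis
          using loop_succ[OF xs(1) True] pair_partitions_unique[OF m 2] by (auto simp: with_mates_def)
      next
        case False
        then obtain y where "y \<in> set xs" "a = mate y"
          using a by (metis Un_iff image_iff list.set_map set_append with_mates_def)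
        then show ?thesis
          using loop_pred[OF xs(1), of y] pair_partitions_unique[OF m 2] by (auto simp: with_mates_def insert_commute)
      qed
    qed
  qed
  have hd1: "(hd xs, a) \<in> ?G\<^sup>*" if "a \<in> set xs" for a
    using loop_connected[of m xs k a] xs that by (auto simp: loop_def successively_append_iff)
  have hd2: "(hd xs, a) \<in> ?G\<^sup>*" if a: "a \<in> set (with_mates xs)" for a
  proof (cases "a \<in> set xs")
    case False
    then obtain y where y: "y \<in> set xs" "a = mate y" using a by (auto simp: with_mates_def)
    then have "(y, a) \<in> ?G" using xs(2) by (auto simp: pairing_graph_def mem_std_pairing)
    then show ?thesis using hd1[OF y(1)] by (rule rtrancl_into_rtrancl[rotated])
  qed (use hd1 in auto)
  have "(r, hd xs) \<in> ?G\<^sup>*"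
    using hd2[OF r] sym_pairing_graph[of k m] by (meson sym_rtrancl symD)
  then have "(r, a) \<in> ?G\<^sup>*" if "a \<in> set (with_mates xs)" for a
    using hd2[OF that] by simp
  moreover have "a \<in> set (with_mates xs)" if "(r, a) \<in> ?G\<^sup>*" for a
    using that by (induction rule: rtrancl_induct) (use r closed in auto)
  ultimately show ?thesis by auto
qed

text \<open>Starting points and orientations of the loops do not matter here, so norm and weight can
  be read off from whatever presentation a surgery produces.\<close>

lemma coset_type_loops:
  assumes m: "m \<in> pair_partitions (2 * k)" and X: "loops k m X"
  shows "coset_type k m = mset (map length X)"
proof -
  note D = loops_distinct[OF X]
  have sub: "set (with_mates xs) \<subseteq> {1..2 * k}" if "xs \<in> set X" for xs
    using D(2) that by auto
  then have sub': "set xs \<subseteq> {1..2 * k}" if "xs \<in> set X" for xs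
    using that by (fastforce simp: with_mates_def)
  have ne: "with_mates xs \<noteq> []" if "xs \<in> set X" for xs
    using loops_loop[OF X that] by (simp add: loop_def with_mates_def)
  have "removeAll [] (map with_mates X) = map with_mates X"
    using ne by (intro removeAll_id) (metis imageE list.set_map)
  then have dm: "distinct (map with_mates X)"
    and dj: "\<And>xs ys. xs \<in> set X \<Longrightarrow> ys \<in> set X \<Longrightarrow> with_mates xs \<noteq> with_mates ys \<Longrightarrow>
       set (with_mates xs) \<inter> set (with_mates ys) = {}"
    and d1: "\<And>xs. xs \<in> set X \<Longrightarrow> distinct (with_mates xs)"
    using D(1) by (auto simp: distinct_concat_iff)
  have "(pairing_graph k m)\<^sup>* `` {r} = set (with_mates xs)" if "xs \<in> set X" "r \<in> set (with_mates xs)" for xs r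
    using loop_component[OF m loops_loop[OF X that(1)] sub'[OF that(1)] that(2)] .
  then have comp: "pairing_components k m = (\<lambda>xs. set (with_mates xs)) ` set X"
    unfolding pairing_components_def quotient_def D(2)[symmetric] using ne by fastforce
  have inj: "inj_on (\<lambda>xs. set (with_mates xs)) (set X)"
  proof (rule inj_onI)
    fix xs ys assume *: "xs \<in> set X" "ys \<in> set X" "set (with_mates xs) = set (with_mates ys)"
    then have "with_mates xs = with_mates ys" using dj[of xs ys] ne by fastforce
    then show "xs = ys" using dm * by (simp add: distinct_map inj_on_def)
  qed
  have dX: "distinct X" using dm by (simp add: distinct_map)
  have card: "card (set (with_mates xs)) div 2 = length xs" if "xs \<in> set X" for xs
    unfolding distinct_card[OF d1[OF that]] by (simp add: with_mates_def)
  have "coset_type k m = image_mset (\<lambda>C. card C div 2) (image_mset (\<lambda>xs. set (with_mates xs)) (mset X))"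
    unfolding coset_type_def comp using inj dX
    by (simp add: image_mset_mset_set[symmetric] mset_set_set)
  also have "\<dots> = image_mset length (mset X)"
    unfolding image_mset.compositionality by (intro image_mset_cong) (simp add: card)
  finally show ?thesis by simp
qed

lemma pairing_norm_loops:
  assumes "m \<in> pair_partitions (2 * k)" "loops k m X"
  shows "pairing_norm k m = k - length X"
  using coset_type_loops[OF assms] by (simp add: pairing_norm_def)

lemma loop_rev:
  assumes "loop m xs" "0 \<notin> set xs"
  shows "loop m (rev (map mate xs))"
proof -
  have mm: "mate (mate x) = x" if "x \<in> set xs" for x
    using assms(2) that by (metis gr0I mate_mate)
  have "successively (\<lambda>x y. {x, mate y} \<in> m) (map mate (rev (xs @ [hd xs])))"
    unfolding successively_map successively_rev
    using assms(1) unfolding loop_def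
    by (auto intro!: successively_mono[of "\<lambda>x y. {x, mate y} \<in> m" "xs @ [hd xs]"] simp: mm insert_commute)
  then have "successively (\<lambda>x y. {x, mate y} \<in> m) (mate (hd xs) # rev (map mate xs))"
    by (simp add: rev_map[symmetric])
  then show ?thesis using assms
    by (cases xs) (auto simp: loop_def successively_append_iff successively_Cons hd_append split: if_splits)
qed

lemma loop_rotate:
  assumes "loop m (as @ i # bs)"
  shows "loop m (i # bs @ as)"
  using assms by (cases as; cases bs rule: rev_cases)
    (auto simp: loop_def successively_append_iff successively_Cons hd_append)

text \<open>Rotation brings an entry to the front; if \<open>i\<close> occurs only as a mate, the
  loop is reversed first.\<close>

lemma loop_from:
  assumes "loop m xs" "0 \<notin> set xs" "i \<in> set (with_mates xs)"
  obtains bs where "loop m (i # bs)" "mset (with_mates (i # bs)) = mset (with_mates xs)" "length xs = Suc (length bs)"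
proof -
  note goal = that
  have *: ?thesis if ys: "loop m ys" "mset (with_mates ys) = mset (with_mates xs)" "i \<in> set ys" for ys
  proof -
    from split_list[OF ys(3)] obtain as bs where ys': "ys = as @ i # bs" by blast
    show ?thesis
    proof (rule goal)
      show "loop m (i # bs @ as)" using loop_rotate ys(1) ys' by blast
      show "mset (with_mates (i # bs @ as)) = mset (with_mates xs)" using ys(2) ys' by (simp add: with_mates_def ac_simps)
      have "length (with_mates ys) = length (with_mates xs)" using ys(2) by (metis size_mset)
      then show "length xs = Suc (length (bs @ as))" using ys' by (simp add: with_mates_def)
    qed
  qed
  show ?thesis
  proof (cases "i \<in> set xs")
    case False
    then have "i \<in> set (rev (map mate xs))" using assms(3) by (auto simp: with_mates_def)
    moreover have "map (\<lambda>x. mate (mate x)) xs = xs"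
      by (rule map_idI) (use assms(2) in \<open>metis gr0I mate_mate\<close>)
    then have "mset (with_mates (rev (map mate xs))) = mset (with_mates xs)"
      by (simp add: with_mates_def rev_map[symmetric] o_def)
    ultimately show ?thesis using *[OF loop_rev[OF assms(1,2)]] by blast
  qed (use * assms in auto)
qed

section \<open>The effect of a transposition on the loops\<close>

text \<open>Only blocks through \<open>i\<close> or \<open>j\<close> change. In a chain the last
  entry occurs only through its mate and the first only as itself, hence \<open>butlast\<close> and
  \<open>tl\<close>; this allows segments that end in \<open>i\<close> or \<open>j\<close>.\<close>

lemma successively_transpose:
  assumes "successively (\<lambda>x y. {x, mate y} \<in> m) zs"
    and "\<forall>x\<in>set (butlast zs). x \<noteq> i \<and> x \<noteq> j"
    and "\<forall>x\<in>set (tl zs). mate x \<noteq> i \<and> mate x \<noteq> j"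
  shows "successively (\<lambda>x y. {x, mate y} \<in> perm_act (Transposition.transpose i j) m) zs"
  unfolding successively_conv_nth
proof (intro allI impI)
  fix t assume t: "Suc t < length zs"
  have "{zs ! t, mate (zs ! Suc t)} \<in> m"
    using successively_nth[OF assms(1) t] .
  moreover have "zs ! t \<in> set (butlast zs)"
    using t by (metis length_butlast less_diff_conv nth_butlast nth_mem Suc_eq_plus1)
  moreover have "zs ! Suc t \<in> set (tl zs)"
    using t by (metis Suc_lessE length_tl diff_Suc_1 nth_mem nth_tl less_diff_conv Suc_eq_plus1)
  ultimately show "{zs ! t, mate (zs ! Suc t)} \<in> perm_act (Transposition.transpose i j) m"
    using assms(2,3) by (simp add: perm_act_mem)
qed

lemma successively_transpose_snoc:
  assumes "successively (\<lambda>x y. {x, mate y} \<in> m) (xs @ [e])"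
    and "\<forall>x\<in>set xs. x \<noteq> i \<and> x \<noteq> j \<and> mate x \<noteq> i \<and> mate x \<noteq> j" "mate e \<noteq> i" "mate e \<noteq> j"
  shows "successively (\<lambda>x y. {x, mate y} \<in> perm_act (Transposition.transpose i j) m) (xs @ [e])"
  using assms by (intro successively_transpose) (cases xs; auto simp: butlast_append)+

lemma loops_distinct_concat:
  assumes "loops k m X"
  shows "distinct (concat X)"
    and "x \<in> set (concat X) \<Longrightarrow> y \<in> set (concat X) \<Longrightarrow> mate x \<noteq> y"
proof -
  have "mset (concat (map with_mates X)) = mset (concat X @ map mate (concat X))"
    by (induction X) (simp_all add: with_mates_def)
  with assms have "mset (concat X @ map mate (concat X)) = mset_set {1..2 * k}"
    by (simp add: loops_def)
  then have "distinct (concat X @ map mate (concat X))" by (rule mset_eq_mset_set) simp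
  then have D: "distinct (concat X)" and I: "set (concat X) \<inter> mate ` set (concat X) = {}"
    unfolding distinct_append set_map by auto
  show "distinct (concat X)" by fact
  show "x \<in> set (concat X) \<Longrightarrow> y \<in> set (concat X) \<Longrightarrow> mate x \<noteq> y" using I by blast
qed

lemma loop_transpose_unaffected:
  assumes "loop m xs" "i \<notin> set (with_mates xs)" "j \<notin> set (with_mates xs)"
  shows "loop (perm_act (Transposition.transpose i j) m) xs"
proof -
  have "set (tl (xs @ [hd xs])) \<subseteq> set xs"
    using assms(1) by (cases xs) (auto simp: loop_def)
  then show ?thesis
    using assms unfolding loop_def
    by (intro conjI successively_transpose) (auto simp: with_mates_def)
qed

text \<open>The apex is \<open>2 * k + 1\<close>, the point moved by every solid arrow at level
  \<open>Suc k\<close>.\<close>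

lemma mate_apex: "mate (Suc (2 * k)) = Suc (Suc (2 * k))"
  by (simp add: mate_def)

context
  fixes k i :: nat and m :: "nat set set"
  assumes i: "i \<in> {1..2 * k}"
begin

text \<open>Here \<open>i\<close> is an entry of the apex loop itself, on the same side as the apex.
  The two exchange their successors, which cuts the cycle in two.\<close>

lemma loops_split:
  assumes X: "loops (Suc k) m (((2 * k + 1) # as @ i # bs) # X)"
  shows "loops (Suc k) (perm_act (Transposition.transpose i (2 * k + 1)) m) (((2 * k + 1) # bs) # (as @ [i]) # X)"
proof -
  let ?a = "2 * k + 1" and ?n = "perm_act (Transposition.transpose i (2 * k + 1)) m"
  note D = loops_distinct[OF X]
  note D' = loops_distinct_concat(1)[OF X] and M = loops_distinct_concat(2)[OF X, simplified]
  have L: "successively (\<lambda>x y. {x, mate y} \<in> m) (?a # as @ i # bs @ [?a])"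
    using loops_loop[OF X, of "?a # as @ i # bs"] by (simp add: loop_def)
  have mate_neqs: "mate ?a \<noteq> i" "mate ?a \<noteq> ?a" using i mate_apex[of k] by auto
  have seg: "successively (\<lambda>x y. {x, mate y} \<in> m) (bs @ [?a])" "successively (\<lambda>x y. {x, mate y} \<in> m) (as @ [i])"
    using L by (auto simp: successively_append_iff successively_Cons)
  have d: "\<forall>x\<in>set as \<union> set bs. x \<noteq> i \<and> x \<noteq> ?a \<and> mate x \<noteq> i \<and> mate x \<noteq> ?a" "mate i \<noteq> i" "mate i \<noteq> ?a"
    using D' M by auto
  have "successively (\<lambda>x y. {x, mate y} \<in> ?n) (bs @ [?a])"
    using seg d mate_neqs by (intro successively_transpose_snoc) auto
  moreover have "{i, mate (hd (bs @ [?a]))} \<in> m"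
    using L by (auto simp: successively_append_iff successively_Cons)
  moreover have "mate (hd (bs @ [?a])) \<noteq> i \<and> mate (hd (bs @ [?a])) \<noteq> ?a"
    using d mate_neqs by (cases bs) auto
  ultimately have 1: "loop ?n (?a # bs)"
    by (simp add: loop_def successively_Cons perm_act_mem)
  have "successively (\<lambda>x y. {x, mate y} \<in> ?n) (as @ [i])"
    using seg d by (intro successively_transpose_snoc) auto
  moreover have "{?a, mate (hd (as @ [i]))} \<in> m"
    using L by (cases as) (auto simp: successively_append_iff successively_Cons)
  moreover have "mate (hd (as @ [i])) \<noteq> i \<and> mate (hd (as @ [i])) \<noteq> ?a"
    using d by (cases as) auto
  ultimately have 2: "loop ?n (as @ [i])"
    by (simp add: loop_def successively_append_iff perm_act_mem hd_append)
  have 3: "\<forall>xs\<in>set X. loop ?n xs"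
    using loops_loop[OF X] D by (intro ballI loop_transpose_unaffected) (auto simp: with_mates_def)
  have "mset (concat (map with_mates ((?a # bs) # (as @ [i]) # X))) = mset (concat (map with_mates ((?a # as @ i # bs) # X)))"
    by (simp add: with_mates_def ac_simps add_mset_commute)
  then show ?thesis using 1 2 3 X by (simp add: loops_def add.assoc[symmetric])
qed

text \<open>Here \<open>i\<close> is the mate of an entry, on the opposite side. The apex gets
  attached to the far end of \<open>as\<close>, and the arc is traversed backwards, so neither the
  number nor the lengths of the loops change.\<close>

lemma loops_twist:
  assumes X: "loops (Suc k) m (((2 * k + 1) # as @ z # bs) # X)" and z: "i = mate z"
  shows "loops (Suc k) (perm_act (Transposition.transpose i (2 * k + 1)) m) (((2 * k + 1) # rev (map mate as) @ z # bs) # X)"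
proof -
  let ?a = "2 * k + 1" and ?n = "perm_act (Transposition.transpose i (2 * k + 1)) m"
  note D = loops_distinct[OF X]
  note D' = loops_distinct_concat(1)[OF X] and M = loops_distinct_concat(2)[OF X, simplified]
  have pos: "0 \<notin> set (concat (map with_mates ((?a # as @ z # bs) # X)))" unfolding D(2) by simp
  have mm: "mate (mate x) = x" if "x \<in> set as \<union> {z}" for x
  proof -
    have "x \<noteq> 0" using pos that by (auto simp: with_mates_def)
    then show ?thesis by simp
  qed
  have L: "successively (\<lambda>x y. {x, mate y} \<in> m) (?a # as @ z # bs @ [?a])"
    using loops_loop[OF X, of "?a # as @ z # bs"] by (simp add: loop_def)
  have mate_neqs: "mate ?a \<noteq> i" "mate ?a \<noteq> ?a" using i mate_apex[of k] by auto
  have seg: "successively (\<lambda>x y. {x, mate y} \<in> m) (bs @ [?a])" "{z, mate (hd (bs @ [?a]))} \<in> m"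
    using L by (auto simp: successively_append_iff successively_Cons)
  have mz: "mate x \<noteq> mate z" if "x \<in> set as \<union> set bs" for x
  proof
    assume "mate x = mate z"
    moreover have "0 < x" using pos that by (auto simp: with_mates_def intro!: gr0I)
    ultimately have "x = z" using mm[of z] mate_mate[of x] by simp
    then show False using D' that by auto
  qed
  have mzb: "mate z \<notin> set as" "mate z \<notin> set bs"
    using M[of z "mate z"] by auto
  have zi: "mate z \<noteq> z"
    using M[of z z] by simp
  have d: "\<forall>x\<in>set as \<union> set bs. x \<noteq> i \<and> x \<noteq> ?a \<and> mate x \<noteq> i \<and> mate x \<noteq> ?a" "z \<noteq> i" "z \<noteq> ?a"
    using D' M[of _ ?a] zi zi[symmetric] mz mzb by (auto simp: z)
  have "successively (\<lambda>x y. {x, mate y} \<in> ?n) (bs @ [?a])"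
    using seg d mate_neqs by (intro successively_transpose_snoc) auto
  moreover have "mate (hd (bs @ [?a])) \<noteq> i \<and> mate (hd (bs @ [?a])) \<noteq> ?a"
    using d mate_neqs by (cases bs) auto
  ultimately have "successively (\<lambda>x y. {x, mate y} \<in> ?n) (z # bs @ [?a])"
    using seg(2) d by (simp add: successively_Cons perm_act_mem)
  moreover have "successively (\<lambda>x y. {x, mate y} \<in> ?n) (?a # rev (map mate as) @ [z])"
  proof (cases "as = []")
    case True
    then show ?thesis using L z by (simp add: perm_act_mem insert_commute)
  next
    case False
    have "successively (\<lambda>x y. {x, mate y} \<in> m) as"
      using L by (auto simp: successively_append_iff successively_Cons)
    then have "successively (\<lambda>x y. {x, mate y} \<in> ?n) (rev (map mate as))"
      unfolding successively_map successively_rev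
      by (rule successively_mono) (use d in \<open>auto simp: mm perm_act_mem insert_commute\<close>)
    moreover have "{last as, mate z} \<in> m" "last as \<noteq> i" "last as \<noteq> ?a"
      using L d False by (simp_all add: successively_append_iff successively_Cons)
    then have "{?a, mate (mate (last as))} \<in> ?n"
      using False z by (simp add: mm perm_act_mem insert_commute)
    moreover have "{?a, mate (hd as)} \<in> m" "mate (hd as) \<noteq> i" "mate (hd as) \<noteq> ?a"
      using L d False by (cases as; simp)+
    then have "{mate (hd as), mate z} \<in> ?n"
      using z by (simp add: perm_act_mem insert_commute)
    ultimately show ?thesis using False
      by (simp add: successively_append_iff successively_Cons hd_append hd_rev last_rev last_map hd_map)
  qed
  ultimately have 1: "loop ?n (?a # rev (map mate as) @ z # bs)"
    by (auto simp: loop_def successively_append_iff successively_Cons hd_append)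
  have 2: "\<forall>xs\<in>set X. loop ?n xs"
    using loops_loop[OF X] D z by (intro ballI loop_transpose_unaffected) (auto simp: with_mates_def)
  have "map (\<lambda>x. mate (mate x)) as = as"
    by (rule map_idI) (simp add: mm)
  then have "mset (concat (map with_mates ((?a # rev (map mate as) @ z # bs) # X))) = mset (concat (map with_mates ((?a # as @ z # bs) # X)))"
    by (simp add: with_mates_def ac_simps add_mset_commute rev_map[symmetric] o_def)
  then show ?thesis using 1 2 X by (simp add: loops_def add.assoc[symmetric])
qed

text \<open>The inverse of a split: exchanging successors across two cycles merges them.\<close>

lemma loops_join:
  assumes X: "loops (Suc k) m (((2 * k + 1) # as) # (i # bs) # X)"
  shows "loops (Suc k) (perm_act (Transposition.transpose i (2 * k + 1)) m) (((2 * k + 1) # bs @ i # as) # X)"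
proof -
  let ?a = "2 * k + 1" and ?n = "perm_act (Transposition.transpose i (2 * k + 1)) m"
  note D = loops_distinct[OF X]
  note D' = loops_distinct_concat(1)[OF X] and M = loops_distinct_concat(2)[OF X, simplified]
  have L: "successively (\<lambda>x y. {x, mate y} \<in> m) (?a # as @ [?a])" "successively (\<lambda>x y. {x, mate y} \<in> m) (i # bs @ [i])"
    using loops_loop[OF X, of "?a # as"] loops_loop[OF X, of "i # bs"] by (simp_all add: loop_def)
  have mate_neqs: "mate ?a \<noteq> i" "mate ?a \<noteq> ?a" "mate i \<noteq> i" using i mate_apex[of k] by auto
  have seg: "successively (\<lambda>x y. {x, mate y} \<in> m) (as @ [?a])" "successively (\<lambda>x y. {x, mate y} \<in> m) (bs @ [i])"
    using L by (auto simp: successively_Cons)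
  have d: "\<forall>x\<in>set as \<union> set bs. x \<noteq> i \<and> x \<noteq> ?a \<and> mate x \<noteq> i \<and> mate x \<noteq> ?a" "mate i \<noteq> ?a"
    using D' M by auto
  have a: "successively (\<lambda>x y. {x, mate y} \<in> ?n) (as @ [?a])"
    using seg d mate_neqs by (intro successively_transpose_snoc) auto
  have b: "successively (\<lambda>x y. {x, mate y} \<in> ?n) (bs @ [i])"
    using seg d mate_neqs by (intro successively_transpose_snoc) auto
  have "{i, mate (hd (bs @ [i]))} \<in> m" "mate (hd (bs @ [i])) \<noteq> i" "mate (hd (bs @ [i])) \<noteq> ?a"
    using L d mate_neqs by (cases bs; simp)+
  then have c: "{?a, mate (hd (bs @ [i]))} \<in> ?n" by (simp add: perm_act_mem)
  have "{?a, mate (hd (as @ [?a]))} \<in> m" "mate (hd (as @ [?a])) \<noteq> i" "mate (hd (as @ [?a])) \<noteq> ?a"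
    using L d mate_neqs by (cases as; simp)+
  then have e: "{i, mate (hd (as @ [?a]))} \<in> ?n" by (simp add: perm_act_mem)
  have 1: "loop ?n (?a # bs @ i # as)"
    using a b c e by (auto simp: loop_def successively_append_iff successively_Cons hd_append)
  have 2: "\<forall>xs\<in>set X. loop ?n xs"
    using loops_loop[OF X] D by (intro ballI loop_transpose_unaffected) (auto simp: with_mates_def)
  have "mset (concat (map with_mates ((?a # bs @ i # as) # X))) = mset (concat (map with_mates ((?a # as) # (i # bs) # X)))"
    by (simp add: with_mates_def ac_simps add_mset_commute)
  then show ?thesis using 1 2 X by (simp add: loops_def add.assoc[symmetric])
qed

end

lemma loops_length_le:
  assumes "loops k m X"
  shows "length X \<le> k"
proof -
  have "\<forall>xs\<in>set X. xs \<noteq> []"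
    using loops_loop[OF assms] by (simp add: loop_def)
  then have "length X \<le> length (concat X)"
    by (induction X) (auto simp: Suc_le_eq simp flip: length_greater_0_conv)
  moreover have "length (concat (map with_mates X)) = 2 * length (concat X)"
    by (induction X) (simp_all add: with_mates_def)
  moreover have "length (concat (map with_mates X)) = 2 * k"
    using assms unfolding loops_def by (metis size_mset size_mset_set card_atLeastAtMost diff_Suc_1)
  ultimately show ?thesis by simp
qed

lemma atLeastAtMost_double_Suc: "{1..2 * Suc k} = insert (2 * k + 2) (insert (2 * k + 1) {1..2 * k})"
  by auto

lemma loop_mono: "loop m xs \<Longrightarrow> m \<subseteq> n \<Longrightarrow> loop n xs"
  unfolding loop_def by (auto elim!: successively_mono)

lemma loops_add_block:
  assumes "loops k (m - {{2 * k + 1, 2 * k + 2}}) X" "{2 * k + 1, 2 * k + 2} \<in> m"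
  shows "loops (Suc k) m ([2 * k + 1] # X)"
  unfolding loops_def
proof
  show "\<forall>xs\<in>set ([2 * k + 1] # X). loop m xs"
    using assms loop_mono[OF loops_loop[OF assms(1)]] by (auto simp: loop_def mate_apex[simplified])
  show "mset (concat (map with_mates ([2 * k + 1] # X))) = mset_set {1..2 * Suc k}"
    unfolding atLeastAtMost_double_Suc using assms(1) mate_apex[of k] by (simp add: loops_def with_mates_def)
qed

lemma loops_remaining:
  assumes "loops (Suc k) m (((2 * k + 1) # as) # X)"
  shows "mset (as @ map mate as @ concat (map with_mates X)) = mset_set {1..2 * k}"
proof -
  have "add_mset (2 * k + 2) (add_mset (2 * k + 1) (mset (as @ map mate as @ concat (map with_mates X))))
     = mset (concat (map with_mates (((2 * k + 1) # as) # X)))"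
    using mate_apex[of k] by (simp add: with_mates_def)
  also have "\<dots> = add_mset (2 * k + 2) (add_mset (2 * k + 1) (mset_set {1..2 * k}))"
    using assms unfolding loops_def atLeastAtMost_double_Suc by simp
  finally show ?thesis by simp
qed

lemma loops_remove_block:
  assumes "loops (Suc k) m ([2 * k + 1] # X)"
  shows "loops k (m - {{2 * k + 1, 2 * k + 2}}) X"
  unfolding loops_def
proof
  note R = loops_remaining[OF assms]
  then show "mset (concat (map with_mates X)) = mset_set {1..2 * k}" by simp
  then have "set (concat (map with_mates X)) = {1..2 * k}" by (rule mset_eq_mset_set) simp
  then have le: "x \<le> 2 * k" if "xs \<in> set X" "x \<in> set xs" for x xs
    using that by (fastforce simp: with_mates_def)
  show "\<forall>xs\<in>set X. loop (m - {{2 * k + 1, 2 * k + 2}}) xs"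
  proof
    fix xs assume xs: "xs \<in> set X"
    then have "loop m xs" using loops_loop[OF assms] by simp
    moreover have "{x, mate y} \<noteq> {2 * k + 1, 2 * k + 2}" if "x \<in> set (xs @ [hd xs])" for x y
    proof -
      have "x \<in> set xs" using that \<open>loop m xs\<close> by (auto simp: loop_def)
      then have "x \<le> 2 * k" using le xs by blast
      then show ?thesis by (auto simp: doubleton_eq_iff)
    qed
    ultimately show "loop (m - {{2 * k + 1, 2 * k + 2}}) xs"
      unfolding loop_def by (auto elim!: successively_mono)
  qed
qed

lemma loops_apex_block_iff:
  assumes m: "m \<in> pair_partitions (2 * Suc k)" and X: "loops (Suc k) m (((2 * k + 1) # as) # X)"
  shows "{2 * k + 1, 2 * k + 2} \<in> m \<longleftrightarrow> as = []"
proof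
  assume *: "{2 * k + 1, 2 * k + 2} \<in> m"
  show "as = []"
  proof (rule ccontr)
    assume "as \<noteq> []"
    then obtain a bs where as: "as = a # bs" by (cases as) auto
    have "{2 * k + 1, mate a} \<in> m" using loops_loop[OF X, of "(2 * k + 1) # as"] as by (simp add: loop_def)
    then have "mate a = mate (2 * k + 1)" using pair_partitions_unique[OF m *] mate_apex[of k] by simp
    then show False using loops_distinct[OF X] as by (auto simp: with_mates_def)
  qed
next
  assume "as = []"
  then show "{2 * k + 1, 2 * k + 2} \<in> m"
    using loops_loop[OF X, of "(2 * k + 1) # as"] mate_apex[of k] by (simp add: loop_def)
qed

lemma loops_replace:
  assumes "loops k m (z # X @ xs # Y)" "loop m ys" "mset (with_mates ys) = mset (with_mates xs)"
  shows "loops k m (z # ys # X @ Y)"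
proof -
  have "mset (concat (map with_mates (z # ys # X @ Y))) = mset (concat (map with_mates (z # X @ xs # Y)))"
    using assms(3) by (simp add: ac_simps)
  then show ?thesis using assms(1,2) by (auto simp: loops_def ac_simps)
qed

text \<open>If the last block is missing, exchanging the apex with the partner of
  \<open>2 * k + 2\<close> creates it. The loops one level down are completed by the loop of the
  apex alone, and exchanging back is a join. The lower level enters as the assumption
  \<open>ex\<close>, so that the lemma serves both the induction and the form with the apex in
  front.\<close>

lemma loops_exists_step:
  assumes ex: "\<And>m. m \<in> pair_partitions (2 * k) \<Longrightarrow> \<exists>X. loops k m X" and m: "m \<in> pair_partitions (2 * Suc k)"
  shows "\<exists>as X. loops (Suc k) m (((2 * k + 1) # as) # X)"
proof (cases "{2 * k + 1, 2 * k + 2} \<in> m")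
  case True
  then show ?thesis using ex[OF pair_partitions_Suc[OF m True]] loops_add_block by blast
next
  case False
  have "2 * k + 2 \<in> {1..2 * Suc k}" by simp
  then obtain i where i: "{2 * k + 2, i} \<in> m" using pair_partitions_ex[OF m] by blast
  then have i': "i \<in> {1..2 * k}"
    using False pair_partitions_mem[OF m i] pair_partitions_neq[OF m i] by (auto simp: le_Suc_eq insert_commute)
  define n where "n = perm_act (Transposition.transpose i (2 * k + 1)) m"
  have n: "n \<in> pair_partitions (2 * Suc k)"
    unfolding n_def using i' by (intro perm_act_pair_partitions m) auto
  have b: "{2 * k + 1, 2 * k + 2} \<in> n"
    unfolding n_def using i i' by (simp add: perm_act_mem insert_commute)
  obtain Y where "loops k (n - {{2 * k + 1, 2 * k + 2}}) Y"
    using ex[OF pair_partitions_Suc[OF n b]] by blast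
  then have Y: "loops (Suc k) n ([2 * k + 1] # Y)" using b by (rule loops_add_block)
  have "mset (concat (map with_mates Y)) = mset_set {1..2 * k}" using loops_remaining[OF Y] by simp
  then have "set (concat (map with_mates Y)) = {1..2 * k}" by (rule mset_eq_mset_set) simp
  with i' have "i \<in> set (concat (map with_mates Y))" by blast
  then obtain xs where xs: "xs \<in> set Y" "i \<in> set (with_mates xs)" by auto
  from split_list[OF xs(1)] obtain Y1 Y2 where Y12: "Y = Y1 @ xs # Y2" by blast
  have lxs: "loop n xs" using loops_loop[OF Y] xs(1) by simp
  have "0 \<notin> set (concat (map with_mates ([2 * k + 1] # Y)))" unfolding loops_distinct(2)[OF Y] by simp
  then have "0 \<notin> set xs" using xs(1) by (auto simp: with_mates_def)
  then obtain bs where bs: "loop n (i # bs)" "mset (with_mates (i # bs)) = mset (with_mates xs)"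
    using loop_from[OF lxs _ xs(2)] by metis
  have "loops (Suc k) n ([2 * k + 1] # (i # bs) # Y1 @ Y2)"
    using Y bs unfolding Y12 by (rule loops_replace)
  from loops_join[OF i' this] show ?thesis
    unfolding n_def perm_act_perm_act by blast
qed

lemma loops_exists: "m \<in> pair_partitions (2 * k) \<Longrightarrow> \<exists>X. loops k m X"
proof (induction k arbitrary: m)
  case 0
  then show ?case by (intro exI[of _ "[]"]) (simp add: loops_def)
next
  case (Suc k)
  then show ?case using loops_exists_step[of k m] by blast
qed

lemma loops_apex_exists:
  assumes "m \<in> pair_partitions (2 * Suc k)"
  obtains as X where "loops (Suc k) m (((2 * k + 1) # as) # X)"
  using loops_exists_step[OF loops_exists assms] by blast

section \<open>Catalan weights and the three kinds of transpositions\<close>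

definition catalan_weight :: "nat \<Rightarrow> nat set set \<Rightarrow> real" where
  "catalan_weight k m = prod_mset (image_mset catalan (coset_type k m))"

text \<open>With the shifted index a loop through 2n points contributes C_(n-1), so a loop of two
  points contributes 1. By \<open>npaths_geodesic\<close> the product counts the shortest
  paths.\<close>

lemma catalan_weight_loops:
  assumes "m \<in> pair_partitions (2 * k)" "loops k m X"
  shows "catalan_weight k m = prod_list (map (catalan \<circ> length) X)"
  unfolding catalan_weight_def coset_type_loops[OF assms]
  by (metis mset_map map_map prod_mset_prod_list)

lemma catalan_weight_pos:
  assumes "m \<in> pair_partitions (2 * k)"
  shows "0 < catalan_weight k m"
proof -
  obtain X where X: "loops k m X" using loops_exists[OF assms] by blast
  have "0 < catalan (length xs)" if "xs \<in> set X" for xs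
    using loops_loop[OF X that] catalan_ge_1 by (cases xs) (auto simp: loop_def intro: less_le_trans[OF zero_less_one])
  then have "0 < prod_list (map (catalan \<circ> length) X)" by (induction X) auto
  then show ?thesis using catalan_weight_loops[OF assms X] by simp
qed

text \<open>\<open>S\<close>, \<open>T\<close> and \<open>J\<close> are the transpositions that split the loop of \<open>2k + 1\<close>, reverse an arc of it, and
  join it to another loop.\<close>

lemma transposition_classes:
  assumes m: "m \<in> pair_partitions (2 * Suc k)"
  defines "n \<equiv> \<lambda>i. perm_act (Transposition.transpose i (2 * k + 1)) m"
    and "b \<equiv> {2 * k + 1, 2 * k + 2}"
  obtains S T J where "{1..2 * k} = S \<union> T \<union> J" "S \<inter> T = {}" "(S \<union> T) \<inter> J = {}"
    "card T \<le> k" "card J \<le> 2 * k"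
    "\<And>i. i \<in> S \<Longrightarrow> Suc (pairing_norm (Suc k) (n i)) = pairing_norm (Suc k) m"
    "\<And>i. i \<in> T \<Longrightarrow> pairing_norm (Suc k) (n i) = pairing_norm (Suc k) m"
    "\<And>i. i \<in> T \<Longrightarrow> catalan_weight (Suc k) (n i) = catalan_weight (Suc k) m"
    "\<And>i. i \<in> J \<Longrightarrow> pairing_norm (Suc k) (n i) = Suc (pairing_norm (Suc k) m)"
    "\<And>i. i \<in> J \<Longrightarrow> catalan_weight (Suc k) (n i) \<le> 8 * (real (Suc k))\<^sup>2 * catalan_weight (Suc k) m"
    "b \<in> m \<Longrightarrow> pairing_norm k (m - {b}) = pairing_norm (Suc k) m"
    "(\<Sum>i\<in>S. catalan_weight (Suc k) (n i)) + (if b \<in> m then catalan_weight k (m - {b}) else 0)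
       = catalan_weight (Suc k) m"
proof -
  obtain as X where X: "loops (Suc k) m (((2 * k + 1) # as) # X)"
    using loops_apex_exists[OF m] .
  define S T J where "S = set as" and "T = mate ` set as" and "J = set (concat (map with_mates X))"
  define R where "R = prod_list (map (catalan \<circ> length) X)"
  note rem = mset_eq_mset_set[OF loops_remaining[OF X], simplified]
  have n: "n i \<in> pair_partitions (2 * Suc k)" if "i \<in> {1..2 * k}" for i
    unfolding n_def using that by (intro perm_act_pair_partitions m) auto
  have mem: "i \<in> {1..2 * k}" if "i \<in> S \<union> T \<union> J" for i
    using that rem(2) unfolding S_def T_def J_def by auto
  have le: "Suc (length X) \<le> Suc k" using loops_length_le[OF X] by simp
  have norm: "pairing_norm (Suc k) m = k - length X"
    using pairing_norm_loops[OF m X] by simp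
  have wt: "catalan_weight (Suc k) m = catalan (Suc (length as)) * R"
    using catalan_weight_loops[OF m X] by (simp add: R_def)
  \<comment> \<open>A cut at position \<open>t\<close> leaves \<open>length as - t\<close> entries
    with the apex and \<open>Suc t\<close> entries in the new loop.\<close>
  have split: "Suc (pairing_norm (Suc k) (n (as ! t))) = pairing_norm (Suc k) m \<and>
      catalan_weight (Suc k) (n (as ! t)) = catalan (length as - t) * catalan (Suc t) * R"
    if t: "t < length as" for t
  proof -
    have i: "as ! t \<in> {1..2 * k}" using mem t by (simp add: S_def)
    have "as = take t as @ as ! t # drop (Suc t) as" using t by (rule id_take_nth_drop)
    then have "loops (Suc k) m (((2 * k + 1) # take t as @ as ! t # drop (Suc t) as) # X)" using X by simp
    from loops_split[OF i this]
    have Y: "loops (Suc k) (n (as ! t)) (((2 * k + 1) # drop (Suc t) as) # (take t as @ [as ! t]) # X)"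
      unfolding n_def .
    show ?thesis
      using pairing_norm_loops[OF n[OF i] Y] catalan_weight_loops[OF n[OF i] Y] norm loops_length_le[OF Y] t
      by (auto simp: R_def min_def Suc_diff_Suc)
  qed
  have twist: "pairing_norm (Suc k) (n i) = pairing_norm (Suc k) m \<and>
      catalan_weight (Suc k) (n i) = catalan_weight (Suc k) m" if "i \<in> T" for i
  proof -
    have i: "i \<in> {1..2 * k}" using mem that by blast
    obtain z where z: "z \<in> set as" "i = mate z" using \<open>i \<in> T\<close> by (auto simp: T_def)
    then obtain as1 as2 where as: "as = as1 @ z # as2" using split_list[OF z(1)] by blast
    have Y: "loops (Suc k) (n i) (((2 * k + 1) # rev (map mate as1) @ z # as2) # X)"
      unfolding n_def using loops_twist[OF i _ z(2)] X as by simp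
    show ?thesis
      using pairing_norm_loops[OF n[OF i] Y] catalan_weight_loops[OF n[OF i] Y] norm wt as by (simp add: R_def)
  qed
  have join: "pairing_norm (Suc k) (n i) = Suc (pairing_norm (Suc k) m) \<and>
      catalan_weight (Suc k) (n i) \<le> 8 * (real (Suc k))\<^sup>2 * catalan_weight (Suc k) m" if "i \<in> J" for i
  proof -
    have i: "i \<in> {1..2 * k}" using mem that by blast
    obtain xs where xs: "xs \<in> set X" "i \<in> set (with_mates xs)" using \<open>i \<in> J\<close> by (auto simp: J_def)
    from split_list[OF xs(1)] obtain X1 X2 where X12: "X = X1 @ xs # X2" by blast
    have lxs: "loop m xs" using loops_loop[OF X] xs(1) by simp
    have "0 \<notin> set (concat (map with_mates (((2 * k + 1) # as) # X)))" unfolding loops_distinct(2)[OF X] by simp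
    then have "0 \<notin> set xs" using xs(1) by (auto simp: with_mates_def)
    then obtain bs where bs: "loop m (i # bs)" "mset (with_mates (i # bs)) = mset (with_mates xs)" "length xs = Suc (length bs)"
      using loop_from[OF lxs _ xs(2)] by metis
    have "loops (Suc k) m (((2 * k + 1) # as) # (i # bs) # X1 @ X2)"
      using X bs(1,2) unfolding X12 by (rule loops_replace)
    from loops_join[OF i this]
    have Y: "loops (Suc k) (n i) (((2 * k + 1) # bs @ i # as) # X1 @ X2)" unfolding n_def .
    define R' where "R' = prod_list (map (catalan \<circ> length) (X1 @ X2))"
    have R: "R = catalan (Suc (length bs)) * R'"
      unfolding R_def R'_def X12 using bs(3) by simp
    have lx: "catalan (length ys) \<ge> 0" if "ys \<in> set X" for ys
      using loops_loop[OF X] that catalan_ge_1[of "length ys - 1"] by (cases ys) (auto simp: loop_def)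
    have "R' \<ge> 0" using lx unfolding R'_def X12 by (auto intro!: mult_nonneg_nonneg prod_list_nonneg)
    have "length (concat (map with_mates (((2 * k + 1) # as) # (i # bs) # X1 @ X2))) = 2 * Suc k"
      using \<open>loops (Suc k) m (((2 * k + 1) # as) # (i # bs) # X1 @ X2)\<close> unfolding loops_def
      by (metis size_mset size_mset_set card_atLeastAtMost diff_Suc_1)
    then have "Suc (length bs) \<le> Suc k" by (simp add: with_mates_def)
    then have "catalan (Suc (length as) + Suc (length bs)) \<le> 8 * (real (Suc k))\<^sup>2 * (catalan (Suc (length as)) * catalan (Suc (length bs)))"
      by (intro catalan_add_le_mult) auto
    from mult_right_mono[OF this \<open>R' \<ge> 0\<close>]
    have "catalan (Suc (Suc (length as + length bs))) * R' \<le> 8 * (real (Suc k))\<^sup>2 * catalan_weight (Suc k) m"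
      unfolding wt R by (simp add: mult_ac)
    then show ?thesis
      using pairing_norm_loops[OF n[OF i] Y] catalan_weight_loops[OF n[OF i] Y] norm X12 loops_length_le[OF X]
      by (simp add: R'_def add.commute Suc_diff_le)
  qed
  have b: "b \<in> m \<longleftrightarrow> as = []" unfolding b_def using loops_apex_block_iff[OF m X] .
  have dash: "pairing_norm k (m - {b}) = pairing_norm (Suc k) m \<and> catalan_weight k (m - {b}) = R" if "b \<in> m"
  proof -
    have m': "m - {b} \<in> pair_partitions (2 * k)" unfolding b_def
      using that by (intro pair_partitions_Suc m) (simp add: b_def)
    have Y: "loops k (m - {b}) X" unfolding b_def
      using X b that by (intro loops_remove_block) simp
    show ?thesis using pairing_norm_loops[OF m' Y] catalan_weight_loops[OF m' Y] norm by (simp add: R_def)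
  qed
  show ?thesis
  proof (rule that[of S T J])
    show "{1..2 * k} = S \<union> T \<union> J" "S \<inter> T = {}" "(S \<union> T) \<inter> J = {}"
      using rem unfolding S_def T_def J_def by auto
    have dT: "distinct (map mate as)" using rem(1) by simp
    have len: "length as + length as + length (concat (map with_mates X)) = 2 * k"
      using loops_remaining[OF X] by (metis add.assoc card_atLeastAtMost diff_Suc_1 length_append length_map size_mset size_mset_set)
    show "card T \<le> k" unfolding T_def using card_image_le[of "set as" mate] card_length[of as] len by simp
    show "card J \<le> 2 * k" unfolding J_def using card_length[of "concat (map with_mates X)"] len by simp
    show "Suc (pairing_norm (Suc k) (n i)) = pairing_norm (Suc k) m" if "i \<in> S" for i
      using that split unfolding S_def by (metis in_set_conv_nth)
    have "(\<Sum>i\<in>S. catalan_weight (Suc k) (n i)) = (\<Sum>t<length as. catalan (length as - t) * catalan (Suc t)) * R"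
    proof -
      have "(\<Sum>i\<in>S. catalan_weight (Suc k) (n i)) = (\<Sum>i\<leftarrow>as. catalan_weight (Suc k) (n i))"
        unfolding S_def using rem(1) by (subst sum_list_distinct_conv_sum_set) auto
      also have "\<dots> = (\<Sum>t<length as. catalan_weight (Suc k) (n (as ! t)))"
        by (simp add: sum_list_sum_nth atLeast0LessThan)
      finally show ?thesis using split by (simp add: sum_distrib_right)
    qed
    \<comment> \<open>If \<open>as\<close> is nonempty, the dashed arrow is absent and the splits
      add up to the convolution. If it is empty, there are no splits and the dashed arrow removes a
      loop of weight \<open>catalan 1 = 1\<close>.\<close>
    then show "(\<Sum>i\<in>S. catalan_weight (Suc k) (n i)) + (if b \<in> m then catalan_weight k (m - {b}) else 0)
       = catalan_weight (Suc k) m"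
      using b dash wt catalan_convolution[of "length as"] by (cases "as = []") auto
  qed (use twist join dash in auto)
qed

section \<open>Counting paths in the Weingarten graph\<close>

text \<open>The recursion follows the first step of a path. It counts transpositions rather than
  target vertices, which is the same by \<open>perm_act_apex_inj\<close>.\<close>

fun npaths :: "nat \<Rightarrow> nat \<Rightarrow> nat set set \<Rightarrow> nat" where
  "npaths 0 l m = (if l = 0 then 1 else 0)"
| "npaths (Suc k) 0 m = (if {2 * k + 1, 2 * k + 2} \<in> m then npaths k 0 (m - {{2 * k + 1, 2 * k + 2}}) else 0)"
| "npaths (Suc k) (Suc l) m = (\<Sum>i\<in>{1..2 * k}. npaths (Suc k) l (perm_act (Transposition.transpose i (2 * k + 1)) m)) +
     (if {2 * k + 1, 2 * k + 2} \<in> m then npaths k (Suc l) (m - {{2 * k + 1, 2 * k + 2}}) else 0)"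

lemma pair_partitions_level:
  assumes "m \<in> pair_partitions (2 * k)" "m \<in> pair_partitions (2 * k')"
  shows "k = k'"
proof -
  have "{1..2 * k} = \<Union>m" "{1..2 * k'} = \<Union>m" using assms unfolding pair_partitions_def partition_on_def by blast+
  then have "card {1..2 * k} = card {1..2 * k'}" by (simp only:)
  then show ?thesis by simp
qed

lemma solid_arrow_iff:
  assumes "m \<in> pair_partitions (2 * Suc k)"
  shows "solid_arrow m n \<longleftrightarrow> (\<exists>i\<in>{1..2 * k}. n = perm_act (Transposition.transpose i (2 * k + 1)) m)"
proof
  assume "solid_arrow m n"
  then obtain k' i where "m \<in> pair_partitions (2 * k')" "1 \<le> i" "i < 2 * k' - 1"
    "n = perm_act (Transposition.transpose i (2 * k' - 1)) m" unfolding solid_arrow_def by blast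
  moreover from this have "k' = Suc k" using pair_partitions_level assms by blast
  ultimately show "\<exists>i\<in>{1..2 * k}. n = perm_act (Transposition.transpose i (2 * k + 1)) m" by auto
next
  assume "\<exists>i\<in>{1..2 * k}. n = perm_act (Transposition.transpose i (2 * k + 1)) m"
  then obtain i where "i \<in> {1..2 * k}" "n = perm_act (Transposition.transpose i (2 * k + 1)) m" by blast
  then show "solid_arrow m n" unfolding solid_arrow_def using assms by (intro exI[of _ "Suc k"] exI[of _ i]) auto
qed

lemma dashed_arrow_iff:
  assumes "m \<in> pair_partitions (2 * Suc k)"
  shows "dashed_arrow m n \<longleftrightarrow> {2 * k + 1, 2 * k + 2} \<in> m \<and> n = m - {{2 * k + 1, 2 * k + 2}}"
proof
  assume "dashed_arrow m n"
  then obtain k' where "m \<in> pair_partitions (2 * k')" "{2 * k' - 1, 2 * k'} \<in> m"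
    "n = m - {{2 * k' - 1, 2 * k'}}" unfolding dashed_arrow_def by blast
  moreover from this have "k' = Suc k" using pair_partitions_level assms by blast
  ultimately show "{2 * k + 1, 2 * k + 2} \<in> m \<and> n = m - {{2 * k + 1, 2 * k + 2}}" by simp
next
  assume "{2 * k + 1, 2 * k + 2} \<in> m \<and> n = m - {{2 * k + 1, 2 * k + 2}}"
  then show "dashed_arrow m n" unfolding dashed_arrow_def using assms by (intro exI[of _ "Suc k"]) simp
qed

lemma no_arrow_empty: "\<not> solid_arrow {} n" "\<not> dashed_arrow {} n"
proof -
  have "k = 0" if "{} \<in> pair_partitions (2 * k)" for k
    using pair_partitions_level[OF that, of 0] pair_partitions_0 by simp
  then show "\<not> solid_arrow {} n" "\<not> dashed_arrow {} n"
    by (force simp: solid_arrow_def dashed_arrow_def)+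
qed

lemma perm_act_apex:
  assumes "m \<in> pair_partitions (2 * Suc k)" "i \<in> {1..2 * k}"
  shows "perm_act (Transposition.transpose i (2 * k + 1)) m \<in> pair_partitions (2 * Suc k)"
  using assms by (intro perm_act_pair_partitions) auto

text \<open>The targets lie on different levels. Since a path records only its vertices, this is
  what makes the kind of each step unambiguous.\<close>

lemma not_solid_and_dashed:
  assumes "m \<in> pair_partitions (2 * Suc k)"
  shows "\<not> (solid_arrow m n \<and> dashed_arrow m n)"
proof
  assume *: "solid_arrow m n \<and> dashed_arrow m n"
  then have "n \<in> pair_partitions (2 * Suc k)"
    using perm_act_apex[OF assms] unfolding solid_arrow_iff[OF assms] by blast
  moreover have "n \<in> pair_partitions (2 * k)"
    using * pair_partitions_Suc[OF assms] unfolding dashed_arrow_iff[OF assms] by blast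
  ultimately show False using pair_partitions_level[of n "Suc k" k] by simp
qed

text \<open>Afterwards the apex is joined to the former partner of \<open>i\<close>, or to
  \<open>i\<close> itself if that partner was the apex; either way \<open>i\<close> can be
  recovered.\<close>

lemma perm_act_apex_inj:
  assumes "m \<in> pair_partitions (2 * Suc k)"
  shows "inj_on (\<lambda>i. perm_act (Transposition.transpose i (2 * k + 1)) m) {1..2 * k}"
proof (rule inj_onI)
  fix i i' assume i: "i \<in> {1..2 * k}" "i' \<in> {1..2 * k}"
    and eq: "perm_act (Transposition.transpose i (2 * k + 1)) m = perm_act (Transposition.transpose i' (2 * k + 1)) m"
  let ?t = "\<lambda>i. Transposition.transpose i (2 * k + 1)"
  have p: "\<exists>y. {i, y} \<in> m \<and> {2 * k + 1, if y = 2 * k + 1 then i else y} \<in> perm_act (?t i) m" if "i \<in> {1..2 * k}" for i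
  proof -
    have "i \<in> {1..2 * Suc k}" using that by auto
    then obtain y where y: "{i, y} \<in> m" using pair_partitions_ex[OF assms] by blast
    then have "y \<noteq> i" using pair_partitions_neq[OF assms y] by simp
    then show ?thesis using y that by (intro exI[of _ y]) (auto simp: perm_act_mem insert_commute)
  qed
  obtain x y where x: "{i, x} \<in> m" "{2 * k + 1, if x = 2 * k + 1 then i else x} \<in> perm_act (?t i) m"
    and y: "{i', y} \<in> m" "{2 * k + 1, if y = 2 * k + 1 then i' else y} \<in> perm_act (?t i) m"
    using p[OF i(1)] p[OF i(2)] eq by auto
  have "(if x = 2 * k + 1 then i else x) = (if y = 2 * k + 1 then i' else y)"
    using pair_partitions_unique[OF perm_act_apex[OF assms i(1)] x(2) y(2)] .
  moreover have "{x, i} \<in> m" "{y, i'} \<in> m" using x y by (simp_all add: insert_commute)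
  ultimately show "i = i'"
    using pair_partitions_unique[OF assms] x(1) y(1) i by (auto split: if_splits) (metis Suc_n_not_le_n, metis Suc_n_not_le_n)
qed

lemma card_steps_Cons:
  "card {t. t < Suc n \<and> Q ((x # ys) ! t) ((x # ys) ! Suc t)} =
   (if Q x (ys ! 0) then 1 else 0) + card {t. t < n \<and> Q (ys ! t) (ys ! Suc t)}"
proof -
  have "{t. t < Suc n \<and> Q ((x # ys) ! t) ((x # ys) ! Suc t)} =
    (if Q x (ys ! 0) then {0} else {}) \<union> Suc ` {t. t < n \<and> Q (ys ! t) (ys ! Suc t)}"
    by (auto simp: image_iff less_Suc_eq_0_disj split: if_splits)
  also have "card \<dots> = (if Q x (ys ! 0) then 1 else 0) + card (Suc ` {t. t < n \<and> Q (ys ! t) (ys ! Suc t)})"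
    by (subst card_Un_disjoint) auto
  finally show ?thesis by (simp add: card_image)
qed

lemma weingarten_paths_Cons:
  assumes m: "m \<in> pair_partitions (2 * Suc k)"
  shows "m # ys \<in> weingarten_paths (Suc k) m l \<longleftrightarrow>
    (\<exists>l'. l = Suc l' \<and> solid_arrow m (ys ! 0) \<and> ys \<in> weingarten_paths (Suc k) (ys ! 0) l') \<or>
    (dashed_arrow m (ys ! 0) \<and> ys \<in> weingarten_paths k (ys ! 0) l)"
proof -
  note c = card_steps_Cons[of "l + k" _ m ys]
  note n = not_solid_and_dashed[OF m, of "ys ! 0"]
  have "m # ys \<in> weingarten_paths (Suc k) m l \<longleftrightarrow>
    length ys = l + k + 1 \<and> ys ! (l + k) = {} \<and>
    (solid_arrow m (ys ! 0) \<or> dashed_arrow m (ys ! 0)) \<and>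
    (\<forall>t < l + k. solid_arrow (ys ! t) (ys ! Suc t) \<or> dashed_arrow (ys ! t) (ys ! Suc t)) \<and>
    (if solid_arrow m (ys ! 0) then 1 else 0) + card {t. t < l + k \<and> solid_arrow (ys ! t) (ys ! Suc t)} = l \<and>
    (if dashed_arrow m (ys ! 0) then 1 else 0) + card {t. t < l + k \<and> dashed_arrow (ys ! t) (ys ! Suc t)} = Suc k"
    unfolding weingarten_paths_def mem_Collect_eq add_Suc_right c
    by (auto simp: less_Suc_eq_0_disj all_conj_distrib)
  then show ?thesis using n unfolding weingarten_paths_def by (cases l) auto
qed

lemma weingarten_paths_hd: "xs \<in> weingarten_paths k m l \<Longrightarrow> xs \<noteq> [] \<and> xs ! 0 = m"
  by (auto simp: weingarten_paths_def)

lemma weingarten_paths_Suc: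
  assumes m: "m \<in> pair_partitions (2 * Suc k)"
  shows "weingarten_paths (Suc k) m l =
    (\<Union>i\<in>{1..2 * k}. if l = 0 then {} else (#) m ` weingarten_paths (Suc k) (perm_act (Transposition.transpose i (2 * k + 1)) m) (l - 1)) \<union>
    (if {2 * k + 1, 2 * k + 2} \<in> m then (#) m ` weingarten_paths k (m - {{2 * k + 1, 2 * k + 2}}) l else {})"
  (is "?A = ?B")
proof (rule set_eqI)
  fix xs
  show "xs \<in> ?A \<longleftrightarrow> xs \<in> ?B"
  proof (cases "\<exists>ys. xs = m # ys")
    case False
    then have "xs \<notin> ?A" using weingarten_paths_hd by (cases xs) fastforce+
    moreover have "xs \<notin> ?B" using False by (auto split: if_splits)
    ultimately show ?thesis by blast
  next
    case True
    then obtain ys where ys: "xs = m # ys" by blast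
    have s: "(\<exists>i\<in>{1..2 * k}. ys ! 0 = perm_act (Transposition.transpose i (2 * k + 1)) m) \<and> ys \<in> weingarten_paths (Suc k) (ys ! 0) l' \<longleftrightarrow>
      (\<exists>i\<in>{1..2 * k}. ys \<in> weingarten_paths (Suc k) (perm_act (Transposition.transpose i (2 * k + 1)) m) l')" for l'
      using weingarten_paths_hd by metis
    have d: "ys ! 0 = n \<and> ys \<in> weingarten_paths k (ys ! 0) l \<longleftrightarrow> ys \<in> weingarten_paths k n l" for n
      using weingarten_paths_hd by metis
    have "xs \<in> ?A \<longleftrightarrow> (\<exists>l'. l = Suc l' \<and> solid_arrow m (ys ! 0) \<and> ys \<in> weingarten_paths (Suc k) (ys ! 0) l') \<or>
      (dashed_arrow m (ys ! 0) \<and> ys \<in> weingarten_paths k (ys ! 0) l)"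
      unfolding ys by (rule weingarten_paths_Cons[OF m])
    also have "\<dots> \<longleftrightarrow> xs \<in> ?B"
      unfolding ys solid_arrow_iff[OF m] dashed_arrow_iff[OF m] s conj_assoc d
      by (cases l) (auto split: if_splits)
    finally show ?thesis .
  qed
qed

lemma card_weingarten_paths:
  assumes "m \<in> pair_partitions (2 * k)"
  shows "finite (weingarten_paths k m l) \<and> card (weingarten_paths k m l) = npaths k l m"
  using assms
proof (induction k l m rule: npaths.induct)
  case (1 l m)
  then have m: "m = {}" using pair_partitions_0 by simp
  show ?case
  proof (cases l)
    case 0
    have "weingarten_paths 0 m 0 = {[{}]}"
      by (auto simp: weingarten_paths_def m length_Suc_conv)
    then show ?thesis using 0 by simp
  next
    case (Suc l')
    have "weingarten_paths 0 m l = {}"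
      using no_arrow_empty by (fastforce simp: weingarten_paths_def m Suc)
    then show ?thesis using Suc by simp
  qed
next
  case (2 k m)
  show ?case
    using weingarten_paths_Suc[OF 2(2), of 0] 2 pair_partitions_Suc[OF 2(2)]
    by (auto simp: card_image)
next
  case (3 k l m)
  let ?n = "\<lambda>i. perm_act (Transposition.transpose i (2 * k + 1)) m" and ?b = "{2 * k + 1, 2 * k + 2}"
  define A where "A = (\<Union>i\<in>{1..2 * k}. (#) m ` weingarten_paths (Suc k) (?n i) l)"
  define B where "B = (if ?b \<in> m then (#) m ` weingarten_paths k (m - {?b}) (Suc l) else {})"
  have AB: "weingarten_paths (Suc k) m (Suc l) = A \<union> B"
    unfolding weingarten_paths_Suc[OF 3(3)] A_def B_def by simp
  have IH: "finite (weingarten_paths (Suc k) (?n i) l)" "card (weingarten_paths (Suc k) (?n i) l) = npaths (Suc k) l (?n i)"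
    if "i \<in> {1..2 * k}" for i
    using 3(1)[OF that perm_act_apex[OF 3(3) that]] by auto
  have A: "finite A" "card A = (\<Sum>i\<in>{1..2 * k}. npaths (Suc k) l (?n i))"
  proof -
    show "finite A" unfolding A_def using IH by auto
    have "card A = (\<Sum>i\<in>{1..2 * k}. card ((#) m ` weingarten_paths (Suc k) (?n i) l))"
      unfolding A_def
    proof (rule card_UN_disjoint)
      show "\<forall>i\<in>{1..2 * k}. \<forall>j\<in>{1..2 * k}. i \<noteq> j \<longrightarrow>
        (#) m ` weingarten_paths (Suc k) (?n i) l \<inter> (#) m ` weingarten_paths (Suc k) (?n j) l = {}"
      proof (intro ballI impI)
        fix i j assume ij: "i \<in> {1..2 * k}" "j \<in> {1..2 * k}" "i \<noteq> j"
        then have "?n i \<noteq> ?n j" using inj_onD[OF perm_act_apex_inj[OF 3(3)]] by blast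
        then have "ys \<notin> weingarten_paths (Suc k) (?n j) l" if "ys \<in> weingarten_paths (Suc k) (?n i) l" for ys
          using that weingarten_paths_hd by metis
        then show "(#) m ` weingarten_paths (Suc k) (?n i) l \<inter> (#) m ` weingarten_paths (Suc k) (?n j) l = {}"
          by blast
      qed
    qed (use IH in auto)
    also have "\<dots> = (\<Sum>i\<in>{1..2 * k}. npaths (Suc k) l (?n i))"
      using IH by (intro sum.cong) (auto simp: card_image)
    finally show "card A = (\<Sum>i\<in>{1..2 * k}. npaths (Suc k) l (?n i))" .
  qed
  have B: "finite B" "card B = (if ?b \<in> m then npaths k (Suc l) (m - {?b}) else 0)"
    using 3(2) pair_partitions_Suc[OF 3(3)] by (auto simp: B_def card_image)
  have "A \<inter> B = {}"
  proof -
    have "ys ! 0 \<in> pair_partitions (2 * Suc k)" if "m # ys \<in> A" for ys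
      using that weingarten_paths_hd perm_act_apex[OF 3(3)] unfolding A_def by fastforce
    moreover have "ys ! 0 \<in> pair_partitions (2 * k)" if "m # ys \<in> B" for ys
      using that weingarten_paths_hd pair_partitions_Suc[OF 3(3)] unfolding B_def by (fastforce split: if_splits)
    moreover have "\<exists>ys. xs = m # ys" if "xs \<in> A" for xs using that unfolding A_def by auto
    moreover have False if "n \<in> pair_partitions (2 * Suc k)" "n \<in> pair_partitions (2 * k)" for n
      using pair_partitions_level[OF that] by simp
    ultimately show ?thesis by (metis disjoint_iff)
  qed
  then show ?case unfolding AB using A B by (simp add: card_Un_disjoint)
qed

section \<open>Numbers of paths by excess\<close>

lemma pairing_norm_0: "pairing_norm 0 m = 0"
  by (simp add: pairing_norm_def)

text \<open>A solid step lowers the norm by at most one, a dashed step keeps it, and the empty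
  pairing has norm 0.\<close>

lemma npaths_below_norm:
  assumes "m \<in> pair_partitions (2 * k)" "l < pairing_norm k m"
  shows "npaths k l m = 0"
  using assms
proof (induction k l m rule: npaths.induct)
  case (1 l m)
  then show ?case by (simp add: pairing_norm_0)
next
  case (2 k m)
  show ?case
  proof (rule transposition_classes[OF 2(2)])
    let ?b = "{2 * k + 1, 2 * k + 2}"
    assume "?b \<in> m \<Longrightarrow> pairing_norm k (m - {?b}) = pairing_norm (Suc k) m"
    then show ?thesis using 2(1)[OF _ pair_partitions_Suc[OF 2(2)]] 2(3) by simp
  qed
next
  case (3 k l m)
  show ?case
  proof (rule transposition_classes[OF 3(3)])
    fix S T J
    let ?n = "\<lambda>i. perm_act (Transposition.transpose i (2 * k + 1)) m" and ?b = "{2 * k + 1, 2 * k + 2}"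
    assume U: "{1..2 * k} = S \<union> T \<union> J"
      and c: "\<And>i. i \<in> S \<Longrightarrow> Suc (pairing_norm (Suc k) (?n i)) = pairing_norm (Suc k) m"
        "\<And>i. i \<in> T \<Longrightarrow> pairing_norm (Suc k) (?n i) = pairing_norm (Suc k) m"
        "\<And>i. i \<in> J \<Longrightarrow> pairing_norm (Suc k) (?n i) = Suc (pairing_norm (Suc k) m)"
      and b: "?b \<in> m \<Longrightarrow> pairing_norm k (m - {?b}) = pairing_norm (Suc k) m"
    have "npaths (Suc k) l (?n i) = 0" if "i \<in> {1..2 * k}" for i
    proof (rule 3(1)[OF that perm_act_apex[OF 3(3) that]])
      from that consider "i \<in> S" | "i \<in> T" | "i \<in> J" using U by blast
      then show "l < pairing_norm (Suc k) (?n i)"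
        using c[of i] 3(4) by cases linarith+
    qed
    then show ?thesis using 3(2)[OF _ pair_partitions_Suc[OF 3(3)]] 3(4) b by simp
  qed
qed

text \<open>Only splits and dashed steps can begin a geodesic, and the last property in
  \<open>transposition_classes\<close> is the same recursion for the weights.\<close>

lemma npaths_geodesic:
  assumes "m \<in> pair_partitions (2 * k)" "l = pairing_norm k m"
  shows "real (npaths k l m) = catalan_weight k m"
  using assms
proof (induction k l m rule: npaths.induct)
  case (1 l m)
  have "loops 0 m []" by (simp add: loops_def)
  then show ?case using catalan_weight_loops[OF 1(1)] 1(2) by (simp add: pairing_norm_0)
next
  case (2 k m)
  show ?case
  proof (rule transposition_classes[OF 2(2)])
    fix S T J
    let ?n = "\<lambda>i. perm_act (Transposition.transpose i (2 * k + 1)) m" and ?b = "{2 * k + 1, 2 * k + 2}"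
    assume S: "\<And>i. i \<in> S \<Longrightarrow> Suc (pairing_norm (Suc k) (?n i)) = pairing_norm (Suc k) m"
      and b: "?b \<in> m \<Longrightarrow> pairing_norm k (m - {?b}) = pairing_norm (Suc k) m"
      and s: "(\<Sum>i\<in>S. catalan_weight (Suc k) (?n i)) + (if ?b \<in> m then catalan_weight k (m - {?b}) else 0) = catalan_weight (Suc k) m"
    \<comment> \<open>At norm 0 nothing can be split.\<close>
    have "S = {}" using S 2(3) by force
    with s have "(if ?b \<in> m then catalan_weight k (m - {?b}) else 0) = catalan_weight (Suc k) m" by simp
    then show ?thesis using 2(1)[OF _ pair_partitions_Suc[OF 2(2)]] b 2(3) by (simp split: if_splits)
  qed
next
  case (3 k l m)
  show ?case
  proof (rule transposition_classes[OF 3(3)])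
    fix S T J
    let ?n = "\<lambda>i. perm_act (Transposition.transpose i (2 * k + 1)) m" and ?b = "{2 * k + 1, 2 * k + 2}"
    assume U: "{1..2 * k} = S \<union> T \<union> J" and dis: "S \<inter> T = {}" "(S \<union> T) \<inter> J = {}"
      and S: "\<And>i. i \<in> S \<Longrightarrow> Suc (pairing_norm (Suc k) (?n i)) = pairing_norm (Suc k) m"
      and T: "\<And>i. i \<in> T \<Longrightarrow> pairing_norm (Suc k) (?n i) = pairing_norm (Suc k) m"
      and J: "\<And>i. i \<in> J \<Longrightarrow> pairing_norm (Suc k) (?n i) = Suc (pairing_norm (Suc k) m)"
      and b: "?b \<in> m \<Longrightarrow> pairing_norm k (m - {?b}) = pairing_norm (Suc k) m"
      and s: "(\<Sum>i\<in>S. catalan_weight (Suc k) (?n i)) + (if ?b \<in> m then catalan_weight k (m - {?b}) else 0) = catalan_weight (Suc k) m"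
    have fin: "finite S" "finite T" "finite J" using U by (metis finite_Un finite_atLeastAtMost)+
    have n: "?n i \<in> pair_partitions (2 * Suc k)" if "i \<in> S \<union> T \<union> J" for i
      using perm_act_apex[OF 3(3)] that U by blast
    \<comment> \<open>After a reversal or a join the remaining \<open>l\<close> solid steps fall
      short of the norm.\<close>
    have "(\<Sum>i\<in>{1..2 * k}. npaths (Suc k) l (?n i)) = (\<Sum>i\<in>S. npaths (Suc k) l (?n i))"
      using U dis fin n T J 3(4) by (intro sum.mono_neutral_right) (auto intro!: npaths_below_norm)
    then have "real (\<Sum>i\<in>{1..2 * k}. npaths (Suc k) l (?n i)) = real (\<Sum>i\<in>S. npaths (Suc k) l (?n i))" by simp
    also have "\<dots> = (\<Sum>i\<in>S. catalan_weight (Suc k) (?n i))"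
      unfolding of_nat_sum
    proof (intro sum.cong refl)
      fix i assume i: "i \<in> S"
      then have "i \<in> {1..2 * k}" "l = pairing_norm (Suc k) (?n i)" using U S[OF i] 3(4) by auto
      then show "real (npaths (Suc k) l (?n i)) = catalan_weight (Suc k) (?n i)"
        using 3(1) n i by blast
    qed
    finally have e: "real (\<Sum>i\<in>{1..2 * k}. npaths (Suc k) l (?n i)) = (\<Sum>i\<in>S. catalan_weight (Suc k) (?n i))" .
    have "real (if ?b \<in> m then npaths k (Suc l) (m - {?b}) else 0) = (if ?b \<in> m then catalan_weight k (m - {?b}) else 0)"
      using 3(2)[OF _ pair_partitions_Suc[OF 3(3)]] b 3(4) by simp
    then show ?thesis using s e by simp
  qed
qed

lemma npaths_two_steps:
  assumes "m \<in> pair_partitions (2 * Suc k)"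
  shows "2 * k * npaths (Suc k) l m \<le> npaths (Suc k) (Suc (Suc l)) m"
proof -
  let ?n = "\<lambda>i m. perm_act (Transposition.transpose i (2 * k + 1)) m"
  have "npaths (Suc k) l m \<le> npaths (Suc k) (Suc l) (?n i m)" if "i \<in> {1..2 * k}" for i
  proof -
    have "npaths (Suc k) l m = npaths (Suc k) l (?n i (?n i m))" by (simp add: perm_act_perm_act)
    also have "\<dots> \<le> (\<Sum>j\<in>{1..2 * k}. npaths (Suc k) l (?n j (?n i m)))"
      using that by (intro member_le_sum) auto
    also have "\<dots> \<le> npaths (Suc k) (Suc l) (?n i m)" by simp
    finally show ?thesis .
  qed
  then have "(\<Sum>i\<in>{1..2 * k}. npaths (Suc k) l m) \<le> (\<Sum>i\<in>{1..2 * k}. npaths (Suc k) (Suc l) (?n i m))"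
    by (rule sum_mono)
  also have "\<dots> \<le> npaths (Suc k) (Suc (Suc l)) m" by simp
  finally show ?thesis by simp
qed

text \<open>The factor \<open>pairing_norm k m + k\<close> is the number of steps of a geodesic path: the first step that
  is not geodesic can occur at any of them, and there it is a reversal (excess 1) or a join
  (excess 2).\<close>

lemma npaths_excess_le_aux:
  assumes outer: "\<And>j' k m. j' < j \<Longrightarrow> k \<le> K \<Longrightarrow> m \<in> pair_partitions (2 * k) \<Longrightarrow>
      real (npaths k (pairing_norm k m + j') m) \<le> C ^ j' * catalan_weight k m"
    and j: "0 < j" and C: "0 \<le> C"
  defines "Q \<equiv> real K * C ^ (j - 1) + (if j = 1 then 0 else 16 * real K ^ 3 * C ^ (j - 2))"
  assumes "m \<in> pair_partitions (2 * k)" "k \<le> K" "l = pairing_norm k m + j"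
  shows "real (npaths k l m) \<le> real (pairing_norm k m + k) * Q * catalan_weight k m"
  using assms(5-)
proof (induction k l m rule: npaths.induct)
  case (1 l m)
  then show ?case using j by (simp add: pairing_norm_0)
next
  case (2 k m)
  then show ?case using j by simp
next
  case (3 k l m)
  show ?case
  proof (rule transposition_classes[OF 3(3)])
    fix S T J
    let ?n = "\<lambda>i. perm_act (Transposition.transpose i (2 * k + 1)) m" and ?b = "{2 * k + 1, 2 * k + 2}"
    let ?w = "catalan_weight (Suc k) m" and ?h = "pairing_norm (Suc k) m + k"
    assume U: "{1..2 * k} = S \<union> T \<union> J" and dis: "S \<inter> T = {}" "(S \<union> T) \<inter> J = {}"
      and cT: "card T \<le> k" and cJ: "card J \<le> 2 * k"
      and S: "\<And>i. i \<in> S \<Longrightarrow> Suc (pairing_norm (Suc k) (?n i)) = pairing_norm (Suc k) m"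
      and T: "\<And>i. i \<in> T \<Longrightarrow> pairing_norm (Suc k) (?n i) = pairing_norm (Suc k) m"
        "\<And>i. i \<in> T \<Longrightarrow> catalan_weight (Suc k) (?n i) = ?w"
      and J: "\<And>i. i \<in> J \<Longrightarrow> pairing_norm (Suc k) (?n i) = Suc (pairing_norm (Suc k) m)"
        "\<And>i. i \<in> J \<Longrightarrow> catalan_weight (Suc k) (?n i) \<le> 8 * (real (Suc k))\<^sup>2 * ?w"
      and b: "?b \<in> m \<Longrightarrow> pairing_norm k (m - {?b}) = pairing_norm (Suc k) m"
      and s: "(\<Sum>i\<in>S. catalan_weight (Suc k) (?n i)) + (if ?b \<in> m then catalan_weight k (m - {?b}) else 0) = ?w"
    have fin: "finite S" "finite T" "finite J" using U by (metis finite_Un finite_atLeastAtMost)+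
    have n: "?n i \<in> pair_partitions (2 * Suc k)" if "i \<in> S \<union> T \<union> J" for i
      using perm_act_apex[OF 3(3)] that U by blast
    have w: "0 < ?w" using catalan_weight_pos[OF 3(3)] .
    have Q: "0 \<le> Q" unfolding Q_def using C by simp
    have l: "l = pairing_norm (Suc k) m + (j - 1)" using 3(5) j by simp
    \<comment> \<open>A split keeps the excess and leaves a geodesic length smaller by one. As the
      weights of the splits and of the dashed step sum to \<open>?w\<close>, these contribute at
      most \<open>?h * Q * ?w\<close>; the unit gained, \<open>Q * ?w\<close>, pays for the
      reversals and joins.\<close>
    have sS: "(\<Sum>i\<in>S. real (npaths (Suc k) l (?n i))) \<le> (\<Sum>i\<in>S. real ?h * Q * catalan_weight (Suc k) (?n i))"
    proof (rule sum_mono)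
      fix i assume i: "i \<in> S"
      have "i \<in> {1..2 * k}" "l = pairing_norm (Suc k) (?n i) + j" using i U l S[OF i] j by auto
      then have "real (npaths (Suc k) l (?n i)) \<le> real (pairing_norm (Suc k) (?n i) + Suc k) * Q * catalan_weight (Suc k) (?n i)"
        using 3(1) n 3(4) i by blast
      also have "pairing_norm (Suc k) (?n i) + Suc k = ?h" using S[OF i] by simp
      finally show "real (npaths (Suc k) l (?n i)) \<le> real ?h * Q * catalan_weight (Suc k) (?n i)" .
    qed
    have "(\<Sum>i\<in>T. real (npaths (Suc k) l (?n i))) \<le> (\<Sum>i\<in>T. C ^ (j - 1) * ?w)"
    proof (rule sum_mono)
      fix i assume i: "i \<in> T"
      show "real (npaths (Suc k) l (?n i)) \<le> C ^ (j - 1) * ?w"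
        using outer[of "j - 1" "Suc k" "?n i"] 3(4) n[of i] i j unfolding T(1)[OF i] T(2)[OF i] l by auto
    qed
    also have "\<dots> \<le> real K * C ^ (j - 1) * ?w"
    proof -
      have "real (card T) * (C ^ (j - 1) * ?w) \<le> real K * (C ^ (j - 1) * ?w)"
        using cT 3(4) C w by (intro mult_right_mono) auto
      then show ?thesis by simp
    qed
    finally have sT: "(\<Sum>i\<in>T. real (npaths (Suc k) l (?n i))) \<le> real K * C ^ (j - 1) * ?w" .
    \<comment> \<open>A join uses up two units of excess, so no path of excess 1 begins with one.
      Otherwise there are at most \<open>2 * K\<close> joins, each raising the weight at most by the
      factor \<open>8 * K^2\<close>.\<close>
    have sJ: "(\<Sum>i\<in>J. real (npaths (Suc k) l (?n i))) \<le> (if j = 1 then 0 else 16 * real K ^ 3 * C ^ (j - 2)) * ?w"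
    proof (cases "j = 1")
      case True
      then have "npaths (Suc k) l (?n i) = 0" if "i \<in> J" for i
        using n that J(1)[OF that] l by (intro npaths_below_norm) auto
      then show ?thesis using True by simp
    next
      case False
      have "real (npaths (Suc k) l (?n i)) \<le> C ^ (j - 2) * (8 * (real K)\<^sup>2 * ?w)" if "i \<in> J" for i
      proof -
        have "real (npaths (Suc k) l (?n i)) \<le> C ^ (j - 2) * catalan_weight (Suc k) (?n i)"
          using outer[OF _ 3(4) n, of "j - 2" i] that J(1)[OF that] j False l by (auto simp: numeral_2_eq_2 Suc_diff_Suc)
        also have "\<dots> \<le> C ^ (j - 2) * (8 * (real (Suc k))\<^sup>2 * ?w)"
          using J(2)[OF that] C by (intro mult_left_mono) auto
        also have "\<dots> \<le> C ^ (j - 2) * (8 * (real K)\<^sup>2 * ?w)"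
          using C w 3(4) by (intro mult_left_mono mult_right_mono power_mono) auto
        finally show ?thesis .
      qed
      then have "(\<Sum>i\<in>J. real (npaths (Suc k) l (?n i))) \<le> real (card J) * (C ^ (j - 2) * (8 * (real K)\<^sup>2 * ?w))"
        by (rule sum_bounded_above)
      also have "\<dots> \<le> (2 * real K) * (C ^ (j - 2) * (8 * (real K)\<^sup>2 * ?w))"
        using cJ 3(4) C w by (intro mult_right_mono) auto
      finally show ?thesis using False by (simp add: power2_eq_square power3_eq_cube mult_ac)
    qed
    have sb: "real (if ?b \<in> m then npaths k (Suc l) (m - {?b}) else 0) \<le> real ?h * Q * (if ?b \<in> m then catalan_weight k (m - {?b}) else 0)"
      using 3(2)[OF _ pair_partitions_Suc[OF 3(3)]] 3(4,5) b by auto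
    have "{1..2 * k} = S \<union> (T \<union> J)" "S \<inter> (T \<union> J) = {}" "T \<inter> J = {}" using U dis by auto
    then have "real (npaths (Suc k) (Suc l) m) = (\<Sum>i\<in>S. real (npaths (Suc k) l (?n i))) + (\<Sum>i\<in>T. real (npaths (Suc k) l (?n i)))
       + (\<Sum>i\<in>J. real (npaths (Suc k) l (?n i))) + real (if ?b \<in> m then npaths k (Suc l) (m - {?b}) else 0)"
      using fin by (simp add: sum.union_disjoint)
    also have "\<dots> \<le> real ?h * Q * ((\<Sum>i\<in>S. catalan_weight (Suc k) (?n i)) + (if ?b \<in> m then catalan_weight k (m - {?b}) else 0))
       + real K * C ^ (j - 1) * ?w + (if j = 1 then 0 else 16 * real K ^ 3 * C ^ (j - 2)) * ?w"
      using sS sT sJ sb by (simp add: sum_distrib_left distrib_left)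
    also have "\<dots> = real (pairing_norm (Suc k) m + Suc k) * Q * ?w"
      unfolding s by (simp add: Q_def algebra_simps)
    finally show ?thesis .
  qed
qed

text \<open>Strong induction on the excess, with the induction along the path left to
  \<open>npaths_excess_le_aux\<close>. A geodesic has at most \<open>2 * K\<close> steps, so what
  remains is \<open>2 * K * Q \<le> C ^ j\<close>.\<close>

lemma npaths_excess_le:
  assumes C: "12 * (real K)\<^sup>2 \<le> C" and "k \<le> K" "m \<in> pair_partitions (2 * k)"
  shows "real (npaths k (pairing_norm k m + j) m) \<le> C ^ j * catalan_weight k m"
  using assms(2,3)
proof (induction j arbitrary: k m rule: less_induct)
  case (less j)
  show ?case
  proof (cases "j = 0")
    case True
    then show ?thesis using npaths_geodesic[OF less(3)] by simp
  next
    case False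
    have C0: "0 \<le> C" using C by (meson order_trans zero_le_mult_iff zero_le_numeral zero_le_power2)
    define Q where "Q = real K * C ^ (j - 1) + (if j = 1 then 0 else 16 * real K ^ 3 * C ^ (j - 2))"
    have Q0: "0 \<le> Q" unfolding Q_def using C0 by simp
    have w: "0 < catalan_weight k m" using catalan_weight_pos[OF less(3)] .
    have "real (npaths k (pairing_norm k m + j) m) \<le> real (pairing_norm k m + k) * Q * catalan_weight k m"
      unfolding Q_def using less False C0 by (intro npaths_excess_le_aux) auto
    also have "\<dots> \<le> 2 * real K * Q * catalan_weight k m"
    proof -
      have "pairing_norm k m \<le> k" by (simp add: pairing_norm_def)
      then show ?thesis using Q0 w less(2) by (intro mult_right_mono) auto
    qed
    also have "2 * real K * Q \<le> C ^ j"
    proof (cases "j = 1")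
      case True
      have "2 * (real K)\<^sup>2 \<le> 12 * (real K)\<^sup>2" by simp
      with C have "2 * (real K)\<^sup>2 \<le> C" by (rule order_trans[rotated])
      then show ?thesis using True by (simp add: Q_def power2_eq_square)
    next
      case False
      with \<open>j \<noteq> 0\<close> obtain i where i: "j = Suc (Suc i)" by (metis One_nat_def not0_implies_Suc)
      \<comment> \<open>Since \<open>K^2\<close> is at most \<open>C / 12\<close>, the two terms are
        at most 1/6 and 2/9 of \<open>C * C\<close>.\<close>
      have "2 * real K * (real K * C + 16 * real K ^ 3) \<le> C * C"
      proof -
        let ?x = "(real K)\<^sup>2"
        have "2 * ?x * C + 32 * ?x * ?x \<le> (C / 6) * C + 32 * (C / 12) * (C / 12)"
          using C C0 by (intro add_mono mult_mono) auto
        also have "\<dots> \<le> C * C" using C0 by simp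
        finally show ?thesis by (simp add: power2_eq_square power3_eq_cube algebra_simps)
      qed
      from mult_right_mono[OF this, of "C ^ i"] C0
      show ?thesis by (simp add: Q_def i algebra_simps)
    qed
    finally show ?thesis using w by simp
  qed
qed

section \<open>Elements of the symplectic group\<close>

fun conj_index :: "'d + 'd \<Rightarrow> 'd + 'd" where
  "conj_index (Inl a) = Inr a"
| "conj_index (Inr a) = Inl a"

fun index_sign :: "'d + 'd \<Rightarrow> complex" where
  "index_sign (Inl a) = 1"
| "index_sign (Inr a) = - 1"

lemma conj_index_conj_index [simp]: "conj_index (conj_index p) = p"
  by (cases p) simp_all

lemma conj_index_neq [simp]: "conj_index p \<noteq> p" "p \<noteq> conj_index p"
  by (cases p; simp)+

lemma conj_index_eq_iff: "conj_index p = q \<longleftrightarrow> p = conj_index q"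
  by auto

lemma index_sign_conj [simp]: "index_sign (conj_index p) = - index_sign p"
  by (cases p) simp_all

lemma index_sign_square [simp]: "index_sign p * index_sign p = 1"
  by (cases p) simp_all

lemma cnj_index_sign [simp]: "cnj (index_sign p) = index_sign p"
  by (cases p) simp_all

lemma bij_conj_index: "bij conj_index"
  by (rule o_bij[of conj_index]) (auto simp: fun_eq_iff)

lemma sp_J_entry: "sp_J $ p $ q = (if q = conj_index p then index_sign p else 0)"
  by (cases p; cases q) (auto simp: sp_J_def)

lemma sum_conj_index: "(\<Sum>p\<in>UNIV. F (conj_index p)) = (\<Sum>p\<in>UNIV. F (p::('d::finite) + 'd))"
  using sum.reindex_bij_betw[of conj_index UNIV UNIV F] bij_conj_index by simp

lemma sum_UNIV_sum: "(\<Sum>p\<in>UNIV. F p) = (\<Sum>b\<in>UNIV. F (Inl (b::'d::finite)) + F (Inr (b::'d)))"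
proof -
  have "(\<Sum>p\<in>UNIV. F p) = (\<Sum>p\<in>UNIV <+> UNIV. F (p :: 'd + 'd))" by simp
  also have "\<dots> = (\<Sum>b\<in>UNIV. F (Inl b)) + (\<Sum>b\<in>UNIV. F (Inr b))"
    by (subst sum.Plus) (simp_all add: o_def)
  finally show ?thesis by (simp add: sum.distrib)
qed

lemma unitary_group_iff:
  "g \<in> unitary_group \<longleftrightarrow> (\<forall>p q. (\<Sum>r\<in>UNIV. g $ p $ r * cnj (g $ q $ r)) = (if p = q then 1 else 0))"
proof -
  have "g ** Finite_Cartesian_Product.transpose (map_matrix cnj g) = mat 1 \<longleftrightarrow>
    (\<forall>p q. (\<Sum>r\<in>UNIV. g $ p $ r * cnj (g $ q $ r)) = (if p = q then 1 else 0))"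
    by (simp add: vec_eq_iff matrix_matrix_mult_def Finite_Cartesian_Product.transpose_def mat_def)
  moreover have "g ** h = mat 1 \<longleftrightarrow> h ** g = mat 1" for h
    by (rule matrix_left_right_inverse)
  ultimately show ?thesis unfolding unitary_group_def by auto
qed

lemma unitary_group_columns:
  assumes "g \<in> unitary_group"
  shows "(\<Sum>r\<in>UNIV. cnj (g $ r $ p) * g $ r $ q) = (if p = q then 1 else 0)"
proof -
  have "(Finite_Cartesian_Product.transpose (map_matrix cnj g) ** g) $ p $ q = mat 1 $ p $ q"
    using assms by (simp add: unitary_group_def)
  then show ?thesis
    by (simp add: matrix_matrix_mult_def Finite_Cartesian_Product.transpose_def mat_def)
qed

lemma Sp_group_iff:
  "g \<in> Sp_group \<longleftrightarrow> g \<in> unitary_group \<and>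
     (\<forall>p q. cnj (g $ conj_index p $ q) = - index_sign p * index_sign q * g $ p $ conj_index q)"
proof -
  have "(g ** sp_J) $ p $ q = - index_sign q * g $ p $ conj_index q" for p q
  proof -
    have "(g ** sp_J) $ p $ q = (\<Sum>r\<in>UNIV. if r = conj_index q then g $ p $ r * index_sign r else 0)"
      unfolding matrix_matrix_mult_def vec_lambda_beta by (rule sum.cong) (auto simp: sp_J_entry)
    then show ?thesis by simp
  qed
  moreover have "(sp_J ** map_matrix cnj g) $ p $ q = index_sign p * cnj (g $ conj_index p $ q)" for p q
  proof -
    have "(sp_J ** map_matrix cnj g) $ p $ q = (\<Sum>r\<in>UNIV. if r = conj_index p then index_sign p * cnj (g $ r $ q) else 0)"
      unfolding matrix_matrix_mult_def vec_lambda_beta by (rule sum.cong) (auto simp: sp_J_entry)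
    then show ?thesis by simp
  qed
  moreover have "- index_sign q * x = index_sign p * y \<longleftrightarrow> y = - index_sign p * index_sign q * x" for p q :: "'a + 'a" and x y
    by (cases p; cases q) (auto simp: eq_commute[of _ y] minus_equation_iff)
  ultimately show ?thesis by (simp add: Sp_group_def vec_eq_iff)
qed

text \<open>The quaternionic relation replaces the conjugated entries in the orthogonality of
  columns by entries of \<open>g\<close> itself. Thus the relation can be used inside moments, which
  contain no conjugates.\<close>

lemma Sp_group_symplectic:
  assumes "g \<in> Sp_group"
  shows "(\<Sum>r\<in>UNIV. index_sign r * g $ r $ c * g $ conj_index r $ c') = sp_J $ c $ c'"
proof -
  have e: "cnj (g $ conj_index p $ q) = - index_sign p * index_sign q * g $ p $ conj_index q" for p q
    using assms Sp_group_iff by blast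
  have "(if conj_index c = c' then 1 else 0) = (\<Sum>r\<in>UNIV. cnj (g $ r $ conj_index c) * g $ r $ c')"
    using unitary_group_columns[of g "conj_index c" c'] assms by (simp add: Sp_group_iff)
  also have "\<dots> = (\<Sum>r\<in>UNIV. cnj (g $ conj_index r $ conj_index c) * g $ conj_index r $ c')"
    by (rule sum_conj_index[symmetric])
  also have "\<dots> = index_sign c * (\<Sum>r\<in>UNIV. index_sign r * g $ r $ c * g $ conj_index r $ c')"
    by (simp add: e sum_distrib_left mult_ac)
  finally have "index_sign c * (if conj_index c = c' then 1 else 0) =
     index_sign c * index_sign c * (\<Sum>r\<in>UNIV. index_sign r * g $ r $ c * g $ conj_index r $ c')"
    by simp
  then show ?thesis by (auto simp: sp_J_entry)
qed

lemma map_matrix_cnj_mult: "map_matrix cnj (g ** h) = map_matrix cnj g ** map_matrix cnj h"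
  by (simp add: vec_eq_iff matrix_matrix_mult_def)

lemma Sp_group_mult:
  assumes "g \<in> Sp_group" "h \<in> Sp_group"
  shows "g ** h \<in> Sp_group"
proof -
  let ?T = "\<lambda>g. Finite_Cartesian_Product.transpose (map_matrix cnj g)"
  have T: "?T (g ** h) = ?T h ** ?T g" by (simp add: map_matrix_cnj_mult matrix_transpose_mul)
  have g: "g ** ?T g = mat 1" "?T g ** g = mat 1" "g ** sp_J = sp_J ** map_matrix cnj g"
    and h: "h ** ?T h = mat 1" "?T h ** h = mat 1" "h ** sp_J = sp_J ** map_matrix cnj h"
    using assms by (simp_all add: Sp_group_def unitary_group_def)
  have "(g ** h) ** ?T (g ** h) = g ** (h ** ?T h) ** ?T g" unfolding T by (simp add: matrix_mul_assoc)
  then have 1: "(g ** h) ** ?T (g ** h) = mat 1" using g h by simp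
  have "?T (g ** h) ** (g ** h) = ?T h ** (?T g ** g) ** h" unfolding T by (simp add: matrix_mul_assoc)
  then have 2: "?T (g ** h) ** (g ** h) = mat 1" using g h by simp
  have "(g ** h) ** sp_J = g ** (h ** sp_J)" by (simp add: matrix_mul_assoc)
  also have "\<dots> = (g ** sp_J) ** map_matrix cnj h" unfolding h(3) by (simp add: matrix_mul_assoc)
  also have "\<dots> = sp_J ** map_matrix cnj (g ** h)" unfolding g(3) by (simp add: map_matrix_cnj_mult matrix_mul_assoc)
  finally show ?thesis using 1 2 by (simp add: Sp_group_def unitary_group_def)
qed

section \<open>Special elements of the group\<close>

definition monomial_matrix :: "('d + 'd \<Rightarrow> complex) \<Rightarrow> ('d + 'd \<Rightarrow> 'd + 'd) \<Rightarrow> ('d::finite) sp_matrix" where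
  "monomial_matrix \<phi> \<sigma> = (\<chi> p q. if q = \<sigma> p then \<phi> p else 0)"

lemma monomial_matrix_mult: "(monomial_matrix \<phi> \<sigma> ** g) $ p $ q = \<phi> p * g $ \<sigma> p $ q"
proof -
  have "(monomial_matrix \<phi> \<sigma> ** g) $ p $ q = (\<Sum>r\<in>UNIV. if r = \<sigma> p then \<phi> p * g $ r $ q else 0)"
    unfolding matrix_matrix_mult_def vec_lambda_beta by (rule sum.cong) (auto simp: monomial_matrix_def)
  then show ?thesis by simp
qed

lemma monomial_matrix_Sp:
  assumes "inj \<sigma>" "\<And>p. \<sigma> (conj_index p) = conj_index (\<sigma> p)" "\<And>p. cmod (\<phi> p) = 1"
    and "\<And>p. \<phi> p * index_sign (\<sigma> p) = index_sign p * cnj (\<phi> (conj_index p))"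
  shows "monomial_matrix \<phi> \<sigma> \<in> Sp_group"
  unfolding Sp_group_iff unitary_group_iff
proof (intro conjI allI)
  fix p q
  have "(\<Sum>r\<in>UNIV. monomial_matrix \<phi> \<sigma> $ p $ r * cnj (monomial_matrix \<phi> \<sigma> $ q $ r)) =
    (\<Sum>r\<in>UNIV. if r = \<sigma> p then (if p = q then \<phi> p * cnj (\<phi> p) else 0) else 0)"
    by (rule sum.cong) (use injD[OF assms(1)] in \<open>auto simp: monomial_matrix_def\<close>)
  also have "\<dots> = (if p = q then 1 else 0)"
    using complex_norm_square[of "\<phi> p"] assms(3)[of p] by auto
  finally show "(\<Sum>r\<in>UNIV. monomial_matrix \<phi> \<sigma> $ p $ r * cnj (monomial_matrix \<phi> \<sigma> $ q $ r)) = (if p = q then 1 else 0)" .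
next
  fix p q
  have "cnj (\<phi> (conj_index p)) = index_sign p * (index_sign p * cnj (\<phi> (conj_index p)))"
    by (simp flip: mult.assoc)
  also have "\<dots> = index_sign p * (\<phi> p * index_sign (\<sigma> p))" unfolding assms(4) ..
  finally have *: "cnj (\<phi> (conj_index p)) = index_sign p * (\<phi> p * index_sign (\<sigma> p))" .
  show "cnj (monomial_matrix \<phi> \<sigma> $ conj_index p $ q) = - index_sign p * index_sign q * monomial_matrix \<phi> \<sigma> $ p $ conj_index q"
    using * by (auto simp: monomial_matrix_def assms(2) conj_index_eq_iff)
qed

text \<open>The same real rotation acts on both halves of the coordinates, hence it is compatible
  with J. The angle is Pythagorean to keep all coefficients rational; what matters is that sine and
  cosine are both nonzero.\<close>

definition rotation_matrix :: "'d \<Rightarrow> 'd \<Rightarrow> ('d::finite) sp_matrix" where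
  "rotation_matrix a b = (\<chi> p q. 
     (if q = p then (if p \<in> {Inl a, Inr a, Inl b, Inr b} then 3 / 5 else 1) else 0) +
     (if q = map_sum (Transposition.transpose a b) (Transposition.transpose a b) p
      then (if p \<in> {Inl a, Inr a} then 4 / 5 else if p \<in> {Inl b, Inr b} then - 4 / 5 else 0) else 0))"

lemma rotation_matrix_mult:
  "(rotation_matrix a b ** g) $ p $ q = 
     (if p \<in> {Inl a, Inr a, Inl b, Inr b} then 3 / 5 else 1) * g $ p $ q +
     (if p \<in> {Inl a, Inr a} then 4 / 5 else if p \<in> {Inl b, Inr b} then - 4 / 5 else 0) *
       g $ map_sum (Transposition.transpose a b) (Transposition.transpose a b) p $ q"
  (is "_ = ?\<alpha> * _ + ?\<beta> * g $ ?\<sigma> $ q")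
proof -
  have "(rotation_matrix a b ** g) $ p $ q = (\<Sum>r\<in>UNIV. (if r = p then ?\<alpha> * g $ r $ q else 0) + (if r = ?\<sigma> then ?\<beta> * g $ r $ q else 0))"
    unfolding matrix_matrix_mult_def vec_lambda_beta by (rule sum.cong) (auto simp: rotation_matrix_def distrib_right)
  also have "\<dots> = ?\<alpha> * g $ p $ q + ?\<beta> * g $ ?\<sigma> $ q"
    unfolding sum.distrib by simp
  finally show ?thesis .
qed

lemma rotation_matrix_Sp:
  assumes "a \<noteq> b"
  shows "rotation_matrix a b \<in> Sp_group"
proof -
  define \<sigma> where "\<sigma> = map_sum (Transposition.transpose a b) (Transposition.transpose a b)"
  define \<alpha> \<beta> :: "'a + 'a \<Rightarrow> complex" where "\<alpha> = (\<lambda>p. if p \<in> {Inl a, Inr a, Inl b, Inr b} then 3 / 5 else 1)"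
    and "\<beta> = (\<lambda>p. if p \<in> {Inl a, Inr a} then 4 / 5 else if p \<in> {Inl b, Inr b} then - 4 / 5 else 0)"
  have R: "rotation_matrix a b $ p $ q = (if q = p then \<alpha> p else 0) + (if q = \<sigma> p then \<beta> p else 0)" for p q
    by (simp add: rotation_matrix_def \<alpha>_def \<beta>_def \<sigma>_def)
  have \<sigma>: "\<sigma> (\<sigma> p) = p" "\<sigma> (conj_index p) = conj_index (\<sigma> p)" "index_sign (\<sigma> p) = index_sign p" for p
    by (cases p; simp add: \<sigma>_def)+
  have \<alpha>\<beta>: "\<alpha> (\<sigma> p) = \<alpha> p" "\<beta> (\<sigma> p) = - \<beta> p" "\<alpha> (conj_index p) = \<alpha> p" "\<beta> (conj_index p) = \<beta> p"
    "cnj (\<alpha> p) = \<alpha> p" "cnj (\<beta> p) = \<beta> p" "\<alpha> p * \<alpha> p + \<beta> p * \<beta> p = 1" for p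
    using assms by (cases p; auto simp: \<sigma>_def \<alpha>_def \<beta>_def Transposition.transpose_def)+
  show ?thesis
    unfolding Sp_group_iff unitary_group_iff
  proof (intro conjI allI)
    fix p q
    have "(\<Sum>r\<in>UNIV. rotation_matrix a b $ p $ r * cnj (rotation_matrix a b $ q $ r)) =
      (\<Sum>r\<in>UNIV. (if r = p then \<alpha> p * cnj (rotation_matrix a b $ q $ r) else 0) + (if r = \<sigma> p then \<beta> p * cnj (rotation_matrix a b $ q $ r) else 0))"
      by (intro sum.cong) (auto simp: R[of p] distrib_right)
    also have "\<dots> = \<alpha> p * cnj (rotation_matrix a b $ q $ p) + \<beta> p * cnj (rotation_matrix a b $ q $ \<sigma> p)"
      unfolding sum.distrib by simp
    also have "\<dots> = (if p = q then 1 else 0)"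
    proof -
      have "\<alpha> p * cnj (rotation_matrix a b $ q $ p) = (if p = q then \<alpha> p * \<alpha> p else 0) + (if p = \<sigma> q then \<alpha> p * \<beta> q else 0)"
        by (simp add: R \<alpha>\<beta> distrib_left)
      moreover have "\<beta> p * cnj (rotation_matrix a b $ q $ \<sigma> p) = (if p = \<sigma> q then \<beta> p * \<alpha> q else 0) + (if p = q then \<beta> p * \<beta> p else 0)"
        using \<sigma>(1) by (auto simp: R \<alpha>\<beta> distrib_left) metis+
      ultimately show ?thesis using \<alpha>\<beta>(1,2)[of q] \<alpha>\<beta>(7)[of q] by auto
    qed
    finally show "(\<Sum>r\<in>UNIV. rotation_matrix a b $ p $ r * cnj (rotation_matrix a b $ q $ r)) = (if p = q then 1 else 0)" .
  next
    fix p q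
    show "cnj (rotation_matrix a b $ conj_index p $ q) = - index_sign p * index_sign q * rotation_matrix a b $ p $ conj_index q"
      by (auto simp: R \<alpha>\<beta> \<sigma> conj_index_eq_iff)
  qed
qed

section \<open>Moments of the Haar measure\<close>

definition moment :: "('d::finite) sp_matrix measure \<Rightarrow> nat \<Rightarrow> (nat \<Rightarrow> 'd + 'd) \<Rightarrow> (nat \<Rightarrow> 'd + 'd) \<Rightarrow> complex" where
  "moment M N i j = integral\<^sup>L M (\<lambda>g. \<Prod>r = 1..N. g $ i r $ j r)"

lemma moment_cong:
  assumes "\<And>r. r \<in> {1..N} \<Longrightarrow> i r = i' r" "\<And>r. r \<in> {1..N} \<Longrightarrow> j r = j' r"
  shows "moment M N i j = moment M N i' j'"
proof -
  have "(\<Prod>r = 1..N. g $ i r $ j r) = (\<Prod>r = 1..N. g $ i' r $ j' r)" for g :: "'a sp_matrix"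
    by (rule prod.cong) (simp_all add: assms)
  then show ?thesis by (simp add: moment_def)
qed

lemma unitary_entry_le_1:
  assumes "g \<in> unitary_group"
  shows "cmod (g $ p $ q) \<le> 1"
proof -
  have "(cmod (g $ p $ q))\<^sup>2 \<le> (\<Sum>r\<in>UNIV. (cmod (g $ p $ r))\<^sup>2)"
    by (rule member_le_sum) auto
  also have "complex_of_real \<dots> = (\<Sum>r\<in>UNIV. g $ p $ r * cnj (g $ p $ r))"
    by (simp only: of_real_sum complex_norm_square)
  then have "complex_of_real (\<Sum>r\<in>UNIV. (cmod (g $ p $ r))\<^sup>2) = 1"
    using assms by (simp add: unitary_group_iff)
  then have "(\<Sum>r\<in>UNIV. (cmod (g $ p $ r))\<^sup>2) = 1" using of_real_eq_1_iff by blast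
  finally show ?thesis by (simp add: power_le_one_iff abs_square_le_1)
qed

text \<open>The sixteen terms are kept as an iterated sum so that linearity of the integral applies
  to them uniformly.\<close>

lemma four_factor_expansion:
  fixes c s p :: complex
  assumes "a \<noteq> b"
  shows "p * ((c * f1 a + s * f1 b) * (c * f2 a + s * f2 b) * (c * f3 a + s * f3 b) * (c * f4 a + s * f4 b)) =
    (\<Sum>x\<in>{a, b}. \<Sum>y\<in>{a, b}. \<Sum>z\<in>{a, b}. \<Sum>w\<in>{a, b}.
      (if x = a then c else s) * (if y = a then c else s) * (if z = a then c else s) * (if w = a then c else s) *
      (p * (f1 x * f2 y * f3 z * f4 w)))"
  using assms by (simp add: algebra_simps)

text \<open>By \<open>sp_adapted_std_index\<close> every row index adapted to
  \<open>std_pairing k\<close> has this form, with \<open>f\<close> injective on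
  \<open>{1..k}\<close>.\<close>

definition std_index :: "(nat \<Rightarrow> 'd) \<Rightarrow> nat \<Rightarrow> 'd + 'd" where
  "std_index f r = (if odd r then Inl (f (Suc r div 2)) else Inr (f (r div 2)))"

lemma std_index_upd:
  "std_index (f(Suc a := x)) = (std_index f)(Suc (2 * a) := Inl x, Suc (Suc (2 * a)) := Inr x)"
proof
  fix r
  have "Suc r div 2 = Suc a \<longleftrightarrow> r = Suc (2 * a)" if "odd r" using that by presburger
  moreover have "r div 2 = Suc a \<longleftrightarrow> r = Suc (Suc (2 * a))" if "even r" using that by presburger
  ultimately show "std_index (f(Suc a := x)) r = ((std_index f)(Suc (2 * a) := Inl x, Suc (Suc (2 * a)) := Inr x)) r"
    by (auto simp: std_index_def)
qed

lemma std_index_simps [simp]: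
  "std_index f (Suc (2 * a)) = Inl (f (Suc a))" "std_index f (Suc (Suc (2 * a))) = Inr (f (Suc a))"
  by (simp_all add: std_index_def)

lemma std_index_range:
  assumes "r \<in> {1..2 * k}"
  shows "\<exists>a\<in>{1..k}. std_index f r \<in> {Inl (f a), Inr (f a)} \<and> (r = 2 * a - 1 \<or> r = 2 * a)"
proof (cases "odd r")
  case True
  then obtain b where "r = Suc (2 * b)" by (auto elim: oddE)
  then show ?thesis using assms by (intro bexI[of _ "Suc b"]) auto
next
  case False
  then obtain b where "r = 2 * b" by (auto elim: evenE)
  then show ?thesis using assms by (intro bexI[of _ b]) (auto simp: std_index_def)
qed

lemma sum_pairs: "(\<Sum>q = 1..2 * k. F q) = (\<Sum>a<k. F (Suc (2 * a)) + (F (Suc (Suc (2 * a))) :: complex))"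
  by (induction k) (simp_all add: add.assoc)

context
  fixes M :: "('d::finite) sp_matrix measure"
  assumes haar: "haar_probability_Sp M"
begin

interpretation prob_space M
  using haar by (simp add: haar_probability_Sp_def)

lemma sets_haar: "sets M = sets (restrict_space borel Sp_group)"
  using haar by (simp add: haar_probability_Sp_def)

lemma space_haar: "space M = Sp_group"
  using sets_eq_imp_space_eq[OF sets_haar] by (simp add: space_restrict_space)

lemma measurable_entry: "(\<lambda>g. g $ p $ q) \<in> borel_measurable M"
proof -
  have "(\<lambda>g :: 'd sp_matrix. g $ p $ q) \<in> borel_measurable borel"
    by (intro borel_measurable_continuous_onI continuous_intros)
  then have "(\<lambda>g :: 'd sp_matrix. g $ p $ q) \<in> borel_measurable (restrict_space borel Sp_group)"
    by (rule measurable_restrict_space1)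
  then show ?thesis using measurable_cong_sets[OF sets_haar refl] by blast
qed

lemma entry_le_1: "g \<in> space M \<Longrightarrow> cmod (g $ p $ q) \<le> 1"
  using unitary_entry_le_1 by (auto simp: space_haar Sp_group_def)

lemma measurable_prod_entries: "(\<lambda>g. \<Prod>r\<in>A. g $ i r $ j r) \<in> borel_measurable M"
  using measurable_entry by (intro borel_measurable_prod) auto

lemma prod_entries_le_1: "g \<in> space M \<Longrightarrow> cmod (\<Prod>r\<in>A. g $ i r $ j r) \<le> 1"
  using entry_le_1 by (simp add: prod_norm[symmetric] prod_le_1)

lemma integrable_prod_entries: "integrable M (\<lambda>g. \<Prod>r\<in>A. g $ i r $ j r)"
  by (rule integrable_const_bound[of _ 1]) (auto intro!: AE_I2 prod_entries_le_1 measurable_prod_entries)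

text \<open>This bound starts the iteration in \<open>moment_eq_path_series\<close>.\<close>

lemma moment_le_1: "cmod (moment M N i j) \<le> 1"
proof -
  have "cmod (moment M N i j) \<le> (LINT g|M. cmod (\<Prod>r = 1..N. g $ i r $ j r))"
    unfolding moment_def by (rule integral_norm_bound)
  also have "\<dots> \<le> (LINT g|M. 1)"
    by (rule integral_mono) (auto intro!: prod_entries_le_1 integrable_norm integrable_prod_entries)
  also have "\<dots> = 1" using prob_space by simp
  finally show ?thesis .
qed

lemma haar_invariant:
  assumes h: "h \<in> Sp_group" and f: "f \<in> borel_measurable M"
  shows "integral\<^sup>L M (\<lambda>g. f (h ** g)) = (integral\<^sup>L M f :: complex)"
proof -
  have "continuous_on UNIV (\<lambda>g :: 'd sp_matrix. h ** g)"
    unfolding matrix_matrix_mult_def by (intro continuous_intros)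
  then have "(\<lambda>g :: 'd sp_matrix. h ** g) \<in> measurable borel borel"
    by (rule borel_measurable_continuous_onI)
  then have "(\<lambda>g. h ** g) \<in> measurable (restrict_space borel Sp_group) (restrict_space borel Sp_group)"
    using Sp_group_mult[OF h] by (intro measurable_restrict_space3) auto
  then have m: "(\<lambda>g. h ** g) \<in> measurable M M"
    using measurable_cong_sets[OF sets_haar sets_haar] by blast
  have "integral\<^sup>L M f = integral\<^sup>L (distr M M (\<lambda>g. h ** g)) f"
    using haar h by (simp add: haar_probability_Sp_def)
  also have "\<dots> = integral\<^sup>L M (\<lambda>g. f (h ** g))"
    by (rule integral_distr[OF m f])
  finally show ?thesis by simp
qed

lemma moment_translate:
  assumes "h \<in> Sp_group"
  shows "moment M N i j = integral\<^sup>L M (\<lambda>g. \<Prod>r = 1..N. (h ** g) $ i r $ j r)"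
  unfolding moment_def by (rule haar_invariant[OF assms measurable_prod_entries, symmetric])

lemma moment_monomial:
  assumes "monomial_matrix \<phi> \<sigma> \<in> (Sp_group :: 'd sp_matrix set)"
  shows "moment M N i j = (\<Prod>r = 1..N. \<phi> (i r)) * moment M N (\<lambda>r. \<sigma> (i r)) j"
  by (subst moment_translate[OF assms]) (simp add: monomial_matrix_mult prod.distrib moment_def)

lemma moment_perm:
  assumes "inj \<pi>"
  shows "moment M N (\<lambda>r. map_sum \<pi> \<pi> (i r)) j = moment M N i j"
proof -
  have "inj (map_sum \<pi> \<pi>)" using assms by (rule sum.inj_map) (rule assms)
  moreover have "map_sum \<pi> \<pi> (conj_index p) = conj_index (map_sum \<pi> \<pi> p)"
    "index_sign (map_sum \<pi> \<pi> p) = index_sign p" for p :: "'d + 'd"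
    by (cases p; simp)+
  ultimately have "monomial_matrix (\<lambda>_. 1) (map_sum \<pi> \<pi>) \<in> (Sp_group :: 'd sp_matrix set)"
    by (intro monomial_matrix_Sp) auto
  from moment_monomial[OF this] show ?thesis by simp
qed

text \<open>The group element used acts on the plane of \<open>Inl a\<close> and
  \<open>Inr a\<close> as the SU(2) matrix with rows (0, 1) and (-1, 0), whence the sign on
  \<open>Inr a\<close>.\<close>

lemma moment_flip:
  "moment M N i j = (\<Prod>r = 1..N. if i r = Inr a then - 1 else 1) *
     moment M N (\<lambda>r. if i r = Inl a \<or> i r = Inr a then conj_index (i r) else i r) j"
proof -
  define \<sigma> where "\<sigma> = (\<lambda>p. if p = Inl a \<or> p = Inr a then conj_index p else p)"
  define \<phi> :: "'d + 'd \<Rightarrow> complex" where "\<phi> = (\<lambda>p. if p = Inr a then - 1 else 1)"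
  have "inj \<sigma>" unfolding \<sigma>_def by (rule injI) (auto split: if_splits)
  moreover have "\<sigma> (conj_index p) = conj_index (\<sigma> p)" for p by (cases p) (auto simp: \<sigma>_def)
  moreover have "\<phi> p * index_sign (\<sigma> p) = index_sign p * cnj (\<phi> (conj_index p))" for p
    by (cases p) (auto simp: \<sigma>_def \<phi>_def)
  ultimately have "monomial_matrix \<phi> \<sigma> \<in> (Sp_group :: 'd sp_matrix set)"
    by (intro monomial_matrix_Sp) (auto simp: \<phi>_def)
  from moment_monomial[OF this, of N i j] show ?thesis unfolding \<sigma>_def \<phi>_def .
qed

text \<open>The diagonal element with entries \<i> and -\<i> at \<open>a\<close> multiplies the
  moment by this product. It sees only the difference between the occurrences of
  \<open>Inl a\<close> and \<open>Inr a\<close> modulo 4; in \<open>moment_exchange\<close> that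
  difference lies between -2 and 2.\<close>

lemma moment_unbalanced:
  assumes "(\<Prod>r = 1..N. if i r = Inl a then \<i> else if i r = Inr a then - \<i> else 1) \<noteq> 1"
  shows "moment M N i j = 0"
proof -
  define \<phi> :: "'d + 'd \<Rightarrow> complex" where "\<phi> = (\<lambda>p. if p = Inl a then \<i> else if p = Inr a then - \<i> else 1)"
  have "\<phi> p * index_sign p = index_sign p * cnj (\<phi> (conj_index p))" for p
    by (cases p) (auto simp: \<phi>_def)
  then have "monomial_matrix \<phi> id \<in> (Sp_group :: 'd sp_matrix set)"
    by (intro monomial_matrix_Sp) (auto simp: \<phi>_def)
  from moment_monomial[OF this, of N i j]
  have "(1 - (\<Prod>r = 1..N. \<phi> (i r))) * moment M N i j = 0" by (simp add: algebra_simps)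
  moreover have "(\<Prod>r = 1..N. \<phi> (i r)) \<noteq> 1" using assms unfolding \<phi>_def .
  ultimately show ?thesis by simp
qed

text \<open>Reordering the factors moves a transposition from the rows to the columns, where it acts
  on the pairing.\<close>

lemma moment_comp_transpose:
  assumes "p \<in> {1..N}" "q \<in> {1..N}"
  shows "moment M N (\<lambda>r. i (Transposition.transpose p q r)) j = moment M N i (\<lambda>r. j (Transposition.transpose p q r))"
proof -
  let ?t = "Transposition.transpose p q"
  have b: "bij_betw ?t {1..N} {1..N}" by (rule bij_betw_transpose_iff) (use assms in simp)
  have "(\<Prod>r = 1..N. g $ i (?t r) $ j r) = (\<Prod>r = 1..N. g $ i r $ j (?t r))" for g :: "'d sp_matrix"
    using prod.reindex_bij_betw[OF b, of "\<lambda>r. g $ i r $ j (?t r)"] by simp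
  then show ?thesis by (simp add: moment_def)
qed

lemma prod_four:
  fixes f :: "'e \<Rightarrow> nat \<Rightarrow> complex"
  assumes "{r, s, t, u} \<subseteq> {1..N}" "distinct [r, s, t, u]"
  shows "(\<Prod>q = 1..N. f ((i(r := x, s := y, t := z, u := w)) q) q) =
    (\<Prod>q\<in>{1..N} - {r, s, t, u}. f (i q) q) * (f x r * f y s * f z t * f w u)"
proof -
  let ?i = "i(r := x, s := y, t := z, u := w)"
  have "(\<Prod>q = 1..N. f (?i q) q) = (\<Prod>q\<in>{1..N} - {r, s, t, u}. f (?i q) q) * (\<Prod>q\<in>{r, s, t, u}. f (?i q) q)"
    using assms(1) by (intro prod.subset_diff) auto
  moreover have "(\<Prod>q\<in>{1..N} - {r, s, t, u}. f (?i q) q) = (\<Prod>q\<in>{1..N} - {r, s, t, u}. f (i q) q)"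
    by (intro prod.cong) auto
  moreover have "(\<Prod>q\<in>{r, s, t, u}. f (?i q) q) = f x r * f y s * f z t * f w u"
    using assms(2) by (simp add: mult.assoc)
  ultimately show ?thesis by simp
qed

text \<open>Invariance under the rotation by the angle \<open>arccos (3 / 5)\<close> in the plane of \<open>a\<close> and \<open>b\<close>: of the
  sixteen terms only the balanced ones survive, and \<open>x = (c\<^sup>4 + s\<^sup>4) x + 2 c\<^sup>2 s\<^sup>2 (y + z)\<close> means
  \<open>x = y + z\<close> since \<open>c\<^sup>2 + s\<^sup>2 = 1\<close>.\<close>

lemma moment_exchange:
  assumes pos: "{r, s, t, u} \<subseteq> {1..N}" "distinct [r, s, t, u]" and ab: "a \<noteq> b"
    and i: "\<And>q. q \<in> {1..N} - {r, s, t, u} \<Longrightarrow> i q \<notin> {Inl a, Inr a, Inl b, Inr b}"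
  shows "moment M N (i(r := Inl a, s := Inl a, t := Inr a, u := Inr a)) j =
    moment M N (i(r := Inl a, s := Inl b, t := Inr a, u := Inr b)) j +
    moment M N (i(r := Inl a, s := Inl b, t := Inr b, u := Inr a)) j"
proof -
  define P where "P g = (\<Prod>q\<in>{1..N} - {r, s, t, u}. g $ i q $ j q)" for g :: "'d sp_matrix"
  define E where "E x y z w = moment M N (i(r := x, s := y, t := z, u := w)) j" for x y z w
  note pf = prod_four[OF pos, of "\<lambda>p q. g $ p $ j q" for g :: "'d sp_matrix"]
  have E: "E x y z w = integral\<^sup>L M (\<lambda>g. P g * (g $ x $ j r * g $ y $ j s * g $ z $ j t * g $ w $ j u))" for x y z w
    unfolding E_def moment_def P_def pf ..
  have I: "integrable M (\<lambda>g. P g * (g $ x $ j r * g $ y $ j s * g $ z $ j t * g $ w $ j u))" for x y z w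
    using integrable_prod_entries[of "i(r := x, s := y, t := z, u := w)" j "{1..N}"]
    unfolding P_def pf .
  have swap: "E (map_sum (Transposition.transpose a b) (Transposition.transpose a b) x)
      (map_sum (Transposition.transpose a b) (Transposition.transpose a b) y)
      (map_sum (Transposition.transpose a b) (Transposition.transpose a b) z)
      (map_sum (Transposition.transpose a b) (Transposition.transpose a b) w) = E x y z w" (is "E (?\<sigma> x) _ _ _ = _") for x y z w
  proof -
    have "?\<sigma> (i q) = i q" if "q \<in> {1..N} - {r, s, t, u}" for q
      using i[OF that] by (cases "i q") (auto simp: Transposition.transpose_def)
    then have "E (?\<sigma> x) (?\<sigma> y) (?\<sigma> z) (?\<sigma> w) = moment M N (\<lambda>q. ?\<sigma> ((i(r := x, s := y, t := z, u := w)) q)) j"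
      unfolding E_def by (intro moment_cong) auto
    also have "\<dots> = E x y z w" unfolding E_def by (rule moment_perm) simp
    finally show ?thesis .
  qed
  have bal: "E x y z w = 0"
    if "(if x = Inl a then \<i> else if x = Inr a then - \<i> else 1) * (if y = Inl a then \<i> else if y = Inr a then - \<i> else 1) *
        (if z = Inl a then \<i> else if z = Inr a then - \<i> else 1) * (if w = Inl a then \<i> else if w = Inr a then - \<i> else 1) \<noteq> 1" for x y z w
    unfolding E_def
  proof (rule moment_unbalanced[where a = a])
    have "(\<Prod>q\<in>{1..N} - {r, s, t, u}. if i q = Inl a then \<i> else if i q = Inr a then - \<i> else 1) = 1"
      using i by (intro prod.neutral) auto
    then show "(\<Prod>q = 1..N. if (i(r := x, s := y, t := z, u := w)) q = Inl a then \<i>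
        else if (i(r := x, s := y, t := z, u := w)) q = Inr a then - \<i> else 1) \<noteq> 1"
      using that prod_four[OF pos, of "\<lambda>p _. if p = Inl a then \<i> else if p = Inr a then - \<i> else 1" i x y z w] by simp
  qed
  have bal4: "E (Inl a) (Inl b) (Inr a) (Inr a) = 0" "E (Inl b) (Inl a) (Inr a) (Inr a) = 0"
    "E (Inl b) (Inl b) (Inr a) (Inr b) = 0" "E (Inl b) (Inl b) (Inr b) (Inr a) = 0"
    by (rule bal; use ab in \<open>simp add: complex_eq_iff\<close>)+
  have PR: "P (rotation_matrix a b ** g) = P g" for g
    unfolding P_def using i by (intro prod.cong) (auto simp: rotation_matrix_mult)
  have "E (Inl a) (Inl a) (Inr a) (Inr a) = integral\<^sup>L M (\<lambda>g. P g *
     ((3 / 5 * g $ Inl a $ j r + 4 / 5 * g $ Inl b $ j r) * (3 / 5 * g $ Inl a $ j s + 4 / 5 * g $ Inl b $ j s) *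
      (3 / 5 * g $ Inr a $ j t + 4 / 5 * g $ Inr b $ j t) * (3 / 5 * g $ Inr a $ j u + 4 / 5 * g $ Inr b $ j u)))"
    unfolding E_def moment_translate[OF rotation_matrix_Sp[OF ab]]
      prod_four[OF pos, of "\<lambda>p q. (rotation_matrix a b ** g) $ p $ j q" for g] P_def[symmetric] PR
    by (simp add: rotation_matrix_mult)
  also have "\<dots> = integral\<^sup>L M (\<lambda>g. \<Sum>x\<in>{a, b}. \<Sum>y\<in>{a, b}. \<Sum>z\<in>{a, b}. \<Sum>w\<in>{a, b}.
     (if x = a then 3 / 5 else 4 / 5) * (if y = a then 3 / 5 else 4 / 5) * (if z = a then 3 / 5 else 4 / 5) * (if w = a then 3 / 5 else 4 / 5) *
     (P g * (g $ Inl x $ j r * g $ Inl y $ j s * g $ Inr z $ j t * g $ Inr w $ j u)))"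
    by (intro Bochner_Integration.integral_cong refl)
      (rule four_factor_expansion[OF ab, where ?f1.0 = "\<lambda>x. _ $ Inl x $ j r" and ?f2.0 = "\<lambda>x. _ $ Inl x $ j s"
        and ?f3.0 = "\<lambda>x. _ $ Inr x $ j t" and ?f4.0 = "\<lambda>x. _ $ Inr x $ j u"])
  also have "\<dots> = (\<Sum>x\<in>{a, b}. \<Sum>y\<in>{a, b}. \<Sum>z\<in>{a, b}. \<Sum>w\<in>{a, b}.
     (if x = a then 3 / 5 else 4 / 5) * (if y = a then 3 / 5 else 4 / 5) * (if z = a then 3 / 5 else 4 / 5) * (if w = a then 3 / 5 else 4 / 5) *
     E (Inl x) (Inl y) (Inr z) (Inr w))"
    unfolding E using I by (simp add: Bochner_Integration.integral_sum Bochner_Integration.integrable_sum)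
  \<comment> \<open>Six of the terms are balanced, in three pairs exchanged by \<open>swap\<close>;
    337 = 3^4 + 4^4 and 288 = 2 * 3^2 * 4^2.\<close>
  also have "\<dots> = 337 / 625 * E (Inl a) (Inl a) (Inr a) (Inr a) +
     288 / 625 * (E (Inl a) (Inl b) (Inr a) (Inr b) + E (Inl a) (Inl b) (Inr b) (Inr a))"
    using ab bal bal4 swap[of "Inl a" "Inl a" "Inr a" "Inr a"] swap[of "Inl a" "Inl b" "Inr a" "Inr b"] swap[of "Inl a" "Inl b" "Inr b" "Inr a"]
    by simp
  finally have "288 * E (Inl a) (Inl a) (Inr a) (Inr a) = 288 * (E (Inl a) (Inl b) (Inr a) (Inr b) + E (Inl a) (Inl b) (Inr b) (Inr a))"
    by (simp add: field_simps)
  then have "E (Inl a) (Inl a) (Inr a) (Inr a) = E (Inl a) (Inl b) (Inr a) (Inr b) + E (Inl a) (Inl b) (Inr b) (Inr a)"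
    by (simp only: mult_cancel_left) simp
  then show ?thesis by (simp add: E_def)
qed

lemma moment_symplectic:
  "(\<Sum>p\<in>UNIV. index_sign p * moment M (Suc (Suc N)) (i(Suc N := p, Suc (Suc N) := conj_index p)) j)
     = sp_J $ j (Suc N) $ j (Suc (Suc N)) * moment M N i j"
proof -
  let ?Q = "\<lambda>g :: 'd sp_matrix. \<Prod>r = 1..N. g $ i r $ j r"
  let ?i = "\<lambda>p. i(Suc N := p, Suc (Suc N) := conj_index p)"
  have e: "(\<Prod>r = 1..Suc (Suc N). g $ ?i p r $ j r) = ?Q g * (g $ p $ j (Suc N) * g $ conj_index p $ j (Suc (Suc N)))"
    for g :: "'d sp_matrix" and p
  proof -
    have "(\<Prod>r = 1..N. g $ ?i p r $ j r) = ?Q g" by (rule prod.cong) auto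
    then show ?thesis by (simp add: mult.assoc)
  qed
  have I: "integrable M (\<lambda>g. ?Q g * (g $ p $ j (Suc N) * g $ conj_index p $ j (Suc (Suc N))))" for p
    using integrable_prod_entries[of "?i p" j "{1..Suc (Suc N)}"] unfolding e .
  have "(\<Sum>p\<in>UNIV. index_sign p * moment M (Suc (Suc N)) (?i p) j) =
    integral\<^sup>L M (\<lambda>g. \<Sum>p\<in>UNIV. index_sign p * (?Q g * (g $ p $ j (Suc N) * g $ conj_index p $ j (Suc (Suc N)))))"
    unfolding moment_def e using I by (simp add: Bochner_Integration.integral_sum)
  also have "\<dots> = integral\<^sup>L M (\<lambda>g. sp_J $ j (Suc N) $ j (Suc (Suc N)) * ?Q g)"
  proof (rule Bochner_Integration.integral_cong)
    fix g assume "g \<in> space M"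
    then have "g \<in> Sp_group" by (simp add: space_haar)
    have "(\<Sum>p\<in>UNIV. index_sign p * (?Q g * (g $ p $ j (Suc N) * g $ conj_index p $ j (Suc (Suc N))))) =
      (\<Sum>p\<in>UNIV. index_sign p * g $ p $ j (Suc N) * g $ conj_index p $ j (Suc (Suc N))) * ?Q g"
      unfolding sum_distrib_right by (rule sum.cong) (simp_all add: mult_ac)
    then show "(\<Sum>p\<in>UNIV. index_sign p * (?Q g * (g $ p $ j (Suc N) * g $ conj_index p $ j (Suc (Suc N))))) =
      sp_J $ j (Suc N) $ j (Suc (Suc N)) * ?Q g"
      unfolding Sp_group_symplectic[OF \<open>g \<in> Sp_group\<close>] .
  qed simp
  finally show ?thesis by (simp add: moment_def)
qed

text \<open>The map from values of \<open>f\<close> to values of \<open>f'\<close> extends to a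
  permutation of all coordinates, as the complements of the two images have equal size.\<close>

lemma moment_std_index_eq:
  assumes "inj_on f {1..k}" "inj_on f' {1..k}"
  shows "moment M (2 * k) (std_index f) j = moment M (2 * k) (std_index f') j"
proof -
  obtain h where "bij_betw h (f ` {1..k}) (f' ` {1..k})" "\<forall>a\<in>{1..k}. h (f a) = f' a"
  proof
    show "bij_betw (\<lambda>x. f' (the_inv_into {1..k} f x)) (f ` {1..k}) (f' ` {1..k})"
      using bij_betw_trans[OF bij_betw_the_inv_into[OF inj_on_imp_bij_betw[OF assms(1)]] inj_on_imp_bij_betw[OF assms(2)]]
      by (simp add: o_def)
    show "\<forall>a\<in>{1..k}. f' (the_inv_into {1..k} f (f a)) = f' a"
      using assms(1) by (simp add: the_inv_into_f_f)
  qed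
  moreover obtain h' where "bij_betw h' (- (f ` {1..k})) (- (f' ` {1..k}))"
    using finite_same_card_bij[of "- (f ` {1..k})" "- (f' ` {1..k})"] assms
    by (auto simp: Compl_eq_Diff_UNIV card_Diff_subset card_image)
  ultimately obtain \<pi> where \<pi>: "bij \<pi>" "\<forall>a\<in>{1..k}. \<pi> (f a) = f' a"
  proof -
    fix h h' assume h: "bij_betw h (f ` {1..k}) (f' ` {1..k})" "\<forall>a\<in>{1..k}. h (f a) = f' a"
      and h': "bij_betw h' (- (f ` {1..k})) (- (f' ` {1..k}))"
    let ?p = "\<lambda>x. if x \<in> f ` {1..k} then h x else h' x"
    assume *: "\<And>\<pi>. bij \<pi> \<Longrightarrow> \<forall>a\<in>{1..k}. \<pi> (f a) = f' a \<Longrightarrow> thesis"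
    have "bij_betw ?p (f ` {1..k} \<union> - (f ` {1..k})) (f' ` {1..k} \<union> - (f' ` {1..k}))"
      by (rule bij_betw_disjoint_Un) (use h h' in auto)
    then show thesis using * h(2) by (simp add: Compl_partition)
  qed
  have "moment M (2 * k) (std_index f) j = moment M (2 * k) (\<lambda>r. map_sum \<pi> \<pi> (std_index f r)) j"
    using moment_perm[OF bij_is_inj[OF \<pi>(1)]] by simp
  also have "\<dots> = moment M (2 * k) (std_index f') j"
  proof (rule moment_cong)
    fix r assume r: "r \<in> {1..2 * k}"
    have "Suc r div 2 \<in> {1..k}" using r by (auto simp: Suc_le_eq)
    moreover have "r div 2 \<in> {1..k}" if "even r" using r that by (auto elim!: evenE)
    ultimately show "map_sum \<pi> \<pi> (std_index f r) = std_index f' r" using \<pi>(2) by (auto simp: std_index_def)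
  qed simp
  finally show ?thesis .
qed

text \<open>Exactly one row carries \<open>Inr a\<close>, so \<open>moment_flip\<close> produces a
  single sign.\<close>

lemma moment_flip_pair:
  assumes "p \<in> {1..N}" "q \<in> {1..N}" "p \<noteq> q"
    and i: "\<And>r. r \<in> {1..N} - {p, q} \<Longrightarrow> i r \<notin> {Inl a, Inr a}"
  shows "moment M N (i(p := Inr a, q := Inl a)) j = - moment M N (i(p := Inl a, q := Inr a)) j"
proof -
  let ?i = "i(p := Inr a, q := Inl a)"
  have "(\<Prod>r = 1..N. if ?i r = Inr a then - 1 else (1 :: complex)) = (\<Prod>r = 1..N. if r = p then - 1 else 1)"
    by (rule prod.cong) (use assms in auto)
  also have "\<dots> = - 1" using assms(1) by (subst prod.delta) auto
  finally have "moment M N ?i j = - moment M N (\<lambda>r. if ?i r = Inl a \<or> ?i r = Inr a then conj_index (?i r) else ?i r) j"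
    using moment_flip[of N ?i j a] by simp
  also have "moment M N (\<lambda>r. if ?i r = Inl a \<or> ?i r = Inr a then conj_index (?i r) else ?i r) j = moment M N (i(p := Inl a, q := Inr a)) j"
    by (rule moment_cong) (use assms in auto)
  finally show ?thesis .
qed

text \<open>In \<open>moment_symplectic\<close> every coordinate contributes \<open>2 * W j\<close>.
  A coordinate already used by the rows \<open>2 * a + 1\<close> and \<open>2 * a + 2\<close>
  contributes in addition the two transpositions of these positions with
  \<open>2 * k + 1\<close>.\<close>

lemma moment_recursion:
  assumes f: "inj_on f {1..Suc k}"
  defines "W \<equiv> \<lambda>j. moment M (2 * Suc k) (std_index f) j"
  shows "2 * of_nat CARD('d) * W j + (\<Sum>q = 1..2 * k. W (\<lambda>r. j (Transposition.transpose q (2 * k + 1) r)))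
     = sp_J $ j (2 * k + 1) $ j (2 * k + 2) * moment M (2 * k) (std_index f) j"
proof -
  let ?N = "Suc (Suc (2 * k))" and ?s = "Suc (2 * k)"
  define T where "T p = moment M ?N ((std_index f)(?s := p, ?N := conj_index p)) j" for p
  define Wt where "Wt q = W (\<lambda>r. j (Transposition.transpose q ?s r))" for q
  have W: "moment M ?N (std_index f') j' = W j'" if "inj_on f' {1..Suc k}" for f' j'
    using moment_std_index_eq[OF that f] by (simp add: W_def)
  have out: "T (Inl b) = W j \<and> T (Inr b) = - W j" if b: "b \<notin> f ` {1..k}" for b
  proof -
    have "{1..Suc k} = insert (Suc k) {1..k}" by auto
    moreover have "inj_on (f(Suc k := b)) {1..k} \<longleftrightarrow> inj_on f {1..k}"
      by (rule inj_on_cong) auto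
    moreover have "(f(Suc k := b)) ` ({1..k} - {Suc k}) = f ` {1..k}"
      by (rule image_cong) auto
    ultimately have "inj_on (f(Suc k := b)) {1..Suc k}"
      using b inj_on_subset[OF f, of "{1..k}"] by (simp only: inj_on_insert) auto
    then have 1: "T (Inl b) = W j" using W by (simp add: T_def std_index_upd[symmetric])
    have "T (Inr b) = - T (Inl b)"
      unfolding T_def conj_index.simps
    proof (rule moment_flip_pair)
      fix r assume "r \<in> {1..?N} - {?s, ?N}"
      then have "r \<in> {1..2 * k}" by auto
      from std_index_range[OF this, of f] show "std_index f r \<notin> {Inl b, Inr b}" using b by auto
    qed auto
    with 1 show ?thesis by simp
  qed
  have ins: "T (Inl (f (Suc a))) = W j + Wt (Suc (2 * a)) \<and> T (Inr (f (Suc a))) = - W j - Wt (Suc (Suc (2 * a)))"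
    if a: "a < k" for a
  proof -
    define b c where "b = f (Suc a)" and "c = f (Suc k)"
    let ?r = "Suc (2 * a)" and ?t = "Suc (Suc (2 * a))"
    have bc: "b \<noteq> c" using inj_onD[OF f, of "Suc a" "Suc k"] a by (auto simp: b_def c_def)
    have pos: "{?r, ?s, ?t, ?N} \<subseteq> {1..?N}" "distinct [?r, ?s, ?t, ?N]" using a by auto
    then have pos': "{?r, ?N, ?t, ?s} \<subseteq> {1..?N}" "distinct [?r, ?N, ?t, ?s]" by auto
    have avoid: "std_index f q \<notin> {Inl b, Inr b, Inl c, Inr c}" if "q \<in> {1..?N} - {?r, ?s, ?t, ?N}" for q
    proof -
      have "q \<in> {1..2 * k}" using that by auto
      from std_index_range[OF this, of f] obtain a' where a': "a' \<in> {1..k}"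
        "std_index f q \<in> {Inl (f a'), Inr (f a')}" "q = 2 * a' - 1 \<or> q = 2 * a'" by blast
      then have "a' \<noteq> Suc a" using that by auto
      then have "f a' \<noteq> b" "f a' \<noteq> c" using inj_onD[OF f] a'(1) a by (auto simp: b_def c_def) fastforce+
      then show ?thesis using a'(2) by auto
    qed
    define f' where "f' = f(Suc a := c, Suc k := b)"
    have f': "inj_on f' {1..Suc k}"
    proof -
      have "f' = f \<circ> Transposition.transpose (Suc a) (Suc k)"
        using a by (auto simp: f'_def b_def c_def Transposition.transpose_def)
      moreover have "Transposition.transpose (Suc a) (Suc k) ` {1..Suc k} = {1..Suc k}" using a by simp
      ultimately show ?thesis using f by (simp add: comp_inj_on)
    qed
    have sf': "std_index f' = (std_index f)(?r := Inl c, ?t := Inr c, ?s := Inl b, ?N := Inr b)"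
      unfolding f'_def std_index_upd ..
    \<comment> \<open>All four rows carry \<open>b\<close>, and \<open>c\<close> is free because the
      last two rows were overwritten. Of the two terms of the exchange one is
      \<open>std_index f\<close>, the other is \<open>std_index f'\<close> with positions
      \<open>?r\<close> and \<open>?s\<close> interchanged.\<close>
    have "T (Inl b) = moment M ?N ((std_index f)(?r := Inl b, ?s := Inl b, ?t := Inr b, ?N := Inr b)) j"
      unfolding T_def by (rule moment_cong) (use pos in \<open>auto simp: b_def\<close>)
    also have "\<dots> = moment M ?N ((std_index f)(?r := Inl b, ?s := Inl c, ?t := Inr b, ?N := Inr c)) j +
        moment M ?N ((std_index f)(?r := Inl b, ?s := Inl c, ?t := Inr c, ?N := Inr b)) j"
      by (rule moment_exchange[OF pos bc avoid])
    also have "moment M ?N ((std_index f)(?r := Inl b, ?s := Inl c, ?t := Inr b, ?N := Inr c)) j = W j"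
      unfolding W[OF f, symmetric] by (rule moment_cong) (use pos in \<open>auto simp: b_def c_def\<close>)
    also have "moment M ?N ((std_index f)(?r := Inl b, ?s := Inl c, ?t := Inr c, ?N := Inr b)) j =
        moment M ?N (\<lambda>q. std_index f' (Transposition.transpose ?r ?s q)) j"
      unfolding sf' by (rule moment_cong) (use pos in \<open>auto simp: Transposition.transpose_def\<close>)
    also have "\<dots> = Wt ?r"
      using pos W[OF f'] by (subst moment_comp_transpose) (auto simp: Wt_def)
    finally have L: "T (Inl b) = W j + Wt ?r" .
    have flip: "moment M ?N ((std_index f)(?s := Inr c, ?N := Inl c)) j' = - W j'" for j'
    proof -
      have "moment M ?N ((std_index f)(?s := Inr c, ?N := Inl c)) j' = - moment M ?N ((std_index f)(?s := Inl c, ?N := Inr c)) j'"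
      proof (rule moment_flip_pair)
        fix q assume "q \<in> {1..?N} - {?s, ?N}"
        then have "q \<in> {1..2 * k}" by auto
        from std_index_range[OF this, of f] obtain a' where a': "a' \<in> {1..k}"
          "std_index f q \<in> {Inl (f a'), Inr (f a')}" by blast
        then have "f a' \<noteq> c" using inj_onD[OF f, of a' "Suc k"] by (auto simp: c_def)
        then show "std_index f q \<notin> {Inl c, Inr c}" using a'(2) by auto
      qed auto
      also have "(std_index f)(?s := Inl c, ?N := Inr c) = std_index f"
        unfolding std_index_upd[symmetric] by (simp add: c_def)
      finally show ?thesis by (simp only: W[OF f])
    qed
    \<comment> \<open>Now position \<open>?s\<close> carries an \<open>Inr\<close>, so it pairs up
      with \<open>?t\<close> instead of \<open>?r\<close>; \<open>flip\<close> restores the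
      orientation of the last block at the cost of a sign.\<close>
    have "T (Inr b) = moment M ?N ((std_index f)(?r := Inl b, ?N := Inl b, ?t := Inr b, ?s := Inr b)) j"
      unfolding T_def by (rule moment_cong) (use pos in \<open>auto simp: b_def\<close>)
    also have "\<dots> = moment M ?N ((std_index f)(?r := Inl b, ?N := Inl c, ?t := Inr b, ?s := Inr c)) j +
        moment M ?N ((std_index f)(?r := Inl b, ?N := Inl c, ?t := Inr c, ?s := Inr b)) j"
      by (rule moment_exchange[OF pos' bc]) (use avoid in auto)
    also have "moment M ?N ((std_index f)(?r := Inl b, ?N := Inl c, ?t := Inr b, ?s := Inr c)) j = moment M ?N ((std_index f)(?s := Inr c, ?N := Inl c)) j"
      by (rule moment_cong) (use pos in \<open>auto simp: b_def\<close>)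
    also note flip
    also have "moment M ?N ((std_index f)(?r := Inl b, ?N := Inl c, ?t := Inr c, ?s := Inr b)) j =
        moment M ?N (\<lambda>q. ((std_index f)(?s := Inr c, ?N := Inl c)) (Transposition.transpose ?t ?s q)) j"
      by (rule moment_cong) (use pos in \<open>auto simp: Transposition.transpose_def b_def\<close>)
    also have "\<dots> = - Wt ?t"
      using pos flip by (subst moment_comp_transpose) (auto simp: Wt_def)
    finally have R: "T (Inr b) = - W j - Wt ?t" by simp
    show ?thesis using L R by (simp add: b_def)
  qed
  have "(\<Sum>p\<in>UNIV. index_sign p * T p) = (\<Sum>b\<in>UNIV. T (Inl b) - T (Inr b))"
    by (simp add: sum_UNIV_sum)
  also have "\<dots> = (\<Sum>b\<in>(UNIV :: 'd set). 2 * W j) + (\<Sum>b\<in>UNIV. T (Inl b) - T (Inr b) - 2 * W j)"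
    by (simp add: sum_subtractf)
  \<comment> \<open>Once \<open>2 * W j\<close> is subtracted, only the coordinates in use
    remain.\<close>
  also have "(\<Sum>b\<in>UNIV. T (Inl b) - T (Inr b) - 2 * W j) = (\<Sum>b\<in>f ` {1..k}. T (Inl b) - T (Inr b) - 2 * W j)"
    using out by (intro sum.mono_neutral_right) auto
  also have "\<dots> = (\<Sum>a\<in>{1..k}. T (Inl (f a)) - T (Inr (f a)) - 2 * W j)"
    using inj_on_subset[OF f, of "{1..k}"] by (subst sum.reindex) auto
  also have "\<dots> = (\<Sum>a<k. T (Inl (f (Suc a))) - T (Inr (f (Suc a))) - 2 * W j)"
    by (simp add: sum.atLeast1_atMost_eq)
  also have "\<dots> = (\<Sum>a<k. Wt (Suc (2 * a)) + Wt (Suc (Suc (2 * a))))"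
    using ins by (intro sum.cong) auto
  also have "\<dots> = (\<Sum>q = 1..2 * k. Wt q)" by (rule sum_pairs[symmetric])
  finally show ?thesis
    using moment_symplectic[of "2 * k" "std_index f" j] by (simp add: T_def Wt_def mult_ac)
qed

end

section \<open>The generating series of paths\<close>

definition path_series :: "nat \<Rightarrow> real \<Rightarrow> nat set set \<Rightarrow> real" where
  "path_series k D m = (\<Sum>l. real (npaths k l m) / D ^ (l + k))"

context
  fixes K :: nat and C D :: real
  assumes C: "12 * (real K)\<^sup>2 \<le> C" and CD: "C < D"
begin

lemma C_nonneg: "0 \<le> C"
  using C by (meson order_trans zero_le_mult_iff zero_le_numeral zero_le_power2)

lemma D_pos: "0 < D"
  using C_nonneg CD by simp

lemma path_series_term_le:
  assumes "k \<le> K" "m \<in> pair_partitions (2 * k)"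
  shows "real (npaths k (l + pairing_norm k m) m) / D ^ l \<le> catalan_weight k m * (C / D) ^ l"
proof -
  have "real (npaths k (l + pairing_norm k m) m) / D ^ l \<le> (C ^ l * catalan_weight k m) / D ^ l"
    using npaths_excess_le[OF C assms, of l] D_pos by (intro divide_right_mono) (simp_all add: add.commute)
  then show ?thesis by (simp add: power_divide mult.commute)
qed

lemma summable_shifted_series:
  assumes "k \<le> K" "m \<in> pair_partitions (2 * k)"
  shows "summable (\<lambda>l. real (npaths k (l + pairing_norm k m) m) / D ^ l)"
proof (rule summable_comparison_test')
  show "summable (\<lambda>l. catalan_weight k m * (C / D) ^ l)"
    using CD C_nonneg D_pos by (intro summable_mult summable_geometric) simp
  show "norm (real (npaths k (l + pairing_norm k m) m) / D ^ l) \<le> catalan_weight k m * (C / D) ^ l" for l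
    using path_series_term_le[OF assms, of l] D_pos by simp
qed

lemma summable_path_series:
  assumes "k \<le> K" "m \<in> pair_partitions (2 * k)"
  shows "summable (\<lambda>l. real (npaths k l m) / D ^ (l + k))"
proof -
  let ?n = "pairing_norm k m"
  have "summable (\<lambda>l. real (npaths k (l + ?n) m) / D ^ l / D ^ (?n + k))"
    by (rule summable_divide[OF summable_shifted_series[OF assms]])
  then have "summable (\<lambda>l. real (npaths k (l + ?n) m) / D ^ (l + ?n + k))"
    by (simp add: power_add mult_ac)
  then show ?thesis by (subst summable_iff_shift[of _ ?n, symmetric])
qed

text \<open>The terms below the norm vanish, so this normalization makes the series start with the
  number of geodesics.\<close>

lemma path_series_shift:
  assumes "k \<le> K" "m \<in> pair_partitions (2 * k)"
  shows "D ^ (pairing_norm k m + k) * path_series k D m = (\<Sum>l. real (npaths k (l + pairing_norm k m) m) / D ^ l)"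
proof -
  let ?n = "pairing_norm k m"
  have "path_series k D m = (\<Sum>l. real (npaths k (l + ?n) m) / D ^ (l + ?n + k)) + (\<Sum>l<?n. real (npaths k l m) / D ^ (l + k))"
    unfolding path_series_def by (rule suminf_split_initial_segment[OF summable_path_series[OF assms]])
  also have "(\<Sum>l<?n. real (npaths k l m) / D ^ (l + k)) = 0"
    using npaths_below_norm[OF assms(2)] by simp
  also have "(\<Sum>l. real (npaths k (l + ?n) m) / D ^ (l + ?n + k)) = (\<Sum>l. (real (npaths k (l + ?n) m) / D ^ l) / D ^ (?n + k))"
    by (simp add: power_add mult_ac)
  also have "\<dots> = (\<Sum>l. real (npaths k (l + ?n) m) / D ^ l) / D ^ (?n + k)"
    by (rule suminf_divide[OF summable_shifted_series[OF assms]])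
  finally show ?thesis using D_pos by simp
qed

lemma path_series_nonneg: "0 \<le> path_series k D m" if "k \<le> K" "m \<in> pair_partitions (2 * k)"
  unfolding path_series_def using D_pos summable_path_series[OF that] by (intro suminf_nonneg) simp_all

lemma path_series_upper:
  assumes "k \<le> K" "m \<in> pair_partitions (2 * k)"
  shows "D ^ (pairing_norm k m + k) * path_series k D m \<le> real (npaths k (pairing_norm k m) m) / (1 - C / D)"
proof -
  have q: "norm (C / D) < 1" using CD C_nonneg D_pos by simp
  have "(\<Sum>l. real (npaths k (l + pairing_norm k m) m) / D ^ l) \<le> (\<Sum>l. catalan_weight k m * (C / D) ^ l)"
    using q by (intro suminf_le path_series_term_le summable_shifted_series summable_mult summable_geometric assms)
  also have "\<dots> = catalan_weight k m * (1 / (1 - C / D))"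
    using q by (subst suminf_mult) (simp_all add: suminf_geometric summable_geometric)
  finally show ?thesis
    unfolding path_series_shift[OF assms] npaths_geodesic[OF assms(2) refl] by simp
qed

text \<open>Every path can be prolonged by a solid step out of \<open>m\<close> and straight back, in \<open>2 (k - 1)\<close> ways.\<close>

lemma path_series_lower:
  assumes "k \<le> K" "m \<in> pair_partitions (2 * k)"
  defines "q \<equiv> 2 * (real k - 1) / D\<^sup>2"
  assumes q: "q < 1"
  shows "real (npaths k (pairing_norm k m) m) / (1 - q) \<le> D ^ (pairing_norm k m + k) * path_series k D m"
proof -
  define h where "h l = real (npaths k (l + pairing_norm k m) m) / D ^ l" for l
  have s: "summable h" unfolding h_def by (rule summable_shifted_series[OF assms(1,2)])
  have h0: "0 \<le> h l" for l using D_pos by (simp add: h_def)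
  \<comment> \<open>For \<open>k = 0\<close> the number \<open>q\<close> is negative and
    \<open>npaths_two_steps\<close> has no instance, hence the separate case.\<close>
  have step: "q * h l \<le> h (l + 2)" for l
  proof (cases k)
    case 0
    then have "q \<le> 0" by (simp add: q_def)
    then show ?thesis using h0[of l] h0[of "l + 2"] by (meson mult_nonpos_nonneg order_trans)
  next
    case (Suc k')
    have "real (2 * k' * npaths k (l + pairing_norm k m) m) \<le> real (npaths k (l + 2 + pairing_norm k m) m)"
      unfolding of_nat_le_iff using npaths_two_steps[of m k' "l + pairing_norm k m"] assms(2) Suc by simp
    then have "2 * (real k - 1) * real (npaths k (l + pairing_norm k m) m) / D ^ (l + 2) \<le> real (npaths k (l + 2 + pairing_norm k m) m) / D ^ (l + 2)"
      using D_pos Suc by (intro divide_right_mono) simp_all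
    then show ?thesis unfolding h_def q_def by (simp add: power_add power2_eq_square)
  qed
  have "q * suminf h = (\<Sum>l. q * h l)" by (rule suminf_mult[OF s, symmetric])
  also have "\<dots> \<le> (\<Sum>l. h (l + 2))"
    using step s by (intro suminf_le summable_mult summable_ignore_initial_segment)
  also have "\<dots> = suminf h - (h 0 + h 1)"
    using suminf_split_initial_segment[OF s, of 2] by (simp add: numeral_2_eq_2)
  \<comment> \<open>The term \<open>h 1\<close>, from paths of excess 1, is discarded.\<close>
  finally have "h 0 \<le> (1 - q) * suminf h" using h0[of 1] by (simp add: algebra_simps)
  then have "h 0 / (1 - q) \<le> suminf h" using q by (simp add: divide_le_eq mult.commute)
  then show ?thesis unfolding path_series_shift[OF assms(1,2)] by (simp add: h_def[abs_def])
qed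

text \<open>This is the recursion of \<open>npaths\<close> summed up. It has the shape of
  \<open>moment_recursion\<close>, except that there the transposed terms stand on the other
  side.\<close>

lemma path_series_recursion:
  assumes "Suc k \<le> K" "m \<in> pair_partitions (2 * Suc k)"
  shows "D * path_series (Suc k) D m =
    (\<Sum>i = 1..2 * k. path_series (Suc k) D (perm_act (Transposition.transpose i (2 * k + 1)) m)) +
    (if {2 * k + 1, 2 * k + 2} \<in> m then path_series k D (m - {{2 * k + 1, 2 * k + 2}}) else 0)"
proof -
  let ?n = "\<lambda>i. perm_act (Transposition.transpose i (2 * k + 1)) m" and ?b = "{2 * k + 1, 2 * k + 2}"
  define a where "a l = (\<Sum>i = 1..2 * k. real (npaths (Suc k) l (?n i)) / D ^ (l + Suc k))" for l
  define b where "b l = (if ?b \<in> m then real (npaths k l (m - {?b})) / D ^ (l + k) else 0)" for l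
  have "(\<lambda>l. real (npaths (Suc k) l (?n i)) / D ^ (l + Suc k)) sums path_series (Suc k) D (?n i)" if "i \<in> {1..2 * k}" for i
    unfolding path_series_def
    by (intro summable_sums summable_path_series assms(1) perm_act_apex[OF assms(2) that])
  then have A: "a sums (\<Sum>i = 1..2 * k. path_series (Suc k) D (?n i))"
    unfolding a_def[abs_def] by (rule sums_sum)
  have B: "b sums (if ?b \<in> m then path_series k D (m - {?b}) else 0)"
  proof (cases "?b \<in> m")
    case True
    then show ?thesis unfolding b_def[abs_def] path_series_def
      using assms pair_partitions_Suc[OF assms(2)] by (auto intro!: summable_sums summable_path_series)
  qed (simp add: b_def[abs_def])
  \<comment> \<open>A solid step takes one unit of \<open>l\<close> along with one power of
    \<open>D\<close>, so its series is shifted and has no term at 0.\<close>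
  have F: "(\<lambda>l. case l of 0 \<Rightarrow> 0 | Suc l \<Rightarrow> a l) sums (\<Sum>i = 1..2 * k. path_series (Suc k) D (?n i))"
    using sums_Suc[of "\<lambda>l. case l of 0 \<Rightarrow> 0 | Suc l \<Rightarrow> a l"] A by simp
  have e: "D * (real (npaths (Suc k) l m) / D ^ (l + Suc k)) = (case l of 0 \<Rightarrow> 0 | Suc l \<Rightarrow> a l) + b l" for l
  proof -
    have "D * (real (npaths (Suc k) l m) / D ^ (l + Suc k)) = real (npaths (Suc k) l m) / D ^ (l + k)"
      using D_pos by simp
    also have "\<dots> = (case l of 0 \<Rightarrow> 0 | Suc l \<Rightarrow> a l) + b l"
      by (cases l) (simp_all add: a_def b_def add_divide_distrib sum_divide_distrib)
    finally show ?thesis .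
  qed
  have "(\<lambda>l. D * (real (npaths (Suc k) l m) / D ^ (l + Suc k))) sums (D * path_series (Suc k) D m)"
    unfolding path_series_def by (intro sums_mult summable_sums summable_path_series assms)
  moreover have "(\<lambda>l. D * (real (npaths (Suc k) l m) / D ^ (l + Suc k))) sums
      ((\<Sum>i = 1..2 * k. path_series (Suc k) D (?n i)) + (if ?b \<in> m then path_series k D (m - {?b}) else 0))"
    unfolding e by (rule sums_add[OF F B])
  ultimately show ?thesis by (rule sums_unique2)
qed

end

lemma path_series_0: "path_series 0 D m = 1"
proof -
  have "(\<lambda>l. real (npaths 0 l m) / D ^ (l + 0)) sums 1"
    using sums_single[of 0 "\<lambda>_. 1 :: real"] by (auto elim!: sums_cong[THEN iffD1, rotated])
  then show ?thesis unfolding path_series_def by (rule sums_unique[symmetric])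
qed

section \<open>Signs of arrangements\<close>

definition index_rank :: "('d \<Rightarrow> nat) \<Rightarrow> 'd + 'd \<Rightarrow> nat" where
  "index_rank e p = (case p of Inl a \<Rightarrow> 2 * e a | Inr a \<Rightarrow> Suc (2 * e a))"

definition order_sign :: "('d \<Rightarrow> nat) \<Rightarrow> 'd + 'd \<Rightarrow> 'd + 'd \<Rightarrow> complex" where
  "order_sign e p q = (if index_rank e p < index_rank e q then 1 else - 1)"

text \<open>The Pfaffian sign of a pairing with oriented blocks, read off from indices that realize it.
  The two ends of a block are adjacent for \<open>index_rank\<close>, so no other index separates them.\<close>

definition arrangement_sign :: "('d \<Rightarrow> nat) \<Rightarrow> nat \<Rightarrow> (nat \<Rightarrow> 'd + 'd) \<Rightarrow> complex" where
  "arrangement_sign e N j = (\<Prod>s = 1..N. \<Prod>r\<in>{1..<s}. order_sign e (j r) (j s))"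

lemma norm_arrangement_sign [simp]: "cmod (arrangement_sign e N j) = 1"
  unfolding arrangement_sign_def by (simp add: prod_norm[symmetric] order_sign_def if_distrib[of cmod] cong: if_cong)

context
  fixes e :: "'d \<Rightarrow> nat"
  assumes e: "inj e"
begin

lemma index_rank_inj: "index_rank e p = index_rank e q \<longleftrightarrow> p = q"
  by (cases p; cases q) (auto simp: index_rank_def inj_eq[OF e] double_not_eq_Suc_double Suc_double_not_eq_double)

lemma order_sign_swap: "p \<noteq> q \<Longrightarrow> order_sign e q p = - order_sign e p q"
  using index_rank_inj[of p q] by (auto simp: order_sign_def)

text \<open>Pairs of positions are reindexed by transposing and sorting them again
  (\<open>\<theta>\<close>). Each pair whose order is reversed gives a factor -1, and there are 1 +
  2 (q - p - 1) of these.\<close>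

lemma arrangement_sign_transpose:
  assumes "inj_on j {1..N}" "1 \<le> p" "p < q" "q \<le> N"
  shows "arrangement_sign e N (\<lambda>r. j (Transposition.transpose p q r)) = - arrangement_sign e N j"
proof -
  let ?t = "Transposition.transpose p q"
  define I where "I = (SIGMA s:{1..N}. {1..<s})"
  define F where "F x = order_sign e (j (snd x)) (j (fst x))" for x
  define \<theta> where "\<theta> x = (max (?t (fst x)) (?t (snd x)), min (?t (fst x)) (?t (snd x)))" for x
  have S: "arrangement_sign e N j' = (\<Prod>x\<in>I. order_sign e (j' (snd x)) (j' (fst x)))" for j'
    unfolding arrangement_sign_def I_def by (subst prod.Sigma) (auto simp: case_prod_unfold)
  have t: "?t r \<in> {1..N} \<longleftrightarrow> r \<in> {1..N}" for r
    using assms by (auto simp: Transposition.transpose_def)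
  have ti: "?t r = ?t s \<longleftrightarrow> r = s" for r s by (rule inj_eq) simp
  have \<theta>: "\<theta> x \<in> I \<and> \<theta> (\<theta> x) = x" if xI: "x \<in> I" for x
  proof -
    obtain s r where x: "x = (s, r)" "r < s" "s \<in> {1..N}" "r \<in> {1..N}" using xI by (auto simp: I_def)
    have ne: "?t s \<noteq> ?t r" unfolding ti using x by simp
    have m: "?t s \<in> {1..N}" "?t r \<in> {1..N}" using t x by blast+
    show ?thesis
    proof (cases "?t r < ?t s")
      case True
      then have "\<theta> x = (?t s, ?t r)" by (simp add: \<theta>_def x)
      then show ?thesis using True m x by (auto simp: \<theta>_def I_def)
    next
      case False
      then have "\<theta> x = (?t r, ?t s)" by (simp add: \<theta>_def x)
      then show ?thesis using False ne m x by (auto simp: \<theta>_def I_def)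
    qed
  qed
  have "order_sign e (j (?t (snd x))) (j (?t (fst x))) = (if ?t (snd x) < ?t (fst x) then 1 else - 1) * F (\<theta> x)"
    if xI: "x \<in> I" for x
  proof -
    obtain s r where x: "x = (s, r)" "r < s" "s \<in> {1..N}" "r \<in> {1..N}" using xI by (auto simp: I_def)
    have "?t s \<noteq> ?t r" unfolding ti using x by simp
    moreover have "?t s \<in> {1..N}" "?t r \<in> {1..N}" unfolding t using x by simp_all
    moreover from calculation have "j (?t s) \<noteq> j (?t r)" using inj_onD[OF assms(1)] by blast
    ultimately show ?thesis
      using order_sign_swap[of "j (?t s)" "j (?t r)"] by (auto simp: F_def \<theta>_def x)
  qed
  then have "arrangement_sign e N (\<lambda>r. j (?t r)) = (\<Prod>x\<in>I. (if ?t (snd x) < ?t (fst x) then 1 else - 1) * F (\<theta> x))"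
    unfolding S by (intro prod.cong) auto
  also have "\<dots> = (\<Prod>x\<in>I. if ?t (snd x) < ?t (fst x) then 1 else - 1) * (\<Prod>x\<in>I. F (\<theta> x))"
    by (rule prod.distrib)
  also have "(\<Prod>x\<in>I. F (\<theta> x)) = (\<Prod>x\<in>I. F x)"
    by (rule prod.reindex_bij_witness[of _ \<theta> \<theta>]) (use \<theta> in auto)
  also have "\<dots> = arrangement_sign e N j" by (simp add: S F_def)
  also have "(\<Prod>x\<in>I. if ?t (snd x) < ?t (fst x) then 1 else - 1) = (- 1 :: complex)"
  proof -
    have fin: "finite I" by (auto simp: I_def)
    have inv: "r < s \<and> \<not> ?t r < ?t s \<longleftrightarrow> s = q \<and> r = p \<or> s = q \<and> p < r \<and> r < q \<or> r = p \<and> p < s \<and> s < q" for r s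
      using assms(3) unfolding Transposition.transpose_def by auto
    have "I \<inter> - {x. ?t (snd x) < ?t (fst x)} = {(q, p)} \<union> ({q} \<times> {p<..<q} \<union> {p<..<q} \<times> {p})"
      (is "?L = ?R")
    proof (rule set_eqI)
      fix x
      show "x \<in> ?L \<longleftrightarrow> x \<in> ?R"
      proof (cases x)
        case (Pair s r)
        have "x \<in> ?L \<longleftrightarrow> 1 \<le> r \<and> s \<le> N \<and> (r < s \<and> \<not> ?t r < ?t s)"
          unfolding I_def Pair by simp linarith
        also have "\<dots> \<longleftrightarrow> s = q \<and> r = p \<or> s = q \<and> p < r \<and> r < q \<or> r = p \<and> p < s \<and> s < q"
          unfolding inv using assms(2-4) by linarith
        also have "\<dots> \<longleftrightarrow> x \<in> ?R" unfolding Pair by auto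
        finally show ?thesis .
      qed
    qed
    moreover have "card ({(q, p)} \<union> ({q} \<times> {p<..<q} \<union> {p<..<q} \<times> {p})) = 1 + (card {p<..<q} + card {p<..<q})"
      by (subst card_Un_disjoint; (subst card_Un_disjoint)?) (auto simp: card_cartesian_product)
    ultimately have "card (I \<inter> - {x. ?t (snd x) < ?t (fst x)}) = 1 + 2 * card {p<..<q}" by simp
    then show ?thesis using fin by (simp add: prod.If_cases power_add power_mult)
  qed
  finally show ?thesis by simp
qed

text \<open>An earlier index compares in the same way with both members of the last pair, so its two
  factors cancel; what is left is the comparison within the pair.\<close>

lemma arrangement_sign_conj:
  assumes "inj_on j {1..Suc (Suc N)}" "j (Suc (Suc N)) = conj_index (j (Suc N))"
  shows "arrangement_sign e (Suc (Suc N)) j = index_sign (j (Suc N)) * arrangement_sign e N j"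
proof -
  let ?x = "j (Suc N)" and ?y = "j (Suc (Suc N))"
  have "order_sign e (j r) ?x * order_sign e (j r) ?y = 1" if "r \<in> {1..<Suc N}" for r
  proof -
    have "j r \<noteq> ?x" "j r \<noteq> ?y" using inj_onD[OF assms(1), of r] that by fastforce+
    then have "index_rank e (j r) \<noteq> index_rank e ?x" "index_rank e (j r) \<noteq> index_rank e ?y"
      by (simp_all add: index_rank_inj)
    moreover have "index_rank e ?y = Suc (index_rank e ?x) \<or> index_rank e ?x = Suc (index_rank e ?y)"
      unfolding assms(2) by (cases ?x) (simp_all add: index_rank_def)
    ultimately show ?thesis by (auto simp: order_sign_def)
  qed
  then have "(\<Prod>r\<in>{1..<Suc N}. order_sign e (j r) ?x * order_sign e (j r) ?y) = 1"
    by (intro prod.neutral) blast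
  moreover have "order_sign e ?x ?y = index_sign ?x"
    unfolding assms(2) by (cases ?x) (simp_all add: order_sign_def index_rank_def)
  moreover have "arrangement_sign e (Suc (Suc N)) j = arrangement_sign e N j *
      (\<Prod>r\<in>{1..<Suc N}. order_sign e (j r) ?x * order_sign e (j r) ?y) * order_sign e ?x ?y"
    by (simp add: arrangement_sign_def prod.distrib mult_ac)
  ultimately show ?thesis by simp
qed

end

text \<open>This is \<open>sp_adapted\<close> without the orientation of blocks. The recursion
  transposes columns and so destroys increasing orientations, whereas this notion is
  preserved.\<close>

definition pairing_index :: "nat \<Rightarrow> nat set set \<Rightarrow> (nat \<Rightarrow> 'd + 'd) \<Rightarrow> bool" where
  "pairing_index k m j \<longleftrightarrow> (\<forall>r\<in>{1..2 * k}. \<forall>s\<in>{1..2 * k}. {r, s} \<in> m \<longleftrightarrow> j s = conj_index (j r))"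

lemma pairing_index_inj:
  assumes "m \<in> pair_partitions (2 * k)" "pairing_index k m j"
  shows "inj_on j {1..2 * k}"
proof (rule inj_onI)
  fix r s assume rs: "r \<in> {1..2 * k}" "s \<in> {1..2 * k}" "j r = j s"
  obtain t where t: "{r, t} \<in> m" using pair_partitions_ex[OF assms(1) rs(1)] .
  then have "t \<in> {1..2 * k}" using pair_partitions_mem[OF assms(1)] by blast
  then have "{s, t} \<in> m" using t rs assms(2) unfolding pairing_index_def by metis
  then show "r = s" using pair_partitions_unique[OF assms(1), of t r s] t by (simp add: insert_commute)
qed

lemma pairing_index_transpose:
  assumes "pairing_index k m j" "p \<in> {1..2 * k}" "q \<in> {1..2 * k}"
  shows "pairing_index k (perm_act (Transposition.transpose p q) m) (\<lambda>r. j (Transposition.transpose p q r))"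
proof -
  have "Transposition.transpose p q r \<in> {1..2 * k}" if "r \<in> {1..2 * k}" for r
    using that assms(2,3) by (auto simp: Transposition.transpose_def)
  then show ?thesis using assms(1) unfolding pairing_index_def perm_act_mem by blast
qed

lemma sp_adapted_pairing_index:
  assumes "m \<in> pair_partitions (2 * k)" "sp_adapted k m j"
  shows "pairing_index k m j"
proof -
  have *: "{r, s} \<in> m \<longleftrightarrow> j s = conj_index (j r)" if "r \<in> {1..2 * k}" "s \<in> {1..2 * k}" "r < s" for r s
  proof -
    have "index_sign (j r) \<noteq> 0" by (cases "j r") simp_all
    moreover have "sp_J $ j r $ j s = (if {r, s} \<in> m then 1 else 0)"
      using assms(2) that unfolding sp_adapted_def by blast
    ultimately show ?thesis by (auto simp: sp_J_entry split: if_splits)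
  qed
  show ?thesis
    unfolding pairing_index_def
  proof (intro ballI)
    fix r s assume rs: "r \<in> {1..2 * k}" "s \<in> {1..2 * k}"
    consider "r < s" | "r = s" | "s < r" by linarith
    then show "{r, s} \<in> m \<longleftrightarrow> j s = conj_index (j r)"
    proof cases
      case 2
      then show ?thesis using pair_partitions_neq[OF assms(1), of r s] by auto
    next
      case 3
      then show ?thesis using *[OF rs(2,1)] conj_index_eq_iff[of "j s" "j r"] by (auto simp: insert_commute)
    qed (use * rs in blast)
  qed
qed

lemma card_pair_partition:
  assumes "m \<in> pair_partitions (2 * k)"
  shows "card m = k"
proof -
  have p: "partition_on {1..2 * k} m" and c: "\<forall>B\<in>m. card B = 2" using assms by (simp_all add: pair_partitions_def)
  have "card (\<Union>m) = sum card m"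
    using partition_onD2[OF p] c by (intro card_Union_disjoint) (auto simp: disjoint_def disjnt_def pairwise_def card_ge_0_finite)
  then show ?thesis using c partition_onD1[OF p, symmetric] by simp
qed

text \<open>One coordinate per block is enough. The smaller end of the block receives
  \<open>Inl\<close>, which makes the entry of \<open>sp_J\<close> equal to 1 rather than
  -1.\<close>

lemma sp_adapted_exists:
  assumes m: "m \<in> pair_partitions (2 * k)" and "k \<le> CARD('d)"
  shows "\<exists>j :: nat \<Rightarrow> 'd::finite + 'd. sp_adapted k m j"
proof -
  have "finite m" using m by (metis (mono_tags, lifting) finite_UnionD finite_atLeastAtMost mem_Collect_eq pair_partitions_def partition_onD1)
  then obtain g :: "nat set \<Rightarrow> 'd" where g: "inj_on g m"
    using card_le_inj[of m "UNIV :: 'd set"] card_pair_partition[OF m] assms(2) by auto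
  define B where "B r = (THE A. A \<in> m \<and> r \<in> A)" for r
  have BI: "B r = A" if "A \<in> m" "r \<in> A" for r A
    unfolding B_def
  proof (rule the_equality)
    fix A' assume "A' \<in> m \<and> r \<in> A'"
    then show "A' = A" using that m disjointD[of m A A'] unfolding pair_partitions_def partition_on_def by blast
  qed (use that in blast)
  have B: "B r \<in> m" "r \<in> B r" if "r \<in> {1..2 * k}" for r
  proof -
    obtain s where "{r, s} \<in> m" using pair_partitions_ex[OF m \<open>r \<in> {1..2 * k}\<close>] .
    then show "B r \<in> m" "r \<in> B r" using BI[of "{r, s}" r] by auto
  qed
  define j where "j r = (if r = Min (B r) then Inl (g (B r)) else Inr (g (B r)))" for r
  have "sp_J $ j r $ j s = (if {r, s} \<in> m then 1 else 0)" if rs: "r \<in> {1..2 * k}" "s \<in> {1..2 * k}" "r < s" for r s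
  proof (cases "{r, s} \<in> m")
    case True
    then have "B r = {r, s}" "B s = {r, s}" using BI by auto
    then show ?thesis using True rs by (simp add: j_def sp_J_entry)
  next
    case False
    have "B r \<noteq> B s"
    proof
      assume "B r = B s"
      then have "{r, s} \<subseteq> B r" "B r \<in> m" using B rs by auto
      moreover from this have "card (B r) = 2" "finite (B r)" using m by (auto simp: pair_partitions_def card_ge_0_finite)
      ultimately have "{r, s} = B r" using rs by (intro card_subset_eq) auto
      then show False using False \<open>B r \<in> m\<close> by simp
    qed
    then have "g (B r) \<noteq> g (B s)" using inj_onD[OF g] B rs by blast
    then show ?thesis using False by (auto simp: j_def sp_J_entry)
  qed
  then show ?thesis unfolding sp_adapted_def by blast
qed

text \<open>The value 1, and not -1, of \<open>sp_J\<close> on a standard block forces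
  \<open>Inl\<close> at its odd end.\<close>

lemma sp_adapted_std_index:
  assumes "sp_adapted k (std_pairing k) i" "std_pairing k \<in> pair_partitions (2 * k)"
  obtains f where "inj_on f {1..k}" "\<And>r. r \<in> {1..2 * k} \<Longrightarrow> i r = std_index f r"
proof -
  have P: "pairing_index k (std_pairing k) i" using sp_adapted_pairing_index assms by blast
  define f where "f a = projl (i (2 * a - 1))" for a
  have L: "i (2 * a - 1) = Inl (f a) \<and> i (2 * a) = Inr (f a)" if "a \<in> {1..k}" for a
  proof -
    have "{2 * a - 1, 2 * a} \<in> std_pairing k" "2 * a - 1 \<in> {1..2 * k}" "2 * a \<in> {1..2 * k}" "2 * a - 1 < 2 * a"
      using that by (auto simp: std_pairing_def)
    then have "sp_J $ i (2 * a - 1) $ i (2 * a) = 1"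
      using assms(1) unfolding sp_adapted_def by metis
    then show ?thesis by (cases "i (2 * a - 1)") (auto simp: sp_J_entry f_def split: if_splits)
  qed
  have "inj_on f {1..k}"
  proof (rule inj_onI)
    fix a a' assume a: "a \<in> {1..k}" "a' \<in> {1..k}" "f a = f a'"
    then have "i (2 * a) = i (2 * a')" using L by simp
    then have "2 * a = 2 * a'" using inj_onD[OF pairing_index_inj[OF assms(2) P], of "2 * a" "2 * a'"] a by auto
    then show "a = a'" by simp
  qed
  moreover have "i r = std_index f r" if r: "r \<in> {1..2 * k}" for r
  proof (cases "odd r")
    case True
    then obtain b where "r = Suc (2 * b)" by (auto elim: oddE)
    then show ?thesis using L[of "Suc b"] r by simp
  next
    case False
    then obtain b where "r = 2 * b" by (auto elim: evenE)
    then show ?thesis using L[of b] r by (simp add: std_index_def)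
  qed
  ultimately show ?thesis using that by blast
qed

lemma std_pairing_pair_partitions: "std_pairing k \<in> pair_partitions (2 * k)"
proof -
  have "\<Union>(std_pairing k) = {1..2 * k}"
  proof
    show "{1..2 * k} \<subseteq> \<Union>(std_pairing k)" using mem_std_pairing by blast
  qed (auto simp: std_pairing_def)
  moreover have "disjoint (std_pairing k)"
    unfolding disjoint_def std_pairing_def by (auto; presburger)
  ultimately show ?thesis
    by (auto simp: pair_partitions_def partition_on_def std_pairing_def)
qed

section \<open>Identification of the moments with the path series\<close>

lemma finite_pair_partitions: "finite (pair_partitions n)"
  by (rule finite_subset[of _ "Pow (Pow {1..n})"]) (auto simp: pair_partitions_def partition_on_def)

text \<open>The difference of the two sides solves the homogeneous recursion, which is a contraction with
  factor \<open>2k / 2d\<close>.\<close>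

lemma moment_eq_path_series:
  fixes M :: "('d::finite) sp_matrix measure"
  assumes haar: "haar_probability_Sp M" and C: "12 * (real K)\<^sup>2 \<le> C" "C < 2 * real CARD('d)"
    and K: "K \<le> CARD('d)" and e: "inj (e :: 'd \<Rightarrow> nat)"
    and "k \<le> K" "inj_on f {1..k}" "m \<in> pair_partitions (2 * k)" "pairing_index k m j"
  shows "moment M (2 * k) (std_index f) j = arrangement_sign e (2 * k) j * complex_of_real (path_series k (2 * real CARD('d)) m)"
  using assms(6-)
proof (induction k arbitrary: f m j)
  case 0
  interpret prob_space M using haar by (simp add: haar_probability_Sp_def)
  show ?case using prob_space by (simp add: moment_def arrangement_sign_def path_series_0)
next
  case (Suc k)
  let ?D = "2 * real CARD('d)"
  define W where "W j = moment M (2 * Suc k) (std_index f) j" for j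
  define \<Delta> where "\<Delta> j m = W j - arrangement_sign e (2 * Suc k) j * complex_of_real (path_series (Suc k) ?D m)" for j m
  let ?t = "\<lambda>q. Transposition.transpose q (2 * k + 1)"
  have D: "0 < ?D" by simp
  have rec: "?D * \<Delta> j m = - (\<Sum>q = 1..2 * k. \<Delta> (\<lambda>r. j (?t q r)) (perm_act (?t q) m))"
    if m: "m \<in> pair_partitions (2 * Suc k)" and j: "pairing_index (Suc k) m j" for j m
  proof -
    let ?s = "arrangement_sign e (2 * Suc k) j" and ?b = "{2 * k + 1, 2 * k + 2}"
    have inj: "inj_on j {1..2 * Suc k}" using pairing_index_inj[OF m j] .
    \<comment> \<open>This sign reconciles the two recursions: it moves the transposed terms of
      \<open>moment_recursion\<close> to the other side, where \<open>path_series_recursion\<close>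
      has them.\<close>
    have sgn: "arrangement_sign e (2 * Suc k) (\<lambda>r. j (?t q r)) = - ?s" if "q \<in> {1..2 * k}" for q
      using that by (intro arrangement_sign_transpose[OF e inj]) auto
    have b: "?b \<in> m \<longleftrightarrow> j (2 * k + 2) = conj_index (j (2 * k + 1))"
      using j unfolding pairing_index_def by simp
    have rhs: "sp_J $ j (2 * k + 1) $ j (2 * k + 2) * moment M (2 * k) (std_index f) j =
      ?s * complex_of_real (if ?b \<in> m then path_series k ?D (m - {?b}) else 0)"
    proof (cases "?b \<in> m")
      case True
      have "pairing_index k (m - {?b}) j"
        unfolding pairing_index_def
      proof (intro ballI)
        fix r s assume rs: "r \<in> {1..2 * k}" "s \<in> {1..2 * k}"
        then have "{r, s} \<noteq> ?b" by (auto simp: doubleton_eq_iff)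
        moreover have "{r, s} \<in> m \<longleftrightarrow> j s = conj_index (j r)"
          using j rs unfolding pairing_index_def by auto
        ultimately show "{r, s} \<in> m - {?b} \<longleftrightarrow> j s = conj_index (j r)" by simp
      qed
      moreover have "inj_on f {1..k}" using inj_on_subset[OF Suc.prems(2), of "{1..k}"] by auto
      ultimately have "moment M (2 * k) (std_index f) j = arrangement_sign e (2 * k) j * complex_of_real (path_series k ?D (m - {?b}))"
        using Suc.IH Suc.prems(1) pair_partitions_Suc[OF m True] by simp
      \<comment> \<open>The factor \<open>index_sign\<close> is also the entry of
        \<open>sp_J\<close>, so the signs of the two levels match.\<close>
      moreover have "?s = index_sign (j (2 * k + 1)) * arrangement_sign e (2 * k) j"
        using arrangement_sign_conj[OF e, of j "2 * k"] inj b True by simp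
      ultimately show ?thesis using b True by (simp add: sp_J_entry)
    qed (use b in \<open>simp add: sp_J_entry\<close>)
    have "?D * W j + (\<Sum>q = 1..2 * k. W (\<lambda>r. j (?t q r))) = ?s * complex_of_real (if ?b \<in> m then path_series k ?D (m - {?b}) else 0)"
      using moment_recursion[OF haar Suc.prems(2), of j] unfolding rhs W_def by simp
    moreover have "?D * (?s * complex_of_real (path_series (Suc k) ?D m)) =
      (\<Sum>q = 1..2 * k. ?s * complex_of_real (path_series (Suc k) ?D (perm_act (?t q) m))) +
      ?s * complex_of_real (if ?b \<in> m then path_series k ?D (m - {?b}) else 0)"
    proof -
      have "complex_of_real ?D * complex_of_real (path_series (Suc k) ?D m) = complex_of_real (\<Sum>q = 1..2 * k. path_series (Suc k) ?D (perm_act (?t q) m)) +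
         complex_of_real (if ?b \<in> m then path_series k ?D (m - {?b}) else 0)"
        unfolding of_real_mult[symmetric] of_real_add[symmetric]
        using path_series_recursion[OF C Suc.prems(1) m] by simp
      then have "?s * (complex_of_real ?D * complex_of_real (path_series (Suc k) ?D m)) = ?s * (complex_of_real (\<Sum>q = 1..2 * k. path_series (Suc k) ?D (perm_act (?t q) m)) +
         complex_of_real (if ?b \<in> m then path_series k ?D (m - {?b}) else 0))" by simp
      then show ?thesis by (simp only: of_real_sum sum_distrib_left distrib_left mult.left_commute)
    qed
    moreover have "(\<Sum>q = 1..2 * k. \<Delta> (\<lambda>r. j (?t q r)) (perm_act (?t q) m)) =
      (\<Sum>q = 1..2 * k. W (\<lambda>r. j (?t q r))) + (\<Sum>q = 1..2 * k. ?s * complex_of_real (path_series (Suc k) ?D (perm_act (?t q) m)))"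
      unfolding \<Delta>_def sum.distrib[symmetric] using sgn by (intro sum.cong) simp_all
    ultimately show ?thesis unfolding \<Delta>_def right_diff_distrib by (simp add: algebra_simps)
  qed
  \<comment> \<open>The iteration runs through other pairings, so the bound has to be uniform; there
    are finitely many pairings.\<close>
  obtain B where B: "path_series (Suc k) ?D m \<le> B" if "m \<in> pair_partitions (2 * Suc k)" for m
    using finite_pair_partitions[of "2 * Suc k"] by (meson finite_imageI bdd_above_finite bdd_above.unfold imageI)
  have bound: "cmod (\<Delta> j m) \<le> (real (2 * k) / ?D) ^ t * (1 + B)"
    if "m \<in> pair_partitions (2 * Suc k)" "pairing_index (Suc k) m j" for t j m
    using that
  proof (induction t arbitrary: j m)
    case 0
    have "cmod (\<Delta> j m) \<le> cmod (W j) + cmod (arrangement_sign e (2 * Suc k) j * complex_of_real (path_series (Suc k) ?D m))"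
      unfolding \<Delta>_def by (rule norm_triangle_ineq4)
    also have "\<dots> \<le> 1 + B"
      using moment_le_1[OF haar] B[OF 0(1)] path_series_nonneg[OF C Suc.prems(1) 0(1)]
      by (intro add_mono) (simp_all add: W_def norm_mult del: mult_Suc_right)
    finally show ?case by simp
  next
    case (Suc t)
    have "?D * cmod (\<Delta> j m) = cmod (?D * \<Delta> j m)" by (simp add: norm_mult)
    also have "\<dots> \<le> (\<Sum>q = 1..2 * k. cmod (\<Delta> (\<lambda>r. j (?t q r)) (perm_act (?t q) m)))"
      unfolding rec[OF Suc.prems] norm_minus_cancel by (rule norm_sum)
    also have "\<dots> \<le> (\<Sum>q = 1..2 * k. (real (2 * k) / ?D) ^ t * (1 + B))"
      using Suc.prems by (intro sum_mono Suc.IH perm_act_apex pairing_index_transpose) auto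
    also have "\<dots> = ?D * ((real (2 * k) / ?D) ^ Suc t * (1 + B))" using D by simp
    finally show ?case using D by (simp only: mult_le_cancel_left_pos)
  qed
  \<comment> \<open>The ratio is below 1 because \<open>k < K \<le> CARD('d)\<close>.\<close>
  have "(\<lambda>t. (real (2 * k) / ?D) ^ t * (1 + B)) \<longlonglongrightarrow> 0 * (1 + B)"
    using K Suc.prems(1) by (intro tendsto_mult_right LIMSEQ_realpow_zero) (simp_all add: divide_less_eq)
  then have "cmod (\<Delta> j m) \<le> 0"
    using bound[OF Suc.prems(3,4)] by (intro tendsto_lowerbound[of "\<lambda>t. (real (2 * k) / ?D) ^ t * (1 + B)"]) auto
  then show ?case by (simp add: \<Delta>_def W_def)
qed

text \<open>Whatever indices the choice operator returns, they influence only the arrangement sign,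
  which has modulus 1.\<close>

lemma cmod_Wg_Sp:
  fixes M :: "('d::finite) sp_matrix measure"
  assumes "haar_probability_Sp M" "12 * (real k)\<^sup>2 \<le> C" "C < 2 * real CARD('d)" "k \<le> CARD('d)"
    and m: "m \<in> pair_partitions (2 * k)"
  shows "cmod (Wg_Sp M k m) = path_series k (2 * real CARD('d)) m"
proof -
  define i :: "nat \<Rightarrow> 'd + 'd" where "i = (SOME i. sp_adapted k (std_pairing k) i)"
  define j :: "nat \<Rightarrow> 'd + 'd" where "j = (SOME j. sp_adapted k m j)"
  have i: "sp_adapted k (std_pairing k) i"
    unfolding i_def using someI_ex[OF sp_adapted_exists[OF std_pairing_pair_partitions assms(4)]] .
  have "sp_adapted k m j"
    unfolding j_def using someI_ex[OF sp_adapted_exists[OF m assms(4)]] .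
  then have j: "pairing_index k m j" using sp_adapted_pairing_index m by blast
  obtain f where f: "inj_on f {1..k}" "\<And>r. r \<in> {1..2 * k} \<Longrightarrow> i r = std_index f r"
    using sp_adapted_std_index[OF i std_pairing_pair_partitions] by blast
  obtain e :: "'d \<Rightarrow> nat" where e: "inj e"
    using finite_imp_inj_to_nat_seg[of "UNIV :: 'd set"] by auto
  have "Wg_Sp M k m = moment M (2 * k) i j" by (simp add: Wg_Sp_def moment_def i_def j_def)
  also have "\<dots> = moment M (2 * k) (std_index f) j" using f(2) by (intro moment_cong) auto
  also have "\<dots> = arrangement_sign e (2 * k) j * complex_of_real (path_series k (2 * real CARD('d)) m)"
    by (rule moment_eq_path_series[OF assms(1-4) e order_refl f(1) m j])
  finally show ?thesis using path_series_nonneg[OF assms(2,3) order_refl m] by (simp add: norm_mult)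
qed

theorem theorem4p10:
  fixes M :: "('d::finite) sp_matrix measure" and d k :: nat and m :: "nat set set"
  assumes "CARD('d) = d"
    and "haar_probability_Sp M"
    and "m \<in> pair_partitions (2 * k)"
    and "real d > 6 * real k powr (7 / 2)"
  shows "real (card (weingarten_paths k m (pairing_norm k m)))
           / (1 - (real k - 1) / (2 * (real d)\<^sup>2))
         \<le> (2 * real d) ^ (pairing_norm k m + k) * cmod (Wg_Sp M k m)
       \<and> (2 * real d) ^ (pairing_norm k m + k) * cmod (Wg_Sp M k m)
         \<le> real (card (weingarten_paths k m (pairing_norm k m)))
             / (1 - 6 * real k powr (7 / 2) / real d)"
proof -
  \<comment> \<open>With \<open>D = 2 * d\<close> this makes \<open>C / D\<close> the ratio in the
    upper bound, and it dominates the \<open>12 * k^2\<close> asked for by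
    \<open>npaths_excess_le\<close>. For \<open>k = 0\<close> the power is 0 by the convention for
    \<open>powr\<close>.\<close>
  define C where "C = 12 * real k powr (7 / 2)"
  have k2: "(real k)\<^sup>2 \<le> real k powr (7 / 2)"
  proof (cases "k = 0")
    case False
    then have "real k powr 2 \<le> real k powr (7 / 2)" by (intro powr_mono) auto
    then show ?thesis using False by (simp add: powr_numeral)
  qed simp
  have C: "12 * (real k)\<^sup>2 \<le> C" using k2 by (simp add: C_def)
  have CD: "C < 2 * real d" using assms(4) by (simp add: C_def)
  have kk: "real k \<le> (real k)\<^sup>2" by (simp add: power2_eq_square flip: of_nat_mult)
  then have kd: "k \<le> d" using k2 assms(4) by linarith
  have W: "cmod (Wg_Sp M k m) = path_series k (2 * real d) m"
    using cmod_Wg_Sp[OF assms(2) C _ _ assms(3)] CD kd assms(1) by simp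
  have N: "card (weingarten_paths k m (pairing_norm k m)) = npaths k (pairing_norm k m) m"
    using card_weingarten_paths[OF assms(3)] by blast
  have d: "0 < d" using assms(1) by auto
  have q: "2 * (real k - 1) / (2 * real d)\<^sup>2 = (real k - 1) / (2 * (real d)\<^sup>2)"
    using d by (simp add: power_mult_distrib field_simps)
  have "real k - 1 < 2 * (real d)\<^sup>2"
  proof -
    have "real k \<le> real d" "real d \<le> (real d)\<^sup>2" using kd by (simp_all add: power2_eq_square flip: of_nat_mult)
    then show ?thesis by linarith
  qed
  then have q1: "2 * (real k - 1) / (2 * real d)\<^sup>2 < 1" unfolding q using d by (simp add: divide_less_eq)
  show ?thesis
    unfolding W N
    using path_series_lower[OF C CD order_refl assms(3) q1] path_series_upper[OF C CD order_refl assms(3)]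
    unfolding q by (simp add: C_def)
qed

end
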